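(* Let $0<q<p<\infty$, $\alpha>0$, and let $g$ and $\psi$ be entire functions on $\mathbb{C}$. Then the following are equivalent: (i) $V_{(g,\psi)}:F_\alpha^p\to F_\alpha^q$ is bounded. (ii) $V_{(g,\psi)}:F_\alpha^p\to F_\alpha^q$ is compact. (iii) $B_{(\psi,\alpha)}(|g|^q)\in L^{\frac{p}{p-q}}(\mathbb{C},dm)$. Moreover, in this case $$\|V_{(g,\psi)}\|\simeq\Big(\int_{\mathbb{C}}\big(B_{(\psi,\alpha)}(|g|^q)(w)\big)^{p/(p-q)}\,dm(w)\Big)^{\frac{p-q}{pq}},$$ that is, each side is bounded by a constant multiple of the other, with constants depending only on $p,q,\alpha$.
   Context: Let $dm$ be Lebesgue measure on $\mathbb{C}$. For $0<p<\infty$ and $\alpha>0$, the Fock space $F_\alpha^p$ consists of all entire functions $f$ with $$\|f\|_{(p,\alpha)}^p=\frac{p\alpha}{2\pi}\int_{\mathbb{C}}|f(z)|^pe^{-\frac{p\alpha}{2}|z|^2}\,dm(z)<\infty.$$ For entire functions $g,\psi$, the operator $V_{(g,\psi)}$ acts on entire functions $f$ by $$V_{(g,\psi)}f(z)=\int_0^z f(\psi(w))g'(w)\,dw.$$ For $0<q<\infty$, the Berezin type integral transform is $$B_{(\psi,\alpha)}(|g|^q)(w)=\int_{\mathbb{C}}e^{\frac{q\alpha}{2}\left(2\Re\langle\psi(z),w\rangle-|z|^2-|w|^2\right)}\frac{|g'(z)|^q}{(1+|z|)^q}\,dm(z)\in[0,\infty],\quad w\in\mathbb{C},$$ where $\langle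 a,b\rangle=a\overline{b}$. The norm $\|V_{(g,\psi)}\|$ is the operator (quasi-)norm $\sup\{\|V_{(g,\psi)}f\|_{(q,\alpha)}:\|f\|_{(p,\alpha)}\le1\}$. *)

theory Defs
  imports "HOL-Complex_Analysis.Complex_Analysis"
begin

text \<open>Real powers of extended nonnegative reals; only used for exponents \<open>a > 0\<close>,
  where \<open>\<infinity>\<close> to the power \<open>a\<close> is \<open>\<infinity>\<close>.\<close>

definition epowr :: "ennreal \<Rightarrow> real \<Rightarrow> ennreal" where
  "epowr x a = (if x = \<infinity> then \<infinity> else ennreal (enn2real x powr a))"

definition fock_norm :: "real \<Rightarrow> real \<Rightarrow> (complex \<Rightarrow> complex) \<Rightarrow> ennreal" where
  "fock_norm p \<alpha> f =
     epowr (ennreal (p * \<alpha> / (2 * pi)) *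
       (\<integral>\<^sup>+z. ennreal (norm (f z) powr p * exp (- (p * \<alpha> / 2) * (norm z)\<^sup>2)) \<partial>lborel)) (1 / p)"

definition fock_space :: "real \<Rightarrow> real \<Rightarrow> (complex \<Rightarrow> complex) set" where
  "fock_space p \<alpha> = {f. f holomorphic_on UNIV \<and> fock_norm p \<alpha> f < \<infinity>}"

text \<open>For \<open>p < 1\<close> only the \<open>p\<close>-th power of the quasi-norm is subadditive, hence the exponent
  \<open>min 1 p\<close>. It does not affect the topology.\<close>

definition fock_dist :: "real \<Rightarrow> real \<Rightarrow> (complex \<Rightarrow> complex) \<Rightarrow> (complex \<Rightarrow> complex) \<Rightarrow> real" where
  "fock_dist p \<alpha> f h = enn2real (fock_norm p \<alpha> (\<lambda>z. f z - h z)) powr (min 1 p)"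

definition fock_topology :: "real \<Rightarrow> real \<Rightarrow> (complex \<Rightarrow> complex) topology" where
  "fock_topology p \<alpha> = Metric_space.mtopology (fock_space p \<alpha>) (fock_dist p \<alpha>)"

definition fock_bounded ::
  "real \<Rightarrow> real \<Rightarrow> real \<Rightarrow> ((complex \<Rightarrow> complex) \<Rightarrow> complex \<Rightarrow> complex) \<Rightarrow> bool" where
  "fock_bounded p q \<alpha> T \<longleftrightarrow>
     T ` fock_space p \<alpha> \<subseteq> fock_space q \<alpha> \<and>
     (\<exists>C::real. \<forall>f\<in>fock_space p \<alpha>. fock_norm q \<alpha> (T f) \<le> ennreal C * fock_norm p \<alpha> f)"

text \<open>The inclusion of ranges is not redundant: \<open>closure_of\<close> ignores points outside the
  underlying space.\<close>

definition fock_compact ::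
  "real \<Rightarrow> real \<Rightarrow> real \<Rightarrow> ((complex \<Rightarrow> complex) \<Rightarrow> complex \<Rightarrow> complex) \<Rightarrow> bool" where
  "fock_compact p q \<alpha> T \<longleftrightarrow>
     T ` fock_space p \<alpha> \<subseteq> fock_space q \<alpha> \<and>
     compactin (fock_topology q \<alpha>)
       (fock_topology q \<alpha> closure_of (T ` {f \<in> fock_space p \<alpha>. fock_norm p \<alpha> f \<le> 1}))"

definition fock_opnorm ::
  "real \<Rightarrow> real \<Rightarrow> real \<Rightarrow> ((complex \<Rightarrow> complex) \<Rightarrow> complex \<Rightarrow> complex) \<Rightarrow> ennreal" where
  "fock_opnorm p q \<alpha> T = (SUP f\<in>{f \<in> fock_space p \<alpha>. fock_norm p \<alpha> f \<le> 1}. fock_norm q \<alpha> (T f))"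

definition volterra_comp ::
  "(complex \<Rightarrow> complex) \<Rightarrow> (complex \<Rightarrow> complex) \<Rightarrow> (complex \<Rightarrow> complex) \<Rightarrow> complex \<Rightarrow> complex" where
  "volterra_comp g \<psi> f z = contour_integral (linepath 0 z) (\<lambda>w. f (\<psi> w) * deriv g w)"

definition berezin ::
  "real \<Rightarrow> real \<Rightarrow> (complex \<Rightarrow> complex) \<Rightarrow> (complex \<Rightarrow> complex) \<Rightarrow> complex \<Rightarrow> ennreal" where
  "berezin q \<alpha> \<psi> g w =
     (\<integral>\<^sup>+z. ennreal (exp (q * \<alpha> / 2 * (2 * Re (\<psi> z * cnj w) - (norm z)\<^sup>2 - (norm w)\<^sup>2)) *
        (norm (deriv g z) powr q / (1 + norm z) powr q)) \<partial>lborel)"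

definition Lr :: "real \<Rightarrow> (complex \<Rightarrow> ennreal) set" where
  "Lr r = {h. h \<in> borel_measurable lborel \<and> (\<integral>\<^sup>+w. epowr (h w) r \<partial>lborel) < \<infinity>}"

end

theory Submission
  imports Defs
begin

text \<open>
  Put \<open>c = q \<alpha> / 2\<close> and let \<open>F = volterra_comp g \<psi> f\<close>, so that \<open>F 0 = 0\<close> and
  \<open>F' z = f (\<psi> z) g' z\<close>. The proof rests on three facts.

  First, a Littlewood--Paley description of the Fock norm that holds for all exponents \<open>q > 0\<close>: if
  \<open>F 0 = 0\<close>, then the integral of \<open>norm (F z) powr q * exp (- c * (norm z)\<^sup>2)\<close> is comparable to
  the same integral for \<open>norm (F' z) / (1 + norm z)\<close> (\<open>fock_derivative_upper_bound\<close> and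
  \<open>fock_derivative_lower_bound\<close>). On discs of radius about \<open>1 / (1 + norm z)\<close> the Gaussian weight
  is almost constant, so that Cauchy's estimate and the sub-mean value property give the upper bound.
  For the lower bound the plane is cut into annuli \<open>n \<le> (norm z)\<^sup>2 < n + 1\<close>. A dilation moves each
  annulus into the preceding one; this gains the factor \<open>exp (- c)\<close>, while the values of \<open>F\<close> change
  only by a local supremum of \<open>F'\<close>, and the resulting recursion is summed.

  Secondly, the Berezin transform is a convolution with a Gaussian. The first fact says that the
  \<open>q\<close>-th power of the norm of \<open>F\<close> is comparable to the integral of
  \<open>norm (f \<zeta>) powr q * exp (- c * (norm \<zeta>)\<^sup>2)\<close> against the image \<open>\<mu>\<close> under \<open>\<psi>\<close> of the measure with
  density \<open>carleson_density\<close>, and completing the square gives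
  \<open>berezin q \<alpha> \<psi> g w = \<integral> exp (- c * (dist \<zeta> w)\<^sup>2) d\<mu>(\<zeta>)\<close>. The sub-mean value property of \<open>f\<close>
  times an exponential reproduces exactly this Gaussian (\<open>fock_pointwise_gaussian_bound\<close>). Hence the
  integral against \<open>\<mu>\<close> is at most a constant times the integral against
  \<open>berezin q \<alpha> \<psi> g w\<close> and Lebesgue measure, and comparing the transform \<open>B\<close> pointwise
  with \<open>\<theta> * X powr (p - q)\<close>, where \<open>X = norm (f w) * exp (- (\<alpha> / 2) * (norm w)\<^sup>2)\<close>,
  bounds the operator when \<open>B\<close> is in \<open>L\<close> with exponent \<open>r = p / (p - q)\<close>. The same comparison with dominated
  convergence, Montel's theorem and Fatou's lemma shows that the image of the unit ball is compact. A
  compact set is bounded, which leads from compactness back to boundedness.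

  Thirdly, a bounded operator is tested on sums of normalised reproducing kernels with centres in
  \<open>\<int> + \<i> \<int>\<close>. The norms of such sums are controlled by the \<open>p\<close>-th powers of the coefficients
  \<open>a j\<close> (\<open>lattice_superposition_bound\<close>). Averaging over all partial sums isolates each single term
  (\<open>sum_norm_powr_subset_sums\<close>), and thereby \<open>\<Sum>j. a j powr q * \<mu>(Q j)\<close> is bounded by the operator
  norm, where \<open>Q j\<close> are the unit squares. The extremal \<open>a j = \<mu>(Q j) powr (1 / (p - q))\<close> puts
  \<open>\<mu>(Q j)\<close> into the sequence space with exponent \<open>r\<close>, and \<open>B\<close> is dominated by a Gaussian
  superposition with these coefficients. Every constant depends on \<open>p\<close>, \<open>q\<close>, \<open>\<alpha>\<close> only, which gives the
  comparison of norms.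
\<close>

section \<open>Lebesgue measure on the plane and the area mean value\<close>

lemma lborel_complex_eq_prod:
  "(lborel :: complex measure) = distr (lborel \<Otimes>\<^sub>M lborel) borel (\<lambda>(x, y). Complex x y)"
proof (rule lborel_eqI)
  have [measurable]: "(\<lambda>(x, y). Complex x y) \<in> borel_measurable (borel \<Otimes>\<^sub>M borel)"
    unfolding Complex_eq case_prod_beta by measurable
  fix l u :: complex assume le: "\<And>b. b \<in> Basis \<Longrightarrow> l \<bullet> b \<le> u \<bullet> b"
  have "(\<lambda>(x, y). Complex x y) -` box l u = box (Re l) (Re u) \<times> box (Im l) (Im u)"
    by (auto simp: in_box_complex_iff box_real)
  moreover have "Re l \<le> Re u" "Im l \<le> Im u"
    using le[of 1] le[of \<i>] by (auto simp: Basis_complex_def)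
  ultimately show "emeasure (distr (lborel \<Otimes>\<^sub>M lborel) borel (\<lambda>(x, y). Complex x y)) (box l u)
      = (\<Prod>b\<in>Basis. (u - l) \<bullet> b)"
    by (simp add: emeasure_distr space_pair_measure lborel.emeasure_pair_measure_Times
        Basis_complex_def ennreal_mult)
qed simp

lemma borel_measurable_Complex [measurable (raw)]:
  fixes f g :: "'a \<Rightarrow> real"
  assumes [measurable]: "f \<in> borel_measurable M" "g \<in> borel_measurable M"
  shows "(\<lambda>x. Complex (f x) (g x)) \<in> borel_measurable M"
  unfolding Complex_eq by measurable

lemma ball_sets_borel [measurable]: "ball (a :: 'a :: metric_space) r \<in> sets borel"
  by simp

lemma nn_integral_complex_Re_Im:
  fixes f :: "complex \<Rightarrow> ennreal"
  assumes [measurable]: "f \<in> borel_measurable borel"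
  shows "(\<integral>\<^sup>+z. f z \<partial>lborel) = (\<integral>\<^sup>+x. \<integral>\<^sup>+y. f (Complex x y) \<partial>lborel \<partial>lborel)"
proof -
  have "(\<integral>\<^sup>+z. f z \<partial>lborel) = (\<integral>\<^sup>+p. f (case p of (x, y) \<Rightarrow> Complex x y) \<partial>(lborel \<Otimes>\<^sub>M lborel))"
    by (subst lborel_complex_eq_prod) (simp add: nn_integral_distr case_prod_beta)
  also have "\<dots> = (\<integral>\<^sup>+x. \<integral>\<^sup>+y. f (Complex x y) \<partial>lborel \<partial>lborel)"
    by (subst lborel.nn_integral_fst[symmetric]) (simp_all add: case_prod_beta)
  finally show ?thesis .
qed

lemma nn_integral_complex_Im_Re:
  fixes f :: "complex \<Rightarrow> ennreal"
  assumes [measurable]: "f \<in> borel_measurable borel"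
  shows "(\<integral>\<^sup>+z. f z \<partial>lborel) = (\<integral>\<^sup>+y. \<integral>\<^sup>+x. f (Complex x y) \<partial>lborel \<partial>lborel)"
  unfolding nn_integral_complex_Re_Im[OF assms]
  by (rule lborel_pair.Fubini'[symmetric]) (simp add: case_prod_beta)

lemma nn_integral_lborel_translate:
  fixes a :: "'a :: euclidean_space"
  assumes [measurable]: "f \<in> borel_measurable borel"
  shows "(\<integral>\<^sup>+z. f (a + z) \<partial>lborel) = (\<integral>\<^sup>+z. f z \<partial>lborel)"
  by (subst (2) lborel_distr_plus[of a, symmetric]) (simp add: nn_integral_distr)

lemma nn_integral_lborel_scale:
  fixes f :: "'a :: euclidean_space \<Rightarrow> ennreal"
  assumes [measurable]: "f \<in> borel_measurable borel" and t: "t > 0"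
  shows "(\<integral>\<^sup>+z. f z \<partial>lborel) = ennreal (t ^ DIM('a)) * (\<integral>\<^sup>+z. f (t *\<^sub>R z) \<partial>lborel)"
  using t by (subst lborel_affine[of t 0])
     (simp_all add: nn_integral_density nn_integral_distr nn_integral_cmult ennreal_power)

lemma nn_integral_complex_shear_Re:
  fixes f :: "complex \<Rightarrow> ennreal"
  assumes [measurable]: "f \<in> borel_measurable borel"
  shows "(\<integral>\<^sup>+z. f (z + of_real (a * Im z)) \<partial>lborel) = (\<integral>\<^sup>+z. f z \<partial>lborel)"
proof -
  have "(\<integral>\<^sup>+z. f (z + of_real (a * Im z)) \<partial>lborel)
      = (\<integral>\<^sup>+y. \<integral>\<^sup>+x. f (Complex (a * y + x) y) \<partial>lborel \<partial>lborel)"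
    by (subst nn_integral_complex_Im_Re) (auto intro!: nn_integral_cong arg_cong[where f=f] complex_eqI)
  also have "\<dots> = (\<integral>\<^sup>+y. \<integral>\<^sup>+x. f (Complex x y) \<partial>lborel \<partial>lborel)"
    by (intro nn_integral_cong nn_integral_lborel_translate) measurable
  finally show ?thesis by (simp add: nn_integral_complex_Im_Re)
qed

lemma nn_integral_complex_shear_Im:
  fixes f :: "complex \<Rightarrow> ennreal"
  assumes [measurable]: "f \<in> borel_measurable borel"
  shows "(\<integral>\<^sup>+z. f (z + \<i> * of_real (a * Re z)) \<partial>lborel) = (\<integral>\<^sup>+z. f z \<partial>lborel)"
proof -
  have "(\<integral>\<^sup>+z. f (z + \<i> * of_real (a * Re z)) \<partial>lborel)
      = (\<integral>\<^sup>+x. \<integral>\<^sup>+y. f (Complex x (a * x + y)) \<partial>lborel \<partial>lborel)"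
    by (subst nn_integral_complex_Re_Im) (auto intro!: nn_integral_cong arg_cong[where f=f] complex_eqI)
  also have "\<dots> = (\<integral>\<^sup>+x. \<integral>\<^sup>+y. f (Complex x y) \<partial>lborel \<partial>lborel)"
    by (intro nn_integral_cong nn_integral_lborel_translate) measurable
  finally show ?thesis by (simp add: nn_integral_complex_Re_Im)
qed

text \<open>A rotation other than the half turn is a product of three shears, and a shear preserves
  Lebesgue measure because it translates each line of one coordinate direction. The half turn is the
  square of the rotation by \<open>\<i>\<close>.\<close>
lemma nn_integral_complex_rotate:
  fixes f :: "complex \<Rightarrow> ennreal"
  assumes [measurable]: "f \<in> borel_measurable borel" and u: "norm u = 1"
  shows "(\<integral>\<^sup>+z. f (u * z) \<partial>lborel) = (\<integral>\<^sup>+z. f z \<partial>lborel)"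
proof -
  have shears: "(\<integral>\<^sup>+z. h (v * z) \<partial>lborel) = (\<integral>\<^sup>+z. h z \<partial>lborel)"
    if [measurable]: "h \<in> borel_measurable borel" and v: "norm v = 1" "v \<noteq> -1" for h :: "complex \<Rightarrow> ennreal" and v
  proof -
    define a where "a = - Im v / (1 + Re v)"
    have sq: "(Re v)\<^sup>2 + (Im v)\<^sup>2 = 1" using v(1) by (simp add: cmod_def)
    have "Re v \<noteq> -1"
      using sq v(2) by (auto simp: complex_eq_iff)
    then have nz: "1 + Re v \<noteq> 0" by linarith
    have "1 + a * Im v = ((1 + Re v) - (Im v)\<^sup>2) / (1 + Re v)"
      using nz by (simp add: a_def field_simps power2_eq_square)
    also have "(1 + Re v) - (Im v)\<^sup>2 = Re v * (1 + Re v)" using sq by (simp add: algebra_simps power2_eq_square)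
    finally have 1: "1 + a * Im v = Re v" using nz by simp
    have 2: "a * (1 + Re v) = - Im v" using nz by (simp add: a_def)
    define A where "A z = z + of_real (a * Im z)" for z
    define B where "B z = z + \<i> * of_real (Im v * Re z)" for z
    have "v * z = A (B (A z))" for z
    proof -
      have im: "Im (B (A z)) = Im v * Re z + Re v * Im z"
          proof -
        have "Im (B (A z)) = Im v * Re z + (1 + a * Im v) * Im z"
          by (simp add: A_def B_def algebra_simps)
        then show ?thesis unfolding 1 .
      qed
      have "Re (A (B (A z))) = Re z + a * Im z + a * (Im v * Re z + Re v * Im z)"
        using im by (subst A_def) (simp add: B_def A_def)
      also have "\<dots> = (1 + a * Im v) * Re z + (a * (1 + Re v)) * Im z" by (simp add: algebra_simps)
      also have "\<dots> = Re (v * z)" unfolding 1 2 by simp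
      finally have "Re (A (B (A z))) = Re (v * z)" .
      moreover have "Im (A (B (A z))) = Im (v * z)" using im by (subst A_def) simp
      ultimately show ?thesis by (simp add: complex_eq_iff)
    qed
    then have "(\<integral>\<^sup>+z. h (v * z) \<partial>lborel) = (\<integral>\<^sup>+z. (\<lambda>z. h (A (B z))) (A z) \<partial>lborel)" by simp
    also have "\<dots> = (\<integral>\<^sup>+z. (\<lambda>z. h (A z)) (B z) \<partial>lborel)"
      unfolding A_def by (rule nn_integral_complex_shear_Re) (simp add: A_def B_def)
    also have "\<dots> = (\<integral>\<^sup>+z. h (A z) \<partial>lborel)"
      unfolding B_def by (rule nn_integral_complex_shear_Im) (simp add: A_def)
    also have "\<dots> = (\<integral>\<^sup>+z. h z \<partial>lborel)"
      unfolding A_def by (rule nn_integral_complex_shear_Re) simp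
    finally show ?thesis .
  qed
  show ?thesis
  proof (cases "u = -1")
    case False then show ?thesis using shears u by simp
  next
    case True
    have "(\<integral>\<^sup>+z. f (u * z) \<partial>lborel) = (\<integral>\<^sup>+z. (\<lambda>z. f (\<i> * z)) (\<i> * z) \<partial>lborel)"
      unfolding True by (simp flip: mult.assoc)
    also have "\<dots> = (\<integral>\<^sup>+z. f (\<i> * z) \<partial>lborel)"
      by (rule shears) (auto simp: complex_eq_iff)
    also have "\<dots> = (\<integral>\<^sup>+z. f z \<partial>lborel)"
      by (rule shears) (auto simp: complex_eq_iff)
    finally show ?thesis .
  qed
qed

lemma entire_compose:
  fixes H g :: "complex \<Rightarrow> complex"
  assumes "H holomorphic_on UNIV" "g holomorphic_on UNIV"
  shows "(\<lambda>z. H (g z)) holomorphic_on UNIV"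
  using holomorphic_on_compose_gen[OF assms(2,1)] by (simp add: o_def)

text \<open>Cauchy's formula at the centre of the circle through \<open>w\<close>. Precomposing with the rotation
  that sends the positive real axis to the ray of \<open>w\<close> makes the standard parametrisation of the
  circle start at \<open>w\<close>.\<close>
lemma entire_circle_mean_value:
  fixes H :: "complex \<Rightarrow> complex"
  assumes H: "H holomorphic_on UNIV"
  shows "ennreal (norm (H 0)) \<le> (\<integral>\<^sup>+x. ennreal (norm (H (exp (2 * of_real pi * \<i> * of_real x) * w))) * indicator {0..1::real} x \<partial>lborel)"
proof -
  define e where "e x = exp (2 * of_real pi * \<i> * of_real x)" for x :: real
  define v where "v = (if w = 0 then 1 else w / of_real (norm w))"
  define G where "G z = H (v * z)" for z
  define \<rho> where "\<rho> = (if w = 0 then 1 else norm w)"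
  have \<rho>: "\<rho> > 0" by (simp add: \<rho>_def)
  have Gh: "G holomorphic_on UNIV"
    unfolding G_def by (intro entire_compose[OF H] holomorphic_intros)
  have cont: "continuous_on UNIV H"
    using H by (simp add: holomorphic_on_imp_continuous_on)
  have contG: "continuous_on UNIV G" using Gh by (simp add: holomorphic_on_imp_continuous_on)
  show ?thesis
  proof (cases "w = 0")
    case True
    then show ?thesis by (simp add: nn_integral_cmult)
  next
    case False
    have "((\<lambda>u. G u / (u - 0)) has_contour_integral (2 * of_real pi * \<i> * G 0)) (circlepath 0 \<rho>)"
      by (rule Cauchy_integral_circlepath_simple) (use Gh \<rho> in \<open>auto intro: holomorphic_on_subset\<close>)
    then have "((\<lambda>x. (G (\<rho> * e x) / (\<rho> * e x)) * (2 * of_real pi * \<i> * \<rho> * e x)) has_integral (2 * of_real pi * \<i> * G 0)) {0..1}"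
      unfolding has_contour_integral_def
    proof (rule has_integral_eq[rotated], goal_cases)
      case (1 x)
      have "vector_derivative (circlepath 0 \<rho>) (at x within {0..1}) = 2 * of_real pi * \<i> * \<rho> * e x"
        using 1 by (simp add: vector_derivative_circlepath01 e_def)
      then show ?case by (simp add: circlepath e_def)
    qed
    moreover have "(G (\<rho> * e x) / (\<rho> * e x)) * (2 * of_real pi * \<i> * \<rho> * e x) = (2 * of_real pi * \<i>) * G (\<rho> * e x)" for x
      using \<rho> by (simp add: e_def field_simps)
    ultimately have "((\<lambda>x. (2 * of_real pi * \<i>) * G (\<rho> * e x)) has_integral (2 * of_real pi * \<i> * G 0)) {0..1}"
      by simp
    from has_integral_mult_right[OF this, of "1 / (2 * of_real pi * \<i>)"]
    have hi: "((\<lambda>x. G (\<rho> * e x)) has_integral G 0) {0..1}" by simp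
    have ce: "continuous_on {0..1} (\<lambda>x. G (\<rho> * e x))"
      unfolding e_def
      by (intro continuous_on_compose2[OF contG] continuous_intros) auto
    have si: "set_integrable lborel {0..1} (\<lambda>x. G (\<rho> * e x))"
      by (rule borel_integrable_atLeastAtMost'[OF ce])
    then have "(LINT x:{0..1}|lborel. G (\<rho> * e x)) = G 0"
      using set_borel_integral_eq_integral(2)[OF si] hi by (simp add: integral_unique)
    then have "ennreal (norm (G 0)) = ennreal (norm (LINT x|lborel. indicator {0..1} x *\<^sub>R G (\<rho> * e x)))"
      by (simp add: set_lebesgue_integral_def)
    also have "\<dots> \<le> (\<integral>\<^sup>+x. ennreal (norm (indicator {0..1} x *\<^sub>R G (\<rho> * e x))) \<partial>lborel)"
      using si unfolding set_integrable_def by (rule integral_norm_bound_ennreal)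
    also have "\<dots> = (\<integral>\<^sup>+x. ennreal (norm (H (e x * w))) * indicator {0..1} x \<partial>lborel)"
      using False by (intro nn_integral_cong) (auto simp: G_def v_def \<rho>_def mult_ac split: split_indicator)
    finally show ?thesis by (simp add: G_def e_def)
  qed
qed

text \<open>The integral over a disc does not change when the integrand is rotated. Averaging over all
  rotations and exchanging the integrals puts a circle mean inside, so polar coordinates are avoided.\<close>
lemma entire_area_mean_value:
  fixes H :: "complex \<Rightarrow> complex"
  assumes H: "H holomorphic_on UNIV" and r: "r > 0"
  shows "ennreal (pi * r\<^sup>2 * norm (H a)) \<le> (\<integral>\<^sup>+w. ennreal (norm (H w)) * indicator (ball a r) w \<partial>lborel)"
proof -
  define G where "G z = H (a + z)" for z
  have Gh: "G holomorphic_on UNIV"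
    unfolding G_def by (intro entire_compose[OF H] holomorphic_intros)
  have cH: "continuous_on UNIV H" and cG: "continuous_on UNIV G"
    using H Gh by (simp_all add: holomorphic_on_imp_continuous_on)
  have [measurable]: "H \<in> borel_measurable borel" "G \<in> borel_measurable borel"
    using cH cG by (simp_all add: borel_measurable_continuous_onI)
  define e where "e x = exp (2 * of_real pi * \<i> * of_real x)" for x :: real
  have ce: "continuous_on UNIV e" unfolding e_def by (intro continuous_intros)
  have [measurable]: "e \<in> borel_measurable borel" by (rule borel_measurable_continuous_onI[OF ce])
  have ne: "norm (e x) = 1" for x by (simp add: e_def)
  have disc: "emeasure lborel (ball (0::complex) r) = ennreal (pi * r\<^sup>2)"
    using r by (simp add: emeasure_ball unit_ball_vol_2)
  have "(\<integral>\<^sup>+w. ennreal (norm (H w)) * indicator (ball a r) w \<partial>lborel)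
      = (\<integral>\<^sup>+w. ennreal (norm (H (a + w))) * indicator (ball a r) (a + w) \<partial>lborel)"
    by (rule nn_integral_lborel_translate[symmetric]) measurable
  also have "\<dots> = (\<integral>\<^sup>+w. ennreal (norm (G w)) * indicator (ball 0 r) w \<partial>lborel)"
    by (intro nn_integral_cong) (auto simp: G_def dist_norm split: split_indicator)
  also have "\<dots> = (\<integral>\<^sup>+x. (\<integral>\<^sup>+w. ennreal (norm (G w)) * indicator (ball 0 r) w \<partial>lborel) * indicator {0..1::real} x \<partial>lborel)"
    by (simp add: nn_integral_cmult)
  also have "\<dots> = (\<integral>\<^sup>+x. (\<integral>\<^sup>+w. ennreal (norm (G (e x * w))) * indicator (ball 0 r) w \<partial>lborel) * indicator {0..1::real} x \<partial>lborel)"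
  proof (rule nn_integral_cong, rule arg_cong2[where f="(*)", OF _ refl])
    fix x
    have "(\<integral>\<^sup>+w. ennreal (norm (G w)) * indicator (ball 0 r) w \<partial>lborel)
      = (\<integral>\<^sup>+w. ennreal (norm (G (e x * w))) * indicator (ball 0 r) (e x * w) \<partial>lborel)"
      by (rule nn_integral_complex_rotate[symmetric]) (simp_all add: ne)
    also have "\<dots> = (\<integral>\<^sup>+w. ennreal (norm (G (e x * w))) * indicator (ball 0 r) w \<partial>lborel)"
      by (intro nn_integral_cong) (auto simp: norm_mult ne split: split_indicator)
    finally show "(\<integral>\<^sup>+w. ennreal (norm (G w)) * indicator (ball 0 r) w \<partial>lborel)
      = (\<integral>\<^sup>+w. ennreal (norm (G (e x * w))) * indicator (ball 0 r) w \<partial>lborel)" .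
  qed
  also have "\<dots> = (\<integral>\<^sup>+x. (\<integral>\<^sup>+w. ennreal (norm (G (e x * w))) * indicator (ball 0 r) w * indicator {0..1::real} x \<partial>lborel) \<partial>lborel)"
    by (intro nn_integral_cong nn_integral_multc[symmetric]) measurable
  also have "\<dots> = (\<integral>\<^sup>+w. (\<integral>\<^sup>+x. ennreal (norm (G (e x * w))) * indicator (ball 0 r) w * indicator {0..1::real} x \<partial>lborel) \<partial>lborel)"
    by (rule lborel_pair.Fubini'[symmetric]) measurable
  also have "\<dots> = (\<integral>\<^sup>+w. (\<integral>\<^sup>+x. ennreal (norm (G (e x * w))) * indicator {0..1::real} x \<partial>lborel) * indicator (ball 0 r) w \<partial>lborel)"
    by (subst nn_integral_multc[symmetric]) (auto intro!: nn_integral_cong simp: mult_ac)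
  finally have eq: "(\<integral>\<^sup>+w. ennreal (norm (H w)) * indicator (ball a r) w \<partial>lborel)
      = (\<integral>\<^sup>+w. (\<integral>\<^sup>+x. ennreal (norm (G (e x * w))) * indicator {0..1::real} x \<partial>lborel) * indicator (ball 0 r) w \<partial>lborel)" .
  have "ennreal (pi * r\<^sup>2 * norm (H a)) = (\<integral>\<^sup>+w. ennreal (norm (G 0)) * indicator (ball (0::complex) r) w \<partial>lborel)"
    by (subst nn_integral_cmult_indicator) (simp_all add: disc G_def mult_ac flip: ennreal_mult')
  also have "\<dots> \<le> (\<integral>\<^sup>+w. (\<integral>\<^sup>+x. ennreal (norm (G (e x * w))) * indicator {0..1::real} x \<partial>lborel) * indicator (ball 0 r) w \<partial>lborel)"
    unfolding e_def by (intro nn_integral_mono mult_right_mono entire_circle_mean_value Gh) auto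
  finally show ?thesis using eq by simp
qed

section \<open>Sub-mean value property for powers of entire functions\<close>

text \<open>Either \<open>x \<le> t\<close>, or the second summand is at least \<open>x\<close>. With a suitable \<open>t\<close>, a fraction of the
  average to be bounded, this does the work of Jensen's inequality at the cost of a constant.\<close>
lemma le_add_powr_mult_powr:
  fixes x t s :: real
  assumes "0 \<le> x" "0 < t" "1 \<le> s"
  shows "x \<le> t + x powr s * t powr (1 - s)"
proof (cases "x \<le> t")
  case False
  have "x = x powr s * x powr (1 - s)" using assms False by (simp flip: powr_add)
  also have "\<dots> \<le> x powr s * t powr (1 - s)"
    using assms False by (intro mult_left_mono powr_mono2') auto
  finally show ?thesis using assms by linarith
qed (use assms in \<open>simp add: add_increasing2\<close>)

lemma entire_measurable [measurable_dest]:
  "H holomorphic_on UNIV \<Longrightarrow> (H :: complex \<Rightarrow> complex) \<in> borel_measurable borel"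
  by (simp add: borel_measurable_continuous_onI holomorphic_on_imp_continuous_on)

text \<open>With \<open>t\<close> half the value at the centre, the term \<open>t\<close> is absorbed by the left-hand side of the
  area mean value inequality.\<close>
lemma entire_powr_sub_mean_value_ge_1:
  fixes H :: "complex \<Rightarrow> complex"
  assumes H: "H holomorphic_on UNIV" and r: "r > 0" and q: "q \<ge> 1"
  shows "ennreal (norm (H a) powr q) \<le> ennreal (2 powr q / pi / r\<^sup>2) *
           (\<integral>\<^sup>+w. ennreal (norm (H w) powr q) * indicator (ball a r) w \<partial>lborel)" (is "_ \<le> _ * ?I")
proof (cases "H a = 0 \<or> ?I = \<infinity>")
  case True
  then show ?thesis using r by (auto simp: ennreal_mult_top)
next
  case False
  have [measurable]: "H \<in> borel_measurable borel" using H by measurable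
  define J where "J = enn2real ?I"
  have J: "?I = ennreal J" and J0: "J \<ge> 0" using False by (auto simp: J_def less_top)
  define t where "t = norm (H a) / 2"
  have t: "t > 0" using False by (simp add: t_def)
  have "ennreal (pi * r\<^sup>2 * norm (H a)) \<le> (\<integral>\<^sup>+w. ennreal (norm (H w)) * indicator (ball a r) w \<partial>lborel)"
    by (rule entire_area_mean_value[OF H r])
  also have "\<dots> \<le> (\<integral>\<^sup>+w. ennreal t * indicator (ball a r) w
      + ennreal (t powr (1 - q)) * (ennreal (norm (H w) powr q) * indicator (ball a r) w) \<partial>lborel)"
    using t q le_add_powr_mult_powr[of "norm (H _)" t q]
    by (intro nn_integral_mono) (auto simp: mult.commute simp flip: ennreal_mult' ennreal_plus split: split_indicator)
  also have "\<dots> = ennreal (t * (pi * r\<^sup>2) + t powr (1 - q) * J)"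
    using t r J0 by (simp add: nn_integral_add nn_integral_cmult nn_integral_cmult_indicator J emeasure_ball unit_ball_vol_2
        flip: ennreal_mult' ennreal_plus)
  finally have "pi * r\<^sup>2 * norm (H a) \<le> t * (pi * r\<^sup>2) + t powr (1 - q) * J"
    using t J0 by (subst (asm) ennreal_le_iff) auto
  then have "pi * r\<^sup>2 * t \<le> t powr (1 - q) * J" by (simp add: t_def mult_ac)
  then have "pi * r\<^sup>2 * t * t powr (q - 1) \<le> t powr (1 - q) * J * t powr (q - 1)"
    by (intro mult_right_mono) auto
  also have "t powr (1 - q) * J * t powr (q - 1) = J" using t by (simp add: powr_add[symmetric] mult_ac)
  also have "pi * r\<^sup>2 * t * t powr (q - 1) = pi * r\<^sup>2 * t powr q"
    using t by (simp add: powr_diff)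
  finally have "t powr q \<le> J / (pi * r\<^sup>2)" using r by (simp add: field_simps)
  then have "norm (H a) powr q \<le> 2 powr q / pi / r\<^sup>2 * J"
    by (simp add: t_def powr_divide field_simps)
  then show ?thesis unfolding J by (simp add: J0 flip: ennreal_mult')
qed

text \<open>For \<open>q < 1\<close> convexity points the wrong way. A maximum point \<open>z0\<close> of
  \<open>(r - dist a z) powr (2 / q) * norm (H z)\<close> has a disc around it, of half its distance to the
  boundary, on which \<open>norm (H w)\<close> is bounded by a multiple of \<open>norm (H z0)\<close>. There \<open>norm (H w)\<close> is
  at most a constant times \<open>norm (H w) powr q\<close>, and the area mean value inequality applies. The
  exponent \<open>2 / q\<close> makes all powers of the radius cancel.\<close>
lemma entire_powr_sub_mean_value_less_1:
  fixes H :: "complex \<Rightarrow> complex"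
  assumes H: "H holomorphic_on UNIV" and r: "r > 0" and q: "0 < q" "q < 1"
  shows "ennreal (norm (H a) powr q) \<le> ennreal (2 powr (2 / q) / pi / r\<^sup>2) *
           (\<integral>\<^sup>+w. ennreal (norm (H w) powr q) * indicator (ball a r) w \<partial>lborel)" (is "_ \<le> _ * ?I")
proof (cases "H a = 0 \<or> ?I = \<infinity>")
  case True
  then show ?thesis using r by (auto simp: ennreal_mult_top)
next
  case False
  have [measurable]: "H \<in> borel_measurable borel" using H by measurable
  define J where "J = enn2real ?I"
  have J: "?I = ennreal J" and J0: "J \<ge> 0" using False by (auto simp: J_def less_top)
  define \<phi> where "\<phi> z = (r - dist a z) powr (2 / q) * norm (H z)" for z
  have "continuous_on (cball a r) \<phi>"
    unfolding \<phi>_def using q holomorphic_on_imp_continuous_on[OF H]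
    by (intro continuous_intros continuous_on_powr') (auto intro: continuous_on_subset)
  then obtain z0 where z0: "z0 \<in> cball a r" and max: "\<And>z. z \<in> cball a r \<Longrightarrow> \<phi> z \<le> \<phi> z0"
    using continuous_attains_sup[of "cball a r" \<phi>] r by auto
  define S where "S = \<phi> z0"
  have "0 < \<phi> a" using False r by (simp add: \<phi>_def)
  also have "\<phi> a \<le> S" using max[of a] r by (simp add: S_def)
  finally have S: "S > 0" .
  then have "dist a z0 \<noteq> r" by (auto simp: S_def \<phi>_def)
  define d where "d = (r - dist a z0) / 2"
  have d: "d > 0" using z0 \<open>dist a z0 \<noteq> r\<close> by (simp add: d_def)
  have far: "d \<le> r - dist a w" if "w \<in> ball z0 d" for w
    using that dist_triangle[of a w z0] by (simp add: d_def)
  have bd: "norm (H w) \<le> S * d powr (- (2 / q))" if w: "w \<in> ball z0 d" for w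
  proof -
    have "d powr (2 / q) * norm (H w) \<le> \<phi> w"
      unfolding \<phi>_def using far[OF w] d q by (intro mult_right_mono powr_mono2) auto
    also have "\<dots> \<le> S" unfolding S_def using far[OF w] d by (intro max) auto
    finally show ?thesis using d by (simp add: powr_minus field_simps)
  qed
  define Q where "Q = (S * d powr (- (2 / q))) powr (1 - q)"
  have "ennreal (pi * d\<^sup>2 * norm (H z0)) \<le> (\<integral>\<^sup>+w. ennreal (norm (H w)) * indicator (ball z0 d) w \<partial>lborel)"
    by (rule entire_area_mean_value[OF H d])
  also have "\<dots> \<le> (\<integral>\<^sup>+w. ennreal Q * (ennreal (norm (H w) powr q) * indicator (ball a r) w) \<partial>lborel)"
  proof (intro nn_integral_mono)
    fix w :: complex
    show "ennreal (norm (H w)) * indicator (ball z0 d) w \<le> ennreal Q * (ennreal (norm (H w) powr q) * indicator (ball a r) w)"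
    proof (cases "w \<in> ball z0 d")
      case True
      then have "w \<in> ball a r" using far[of w] d by (simp)
      have "norm (H w) = norm (H w) powr (1 - q) * norm (H w) powr q"
        by (simp flip: powr_add)
      also have "\<dots> \<le> Q * norm (H w) powr q"
        unfolding Q_def using q bd[OF True] by (intro mult_right_mono powr_mono2) auto
      finally show ?thesis using True \<open>w \<in> ball a r\<close> by (simp add: Q_def flip: ennreal_mult')
    qed simp
  qed
  also have "\<dots> = ennreal (Q * J)"
    by (simp add: nn_integral_cmult J Q_def J0 flip: ennreal_mult')
  finally have le: "pi * d\<^sup>2 * norm (H z0) \<le> Q * J"
    using J0 by (subst (asm) ennreal_le_iff) (auto simp: Q_def)
  have Hz0: "norm (H z0) = S * (2 * d) powr (- (2 / q))"
  proof -
    have "2 * d = r - dist a z0" by (simp add: d_def)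
    then have "S = (2 * d) powr (2 / q) * norm (H z0)" by (simp only: S_def \<phi>_def)
    then show ?thesis using d by (simp add: powr_minus)
  qed
  have Qe: "Q = S * S powr (- q) * (d powr (- (2 / q)) * d powr 2)"
  proof -
    have "Q = S powr (1 - q) * d powr (- (2 / q) * (1 - q))"
      using S d by (simp add: Q_def powr_mult powr_powr)
    also have "- (2 / q) * (1 - q) = - (2 / q) + 2" using q by (simp add: field_simps)
    finally show ?thesis using S unfolding powr_add by (simp add: powr_diff powr_minus field_simps)
  qed
  have "pi * d\<^sup>2 * (S * (2 powr (- (2 / q)) * d powr (- (2 / q)))) \<le> S * S powr (- q) * (d powr (- (2 / q)) * d powr 2) * J"
    using le d unfolding Hz0 Qe by (simp add: powr_mult)
  then have "(S * d\<^sup>2 * d powr (- (2 / q))) * (pi * 2 powr (- (2 / q))) \<le> (S * d\<^sup>2 * d powr (- (2 / q))) * (S powr (- q) * J)"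
    using d by (simp add: mult_ac)
  then have "pi * 2 powr (- (2 / q)) \<le> S powr (- q) * J"
    using S d by (simp add: mult_le_cancel_left_pos)
  then have Sq: "S powr q \<le> 2 powr (2 / q) / pi * J"
    using S by (simp add: powr_minus field_simps)
  have "r\<^sup>2 * norm (H a) powr q = \<phi> a powr q"
    using r q by (simp add: \<phi>_def powr_mult powr_powr)
  also have "\<dots> \<le> S powr q" using \<open>0 < \<phi> a\<close> \<open>\<phi> a \<le> S\<close> q by (intro powr_mono2) auto
  also note Sq
  finally have "norm (H a) powr q \<le> 2 powr (2 / q) / pi / r\<^sup>2 * J"
    using r by (simp add: field_simps)
  then show ?thesis unfolding J by (simp add: J0 flip: ennreal_mult')
qed

lemma entire_powr_sub_mean_value:
  assumes q: "0 < (q::real)"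
  obtains C :: real where "C > 0" and
    "\<And>H a r. H holomorphic_on UNIV \<Longrightarrow> r > 0 \<Longrightarrow>
       ennreal (norm (H a) powr q) \<le> ennreal (C / r\<^sup>2) *
         (\<integral>\<^sup>+w. ennreal (norm (H w) powr q) * indicator (ball a r) w \<partial>lborel)"
proof (cases "q \<ge> 1")
  case True
  show ?thesis
    by (rule that[of "2 powr q / pi"]) (use entire_powr_sub_mean_value_ge_1 True in auto)
next
  case False
  show ?thesis
    by (rule that[of "2 powr (2 / q) / pi"]) (use entire_powr_sub_mean_value_less_1 False q in auto)
qed

text \<open>The integrands of the Fock integrals, without and with a polynomial damping factor.\<close>
abbreviation wpowr :: "real \<Rightarrow> real \<Rightarrow> (complex \<Rightarrow> complex) \<Rightarrow> complex \<Rightarrow> real" where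
  "wpowr q c f z \<equiv> norm (f z) powr q * exp (- c * (norm z)\<^sup>2)"

abbreviation dpowr :: "real \<Rightarrow> real \<Rightarrow> real \<Rightarrow> (complex \<Rightarrow> complex) \<Rightarrow> complex \<Rightarrow> real" where
  "dpowr q s c f z \<equiv> norm (f z) powr q * (1 + norm z) powr (- s) * exp (- c * (norm z)\<^sup>2)"

section \<open>Local suprema at the scale of the Gaussian weight\<close>

lemma emeasure_disc: "r \<ge> 0 \<Longrightarrow> emeasure lborel (ball (a::complex) r) = ennreal (pi * r\<^sup>2)"
  by (simp add: emeasure_ball unit_ball_vol_2)

text \<open>A displacement of \<open>3 / (1 + norm z)\<close> changes the squared modulus by a bounded amount. This is
  why \<open>1 / (1 + norm z)\<close> is the natural radius for the weight \<open>exp (- c * (norm z)\<^sup>2)\<close>.\<close>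
lemma near_comparable:
  fixes z w :: complex
  assumes "dist z w < 3 / (1 + norm z)"
  shows "1 + norm z \<le> 4 * (1 + norm w)" "1 + norm w \<le> 4 * (1 + norm z)"
    "(norm w)\<^sup>2 \<le> (norm z)\<^sup>2 + 15" "(norm z)\<^sup>2 \<le> (norm w)\<^sup>2 + 15" "dist w z < 12 / (1 + norm w)"
proof -
  have p: "1 + norm z > 0" "1 + norm w > 0" by (simp_all add: add_pos_nonneg)
  have d1: "dist z w * (1 + norm z) < 3" using assms p by (simp add: field_simps)
  have "dist z w * 1 \<le> dist z w * (1 + norm z)" by (intro mult_left_mono) auto
  then have d3: "dist z w < 3" using d1 by simp
  have zw: "norm z \<le> norm w + dist z w" "norm w \<le> norm z + dist z w"
    using norm_triangle_ineq2[of z w] norm_triangle_ineq2[of w z] by (auto simp: dist_norm norm_minus_commute)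
  show "1 + norm z \<le> 4 * (1 + norm w)"
    using zw d3 norm_ge_zero[of z] norm_ge_zero[of w] by argo
  show b: "1 + norm w \<le> 4 * (1 + norm z)"
    using zw d3 norm_ge_zero[of z] norm_ge_zero[of w] by argo
  have dn: "dist z w * norm z < 3"
    using d1 zero_le_dist[of z w] by (simp only: distrib_left mult_1_right)
  have dd: "dist z w * dist z w \<le> 9"
    using mult_mono[of "dist z w" 3 "dist z w" 3] d3 by simp
  have "(norm w)\<^sup>2 \<le> (norm z + dist z w)\<^sup>2" using zw by (intro power_mono) auto
  also have "\<dots> = (norm z)\<^sup>2 + 2 * (dist z w * norm z) + dist z w * dist z w" by (simp add: power2_eq_square algebra_simps)
  finally show "(norm w)\<^sup>2 \<le> (norm z)\<^sup>2 + 15" using dn dd by linarith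
  show "(norm z)\<^sup>2 \<le> (norm w)\<^sup>2 + 15"
  proof (cases "norm z \<le> dist z w")
    case True
    then have "norm z * norm z \<le> 3 * 3" using d3 by (intro mult_mono) auto
    then show ?thesis by (simp add: power2_eq_square add_increasing)
  next
    case False
    have "(norm z - dist z w)\<^sup>2 \<le> (norm w)\<^sup>2" using zw False by (intro power_mono) auto
    moreover have "(norm z - dist z w)\<^sup>2 = (norm z)\<^sup>2 - 2 * (dist z w * norm z) + dist z w * dist z w"
      by (simp add: power2_eq_square algebra_simps)
    moreover have "dist z w * dist z w \<ge> 0" by simp
    ultimately show ?thesis using dn by linarith
  qed
  have "dist z w * (1 + norm w) \<le> dist z w * (4 * (1 + norm z))" using b by (intro mult_left_mono) auto
  also have "\<dots> = 4 * (dist z w * (1 + norm z))" by (rule mult.left_commute)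
  also have "\<dots> < 12" using d1 by linarith
  finally show "dist w z < 12 / (1 + norm w)" using p by (simp add: dist_commute field_simps)
qed

lemma powr_comparable:
  fixes x y s :: real
  assumes "0 < x" "0 < y" "x \<le> 4 * y" "y \<le> 4 * x"
  shows "x powr s \<le> 4 powr \<bar>s\<bar> * y powr s"
proof (cases "s \<ge> 0")
  case True
  then have "x powr s \<le> (4 * y) powr s" using assms by (intro powr_mono2) auto
  then show ?thesis using True assms by (simp add: powr_mult)
next
  case False
  then have "x powr s \<le> (y / 4) powr s" using assms by (intro powr_mono2') auto
  then show ?thesis using False assms by (simp add: powr_divide powr_minus field_simps)
qed

text \<open>A value at a point \<open>\<zeta>\<close> near \<open>z\<close> is bounded by a mean over a disc of radius \<open>1 / (1 + norm z)\<close>,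
  over which all weights are constant up to factors. After Tonelli's theorem, each \<open>w\<close> is counted by
  a set of \<open>z\<close> whose area is of order \<open>1 / (1 + norm w)\<^sup>2\<close>, and this cancels the normalisation of the mean.
  The function \<open>\<Phi>\<close> stands for any quantity dominated by such local suprema.\<close>
lemma weighted_local_sup_bound:
  fixes c q s :: real
  assumes q: "0 < q" and c: "0 \<le> c"
  obtains C :: real where "C > 0" and
    "\<And>H \<Phi>. H holomorphic_on UNIV \<Longrightarrow>
       (\<And>z. 0 \<le> \<Phi> z \<and> (\<exists>\<zeta>. dist z \<zeta> \<le> 2 / (1 + norm z) \<and> \<Phi> z \<le> norm (H \<zeta>))) \<Longrightarrow>
       (\<integral>\<^sup>+z. ennreal (\<Phi> z powr q * (1 + norm z) powr (- s) * exp (- c * (norm z)\<^sup>2)) \<partial>lborel)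
         \<le> ennreal C * (\<integral>\<^sup>+w. ennreal (dpowr q s c H w) \<partial>lborel)"
proof -
  obtain C1 :: real where C1: "C1 > 0" and sub: "\<And>H a r. H holomorphic_on UNIV \<Longrightarrow> r > 0 \<Longrightarrow>
       ennreal (norm (H a) powr q) \<le> ennreal (C1 / r\<^sup>2) *
         (\<integral>\<^sup>+w. ennreal (norm (H w) powr q) * indicator (ball a r) w \<partial>lborel)"
    using entire_powr_sub_mean_value[OF q] by blast
  define K where "K = C1 * 16 * 4 powr \<bar>s\<bar> * exp (15 * c)"
  have K: "K > 0" using C1 by (simp add: K_def)
  show thesis
  proof (rule that[of "144 * pi * K"])
    show "144 * pi * K > 0" using K by simp
    fix H :: "complex \<Rightarrow> complex" and \<Phi>
    assume H: "H holomorphic_on UNIV"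
      and \<Phi>: "\<And>z. 0 \<le> \<Phi> z \<and> (\<exists>\<zeta>. dist z \<zeta> \<le> 2 / (1 + norm z) \<and> \<Phi> z \<le> norm (H \<zeta>))"
    have [measurable]: "H \<in> borel_measurable borel" using H by measurable
    define W where "W w = dpowr q s c H w" for w
    have W0: "W w \<ge> 0" for w by (simp add: W_def)
    have [measurable]: "W \<in> borel_measurable borel" unfolding W_def by measurable
    define D where "D = {p :: complex \<times> complex. dist (snd p) (fst p) < 12 / (1 + norm (snd p))}"
    have "open D" unfolding D_def
      by (intro open_Collect_less continuous_intros) (simp add: add_pos_nonneg less_imp_neq[symmetric])
    then have [measurable]: "D \<in> sets (borel \<Otimes>\<^sub>M borel)"
      unfolding borel_prod by (rule borel_open)
    have pointwise: "ennreal (\<Phi> z powr q * (1 + norm z) powr (- s) * exp (- c * (norm z)\<^sup>2))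
       \<le> (\<integral>\<^sup>+w. ennreal (K * (1 + norm w)\<^sup>2 * W w) * indicator D (z, w) \<partial>lborel)" for z
    proof -
      define \<rho> where "\<rho> = 1 / (1 + norm z)"
      have \<rho>: "\<rho> > 0" by (simp add: \<rho>_def add_pos_nonneg)
      obtain \<zeta> where \<zeta>: "dist z \<zeta> \<le> 2 * \<rho>" "\<Phi> z \<le> norm (H \<zeta>)" using \<Phi>[of z] by (auto simp: \<rho>_def)
      define L where "L = (1 + norm z) powr (- s) * exp (- c * (norm z)\<^sup>2)"
      have L: "L \<ge> 0" by (simp add: L_def)
      have "ennreal (\<Phi> z powr q * (1 + norm z) powr (- s) * exp (- c * (norm z)\<^sup>2)) = ennreal L * ennreal (\<Phi> z powr q)"
        by (simp add: L_def mult_ac flip: ennreal_mult')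
      also have "\<dots> \<le> ennreal L * ennreal (norm (H \<zeta>) powr q)"
        using \<zeta> \<Phi>[of z] q by (intro mult_left_mono ennreal_leI powr_mono2) auto
      also have "\<dots> \<le> ennreal L * (ennreal (C1 / \<rho>\<^sup>2) *
         (\<integral>\<^sup>+w. ennreal (norm (H w) powr q) * indicator (ball \<zeta> \<rho>) w \<partial>lborel))"
        by (intro mult_left_mono sub[OF H \<rho>]) auto
      also have "\<dots> = (\<integral>\<^sup>+w. ennreal (L * (C1 / \<rho>\<^sup>2) * norm (H w) powr q) * indicator (ball \<zeta> \<rho>) w \<partial>lborel)"
      proof -
        have LC: "0 \<le> L * (C1 / \<rho>\<^sup>2)" using L C1 by simp
        have "ennreal L * (ennreal (C1 / \<rho>\<^sup>2) * (\<integral>\<^sup>+w. ennreal (norm (H w) powr q) * indicator (ball \<zeta> \<rho>) w \<partial>lborel))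
          = ennreal (L * (C1 / \<rho>\<^sup>2)) * (\<integral>\<^sup>+w. ennreal (norm (H w) powr q) * indicator (ball \<zeta> \<rho>) w \<partial>lborel)"
          by (simp only: ennreal_mult'[OF L] mult.assoc)
        also have "\<dots> = (\<integral>\<^sup>+w. ennreal (L * (C1 / \<rho>\<^sup>2)) * (ennreal (norm (H w) powr q) * indicator (ball \<zeta> \<rho>) w) \<partial>lborel)"
          by (rule nn_integral_cmult[symmetric]) measurable
        also have "\<dots> = (\<integral>\<^sup>+w. ennreal (L * (C1 / \<rho>\<^sup>2) * norm (H w) powr q) * indicator (ball \<zeta> \<rho>) w \<partial>lborel)"
          by (simp only: ennreal_mult'[OF LC]) (simp only: mult.assoc)
        finally show ?thesis .
      qed
      also have "\<dots> \<le> (\<integral>\<^sup>+w. ennreal (K * (1 + norm w)\<^sup>2 * W w) * indicator D (z, w) \<partial>lborel)"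
      proof (intro nn_integral_mono)
        fix w
        show "ennreal (L * (C1 / \<rho>\<^sup>2) * norm (H w) powr q) * indicator (ball \<zeta> \<rho>) w
          \<le> ennreal (K * (1 + norm w)\<^sup>2 * W w) * indicator D (z, w)"
        proof (cases "w \<in> ball \<zeta> \<rho>")
          case True
          have "dist z w \<le> dist z \<zeta> + dist \<zeta> w" by (rule dist_triangle)
          also have "\<dots> < 3 * \<rho>" using True \<zeta> by simp
          finally have near: "dist z w < 3 / (1 + norm z)" by (simp add: \<rho>_def)
          note nc = near_comparable[OF near]
          have p: "1 + norm z > 0" "1 + norm w > 0" by (simp_all add: add_pos_nonneg)
          have 1: "(1 + norm z)\<^sup>2 \<le> 16 * (1 + norm w)\<^sup>2"
          proof -
            have "(1 + norm z)\<^sup>2 \<le> (4 * (1 + norm w))\<^sup>2" using nc(1) p by (intro power_mono) auto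
            also have "\<dots> = 16 * (1 + norm w)\<^sup>2" by (simp only: power_mult_distrib) simp
            finally show ?thesis .
          qed
          have 2: "(1 + norm z) powr (- s) \<le> 4 powr \<bar>s\<bar> * (1 + norm w) powr (- s)"
            using powr_comparable[OF p nc(1,2), of "-s"] by simp
          have "c * (norm w)\<^sup>2 \<le> c * ((norm z)\<^sup>2 + 15)" using c nc by (intro mult_left_mono) auto
          then have 3: "exp (- c * (norm z)\<^sup>2) \<le> exp (15 * c) * exp (- c * (norm w)\<^sup>2)"
            by (simp add: algebra_simps flip: exp_add)
          have "L * (C1 / \<rho>\<^sup>2) * norm (H w) powr q
             = C1 * ((1 + norm z)\<^sup>2 * ((1 + norm z) powr (- s) * exp (- c * (norm z)\<^sup>2))) * norm (H w) powr q"
            by (simp add: L_def \<rho>_def power_divide mult_ac)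
          also have "\<dots> \<le> C1 * ((16 * (1 + norm w)\<^sup>2) * ((4 powr \<bar>s\<bar> * (1 + norm w) powr (- s)) * (exp (15 * c) * exp (- c * (norm w)\<^sup>2)))) * norm (H w) powr q"
            using C1 1 2 3 by (intro mult_right_mono mult_left_mono mult_mono) auto
          also have "\<dots> = K * (1 + norm w)\<^sup>2 * W w" by (simp add: K_def W_def mult_ac)
          finally show ?thesis using True nc(5) by (simp add: D_def ennreal_leI)
        qed simp
      qed
      finally show ?thesis .
    qed
    have "(\<integral>\<^sup>+z. ennreal (\<Phi> z powr q * (1 + norm z) powr (- s) * exp (- c * (norm z)\<^sup>2)) \<partial>lborel)
      \<le> (\<integral>\<^sup>+z. (\<integral>\<^sup>+w. ennreal (K * (1 + norm w)\<^sup>2 * W w) * indicator D (z, w) \<partial>lborel) \<partial>lborel)"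
      by (intro nn_integral_mono pointwise)
    also have "\<dots> = (\<integral>\<^sup>+w. (\<integral>\<^sup>+z. ennreal (K * (1 + norm w)\<^sup>2 * W w) * indicator D (z, w) \<partial>lborel) \<partial>lborel)"
      by (rule lborel_pair.Fubini'[symmetric]) (simp add: borel_prod)
    also have "\<dots> = (\<integral>\<^sup>+w. ennreal (144 * pi * K) * ennreal (W w) \<partial>lborel)"
    proof (intro nn_integral_cong)
      fix w :: complex
      have p: "1 + norm w > 0" by (simp add: add_pos_nonneg)
      have "(\<integral>\<^sup>+z. ennreal (K * (1 + norm w)\<^sup>2 * W w) * indicator D (z, w) \<partial>lborel)
        = (\<integral>\<^sup>+z. ennreal (K * (1 + norm w)\<^sup>2 * W w) * indicator (ball w (12 / (1 + norm w))) z \<partial>lborel)"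
        by (intro nn_integral_cong) (auto simp: D_def split: split_indicator)
      also have "\<dots> = ennreal (K * (1 + norm w)\<^sup>2 * W w) * ennreal (pi * (12 / (1 + norm w))\<^sup>2)"
        using p by (subst nn_integral_cmult_indicator) (simp_all add: emeasure_disc)
      also have "\<dots> = ennreal (K * (1 + norm w)\<^sup>2 * W w * (pi * (12 / (1 + norm w))\<^sup>2))"
        using K W0 by (intro ennreal_mult[symmetric]) auto
      also have "K * (1 + norm w)\<^sup>2 * W w * (pi * (12 / (1 + norm w))\<^sup>2) = 144 * pi * K * W w"
        using p by (simp add: power_divide)
      finally show "(\<integral>\<^sup>+z. ennreal (K * (1 + norm w)\<^sup>2 * W w) * indicator D (z, w) \<partial>lborel) = ennreal (144 * pi * K) * ennreal (W w)"
        using K W0 by (simp add: ennreal_mult)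
    qed
    also have "\<dots> = ennreal (144 * pi * K) * (\<integral>\<^sup>+w. ennreal (W w) \<partial>lborel)"
      by (rule nn_integral_cmult) simp
    finally show "(\<integral>\<^sup>+z. ennreal (\<Phi> z powr q * (1 + norm z) powr (- s) * exp (- c * (norm z)\<^sup>2)) \<partial>lborel)
         \<le> ennreal (144 * pi * K) * (\<integral>\<^sup>+w. ennreal (dpowr q s c H w) \<partial>lborel)"
      by (simp add: W_def)
  qed
qed

text \<open>By Cauchy's estimate on the disc of radius \<open>1 / (1 + norm z)\<close>, the damped derivative is at most
  the supremum of the function on that disc.\<close>
lemma fock_derivative_upper_bound:
  fixes c q :: real
  assumes q: "0 < q" and c: "0 \<le> c"
  obtains C :: real where "C > 0" and
    "\<And>F. F holomorphic_on UNIV \<Longrightarrow>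
       (\<integral>\<^sup>+z. ennreal (dpowr q q c (deriv F) z) \<partial>lborel)
         \<le> ennreal C * (\<integral>\<^sup>+z. ennreal (wpowr q c F z) \<partial>lborel)"
proof -
  obtain C :: real where C: "C > 0" and bd:
    "\<And>H \<Phi>. H holomorphic_on UNIV \<Longrightarrow>
       (\<And>z. 0 \<le> \<Phi> z \<and> (\<exists>\<zeta>. dist z \<zeta> \<le> 2 / (1 + norm z) \<and> \<Phi> z \<le> norm (H \<zeta>))) \<Longrightarrow>
       (\<integral>\<^sup>+z. ennreal (\<Phi> z powr q * (1 + norm z) powr (- 0) * exp (- c * (norm z)\<^sup>2)) \<partial>lborel)
         \<le> ennreal C * (\<integral>\<^sup>+w. ennreal (dpowr q 0 c H w) \<partial>lborel)"
    using weighted_local_sup_bound[OF q c, of 0] by blast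
  show thesis
  proof (rule that[OF C])
    fix F :: "complex \<Rightarrow> complex" assume F: "F holomorphic_on UNIV"
    have cF: "continuous_on UNIV F" using F by (simp add: holomorphic_on_imp_continuous_on)
    have pos: "1 + norm z > 0" for z :: complex by (simp add: add_pos_nonneg)
    have ex: "\<exists>\<zeta>. dist z \<zeta> \<le> 2 / (1 + norm z) \<and> norm (deriv F z) / (1 + norm z) \<le> norm (F \<zeta>)" for z
    proof -
      define \<rho> where "\<rho> = 1 / (1 + norm z)"
      have \<rho>: "\<rho> > 0" using pos by (simp add: \<rho>_def)
      have ne: "cball z \<rho> \<noteq> {}" using \<rho> by simp
      obtain \<zeta> where \<zeta>: "\<zeta> \<in> cball z \<rho>" "\<And>x. x \<in> cball z \<rho> \<Longrightarrow> norm (F x) \<le> norm (F \<zeta>)"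
        using continuous_attains_sup[OF compact_cball ne, of "\<lambda>x. norm (F x)"]
          continuous_on_norm[OF continuous_on_subset[OF cF subset_UNIV]] by blast
      have "norm ((deriv ^^ 1) F z) \<le> fact 1 * norm (F \<zeta>) / \<rho> ^ 1"
      proof (rule Cauchy_inequality[OF _ _ \<rho>])
        show "norm (F x) \<le> norm (F \<zeta>)" if "norm (z - x) = \<rho>" for x
          using that by (intro \<zeta>(2)) (simp add: dist_norm)
      qed (use F cF in \<open>auto intro: holomorphic_on_subset continuous_on_subset\<close>)
      then have "norm (deriv F z) * \<rho> \<le> norm (F \<zeta>)" using \<rho> by (simp add: field_simps)
      moreover have "dist z \<zeta> \<le> 2 / (1 + norm z)"
      proof -
        have "\<rho> \<le> 2 / (1 + norm z)" unfolding \<rho>_def using pos[of z] by (intro divide_right_mono) auto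
        then show ?thesis using \<zeta>(1) by (simp add: dist_commute)
      qed
      ultimately show ?thesis unfolding \<rho>_def by auto
    qed
    have "(\<integral>\<^sup>+z. ennreal (dpowr q q c (deriv F) z) \<partial>lborel)
      = (\<integral>\<^sup>+z. ennreal ((norm (deriv F z) / (1 + norm z)) powr q * (1 + norm z) powr (- 0) * exp (- c * (norm z)\<^sup>2)) \<partial>lborel)"
      using pos by (intro nn_integral_cong) (simp add: powr_divide powr_minus divide_simps less_imp_neq[symmetric])
    also have "\<dots> \<le> ennreal C * (\<integral>\<^sup>+w. ennreal (dpowr q 0 c F w) \<partial>lborel)"
      using ex pos by (intro bd[OF F] conjI) (auto intro: less_imp_le)
    also have "\<dots> = ennreal C * (\<integral>\<^sup>+w. ennreal (wpowr q c F w) \<partial>lborel)"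
      using pos by (intro arg_cong2[where f="(*)"] nn_integral_cong) (auto simp: less_imp_neq[symmetric])
    finally show "(\<integral>\<^sup>+z. ennreal (dpowr q q c (deriv F) z) \<partial>lborel)
         \<le> ennreal C * (\<integral>\<^sup>+z. ennreal (wpowr q c F z) \<partial>lborel)" .
  qed
qed

text \<open>The first summand suffices if \<open>b \<le> \<kappa> * a\<close>, the second one otherwise. It is valid for every
  \<open>q > 0\<close>, with a first coefficient as close to \<open>1\<close> as desired.\<close>
lemma powr_add_le_split:
  fixes a b \<kappa> q :: real
  assumes "0 \<le> a" "0 \<le> b" "0 < \<kappa>" "0 < q"
  shows "(a + b) powr q \<le> (1 + \<kappa>) powr q * a powr q + (1 + 1 / \<kappa>) powr q * b powr q"
proof (cases "b \<le> \<kappa> * a")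
  case True
  then have "(a + b) powr q \<le> ((1 + \<kappa>) * a) powr q"
    using assms by (intro powr_mono2) (auto simp: algebra_simps)
  then show ?thesis using assms by (simp add: powr_mult add_increasing2)
next
  case False
  define m where "m = 1 + 1 / \<kappa>"
  have m: "m > 0" unfolding m_def using assms by (intro add_pos_pos) auto
  have "a + b \<le> m * b" using False assms by (simp add: m_def field_simps)
  then have "(a + b) powr q \<le> (m * b) powr q"
    using assms by (intro powr_mono2) auto
  then show ?thesis using assms m unfolding m_def[symmetric] by (simp add: powr_mult add_increasing)
qed

lemma mean_value_inequality_segment:
  fixes F :: "complex \<Rightarrow> complex"
  assumes F: "F holomorphic_on UNIV"
  obtains \<zeta> where "\<zeta> \<in> closed_segment x y" "norm (F x - F y) \<le> norm (deriv F \<zeta>) * dist x y"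
proof -
  have dF: "deriv F holomorphic_on UNIV" using F by (simp add: holomorphic_deriv)
  then have "continuous_on (closed_segment x y) (\<lambda>w. norm (deriv F w))"
    by (intro continuous_on_norm) (auto intro: holomorphic_on_imp_continuous_on holomorphic_on_subset)
  then obtain \<zeta> where \<zeta>: "\<zeta> \<in> closed_segment x y" "\<And>w. w \<in> closed_segment x y \<Longrightarrow> norm (deriv F w) \<le> norm (deriv F \<zeta>)"
    using continuous_attains_sup[of "closed_segment x y" "\<lambda>w. norm (deriv F w)"] by auto
  have "norm (F x - F y) \<le> norm (deriv F \<zeta>) * norm (x - y)"
  proof (rule field_differentiable_bound[where S="closed_segment x y" and f'="deriv F"])
    show "(F has_field_derivative deriv F w) (at w within closed_segment x y)" for w
      using F by (simp add: holomorphic_derivI[of _ UNIV] has_field_derivative_at_within)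
  qed (use \<zeta> in auto)
  then show thesis using that \<zeta> by (simp add: dist_norm)
qed

section \<open>Recovering an entire function from its derivative\<close>

definition annulus :: "nat \<Rightarrow> complex set" where
  "annulus n = {z. real n \<le> (norm z)\<^sup>2 \<and> (norm z)\<^sup>2 < real n + 1}"

definition shrink :: "nat \<Rightarrow> real" where
  "shrink n = sqrt (1 - 1 / real n)"

definition annulus_mass :: "real \<Rightarrow> real \<Rightarrow> (complex \<Rightarrow> complex) \<Rightarrow> nat \<Rightarrow> ennreal" where
  "annulus_mass q c F n = (\<integral>\<^sup>+z. ennreal (wpowr q c F z) * indicator (annulus n) z \<partial>lborel)"

lemma annulus_measurable [measurable]: "annulus n \<in> sets borel"
proof -
  have "annulus n = {z \<in> space borel. real n \<le> (norm z)\<^sup>2 \<and> (norm z)\<^sup>2 < real n + 1}"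
    by (simp add: annulus_def)
  then show ?thesis by simp
qed

lemma mem_annulus_floor: "z \<in> annulus (nat \<lfloor>(norm z)\<^sup>2\<rfloor>)"
  by (simp add: annulus_def of_nat_nat)

lemma mem_annulus_iff: "z \<in> annulus n \<longleftrightarrow> nat \<lfloor>(norm z)\<^sup>2\<rfloor> = n"
proof -
  have "z \<in> annulus n \<longleftrightarrow> \<lfloor>(norm z)\<^sup>2\<rfloor> = int n" by (auto simp: annulus_def floor_eq_iff)
  then show ?thesis by (auto simp: nat_eq_iff)
qed

lemma sum_indicator_annulus:
  "(\<Sum>n<M. indicator (annulus n) z) = (indicator {z. (norm z)\<^sup>2 < real M} z :: ennreal)"
  by (induction M) (auto simp: annulus_def split: split_indicator)

lemma annulus_subset_ball: "annulus n \<subseteq> ball 0 (sqrt (real n + 1))"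
  by (auto simp: annulus_def real_less_rsqrt)

text \<open>The factor \<open>shrink n\<close> removes the fraction \<open>1 / n\<close> of the squared modulus. On the annulus this is
  at least \<open>1\<close>, and it does not lead below \<open>n - 1\<close>.\<close>
lemma shrink_annulus:
  assumes n: "n \<ge> 2" and z: "z \<in> annulus n"
  shows "(norm (shrink n *\<^sub>R z))\<^sup>2 \<le> (norm z)\<^sup>2 - 1" "shrink n *\<^sub>R z \<in> annulus (n - 1)"
    "dist z (shrink n *\<^sub>R z) \<le> norm z / real n"
proof -
  define t where "t = shrink n"
  have z: "real n \<le> (norm z)\<^sup>2" "(norm z)\<^sup>2 < real n + 1" using z by (auto simp: annulus_def)
  have n: "real n \<ge> 2" using n by simp
  have t2: "t\<^sup>2 = 1 - 1 / real n" using n by (simp add: t_def shrink_def)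
  have t01: "0 \<le> t" "t \<le> 1" using n by (auto simp: t_def shrink_def real_sqrt_le_1_iff)
  have nt: "(norm (t *\<^sub>R z))\<^sup>2 = (1 - 1 / real n) * (norm z)\<^sup>2"
    using t2 by (simp add: power_mult_distrib)
  have eq: "(1 - 1 / real n) * (norm z)\<^sup>2 = (norm z)\<^sup>2 - (norm z)\<^sup>2 / real n" by (simp add: algebra_simps)
  show "(norm (shrink n *\<^sub>R z))\<^sup>2 \<le> (norm z)\<^sup>2 - 1"
    unfolding t_def[symmetric] nt eq using z n by (simp add: field_simps)
  have "(1 - 1 / real n) * real n \<le> (1 - 1 / real n) * (norm z)\<^sup>2"
    using z n by (intro mult_left_mono) auto
  moreover have "(1 - 1 / real n) * real n = real (n - 1)" using n by (simp add: field_simps of_nat_diff)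
  ultimately have lo: "real (n - 1) \<le> (norm (t *\<^sub>R z))\<^sup>2" unfolding nt by simp
  have "(1 - 1 / real n) * (norm z)\<^sup>2 < (1 - 1 / real n) * (real n + 1)"
    using z n by (intro mult_strict_left_mono) auto
  also have "\<dots> = real n - 1 / real n" using n by (simp add: field_simps)
  also have "\<dots> < real (n - 1) + 1" using n by (simp add: of_nat_diff)
  finally have "(norm (t *\<^sub>R z))\<^sup>2 < real (n - 1) + 1" unfolding nt .
  with lo show "shrink n *\<^sub>R z \<in> annulus (n - 1)" unfolding annulus_def t_def by blast
  have "t * t \<le> t" using t01 mult_left_le[of t t] by simp
  then have "1 - t \<le> 1 / real n" using t2 by (simp add: power2_eq_square)
  have "dist z (t *\<^sub>R z) = norm ((1 - t) *\<^sub>R z)" by (simp add: dist_norm algebra_simps)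
  also have "\<dots> = (1 - t) * norm z" using t01 by simp
  also have "\<dots> \<le> (1 / real n) * norm z" using \<open>1 - t \<le> 1 / real n\<close> by (intro mult_right_mono) auto
  finally show "dist z (shrink n *\<^sub>R z) \<le> norm z / real n" by (simp add: t_def)
qed

text \<open>Substituting \<open>w = shrink n \<cdot> z\<close> sends the annulus into the preceding one and gains the
  factor \<open>exp (- c)\<close> from the Gaussian. The denominator \<open>1 - 1 / n\<close> is the Jacobian.\<close>
lemma annulus_mass_recursion:
  assumes F: "F holomorphic_on UNIV" and q: "0 < q" and c: "0 < c" and \<kappa>: "0 < \<kappa>" and n: "n \<ge> 2"
  shows "annulus_mass q c F n \<le> ennreal ((1 + \<kappa>) powr q * exp (- c) / (1 - 1 / real n)) * annulus_mass q c F (n - 1)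
    + ennreal ((1 + 1 / \<kappa>) powr q) * (\<integral>\<^sup>+z. ennreal (wpowr q c (\<lambda>z. F z - F (shrink n *\<^sub>R z)) z) * indicator (annulus n) z \<partial>lborel)"
proof -
  have [measurable]: "F \<in> borel_measurable borel" using F by measurable
  define t where "t = shrink n"
  have t: "t > 0" "t\<^sup>2 = 1 - 1 / real n" using n by (auto simp: t_def shrink_def)
  define L where "L = (1 + \<kappa>) powr q * exp (- c)"
  define K where "K = (1 + 1 / \<kappa>) powr q"
  have LK: "L \<ge> 0" "K \<ge> 0" by (simp_all add: L_def K_def)
  define W where "W z = wpowr q c F z" for z
  define D where "D z = wpowr q c (\<lambda>z. F z - F (t *\<^sub>R z)) z" for z
  have [measurable]: "W \<in> borel_measurable borel" "D \<in> borel_measurable borel" unfolding W_def D_def by measurable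
  define I where "I = (\<integral>\<^sup>+z. ennreal (W (t *\<^sub>R z)) * indicator (annulus (n - 1)) (t *\<^sub>R z) \<partial>lborel)"
  have "annulus_mass q c F n \<le> (\<integral>\<^sup>+z. ennreal L * (ennreal (W (t *\<^sub>R z)) * indicator (annulus (n - 1)) (t *\<^sub>R z))
      + ennreal K * (ennreal (D z) * indicator (annulus n) z) \<partial>lborel)"
    unfolding annulus_mass_def W_def[symmetric]
  proof (rule nn_integral_mono)
    fix z :: complex
    show "ennreal (W z) * indicator (annulus n) z \<le> ennreal L * (ennreal (W (t *\<^sub>R z)) * indicator (annulus (n - 1)) (t *\<^sub>R z))
      + ennreal K * (ennreal (D z) * indicator (annulus n) z)"
    proof (cases "z \<in> annulus n")
      case True
      note sh = shrink_annulus[OF n True, folded t_def]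
      define \<delta> where "\<delta> = norm (F z - F (t *\<^sub>R z))"
      define e where "e = exp (- c * (norm z)\<^sup>2)"
      have "norm (F z) \<le> norm (F (t *\<^sub>R z)) + \<delta>"
        unfolding \<delta>_def using norm_triangle_ineq2[of "F z" "F (t *\<^sub>R z)"] by simp
      then have "norm (F z) powr q \<le> (norm (F (t *\<^sub>R z)) + \<delta>) powr q"
        using q by (intro powr_mono2) auto
      also have "\<dots> \<le> (1 + \<kappa>) powr q * norm (F (t *\<^sub>R z)) powr q + K * \<delta> powr q"
        unfolding K_def by (intro powr_add_le_split \<kappa> q) (auto simp: \<delta>_def)
      finally have "W z \<le> ((1 + \<kappa>) powr q * norm (F (t *\<^sub>R z)) powr q + K * \<delta> powr q) * e"
        unfolding W_def e_def by (rule mult_right_mono) simp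
      also have "\<dots> = (1 + \<kappa>) powr q * norm (F (t *\<^sub>R z)) powr q * e + K * D z"
        unfolding D_def e_def \<delta>_def by (simp only: distrib_right mult.assoc)
      also have "\<dots> \<le> (1 + \<kappa>) powr q * norm (F (t *\<^sub>R z)) powr q * (exp (- c) * exp (- c * (norm (t *\<^sub>R z))\<^sup>2)) + K * D z"
      proof (intro add_right_mono mult_left_mono)
        have "c * (norm (t *\<^sub>R z))\<^sup>2 \<le> c * ((norm z)\<^sup>2 - 1)" using c sh(1) by (intro mult_left_mono) auto
        then show "e \<le> exp (- c) * exp (- c * (norm (t *\<^sub>R z))\<^sup>2)"
          unfolding e_def by (simp add: algebra_simps flip: exp_add)
      qed simp
      also have "\<dots> = L * W (t *\<^sub>R z) + K * D z" unfolding L_def W_def by (simp only: mult_ac)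
      finally have "ennreal (W z) \<le> ennreal (L * W (t *\<^sub>R z) + K * D z)" by (rule ennreal_leI)
      also have "\<dots> = ennreal L * ennreal (W (t *\<^sub>R z)) + ennreal K * ennreal (D z)"
        using LK by (subst ennreal_plus) (simp_all add: ennreal_mult' W_def D_def)
      finally show ?thesis using True sh(2) by simp
    qed simp
  qed
  also have "\<dots> = ennreal L * I + ennreal K * (\<integral>\<^sup>+z. ennreal (D z) * indicator (annulus n) z \<partial>lborel)"
    unfolding I_def by (simp add: nn_integral_add nn_integral_cmult)
  also have "ennreal L * I = ennreal (L / (1 - 1 / real n)) * annulus_mass q c F (n - 1)"
  proof -
    have "annulus_mass q c F (n - 1) = ennreal (t\<^sup>2) * I"
      unfolding annulus_mass_def W_def[symmetric] I_def by (subst nn_integral_lborel_scale[OF _ t(1)]) simp_all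
    moreover have "0 \<le> L / t\<^sup>2" using LK by simp
    ultimately have "ennreal (L / t\<^sup>2) * annulus_mass q c F (n - 1) = ennreal (L / t\<^sup>2 * t\<^sup>2) * I"
      by (simp only: ennreal_mult' mult.assoc)
    then show ?thesis using t(1) unfolding t(2)[symmetric] by simp
  qed
  finally show ?thesis by (simp add: L_def K_def D_def t_def)
qed

text \<open>On the \<open>n\<close>-th annulus \<open>z\<close> and \<open>shrink n \<cdot> z\<close> are within \<open>2 / (1 + norm z)\<close> of each other,
  so that the difference of the values of \<open>F\<close> is governed by the local supremum of the derivative.\<close>
lemma radial_difference_sum_bound:
  fixes c q :: real
  assumes q: "0 < q" and c: "0 < c"
  obtains C :: real where "C > 0" and
    "\<And>F N M. F holomorphic_on UNIV \<Longrightarrow> N \<ge> 5 \<Longrightarrow>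
       (\<Sum>n\<in>{N..<M}. \<integral>\<^sup>+z. ennreal (wpowr q c (\<lambda>z. F z - F (shrink n *\<^sub>R z)) z) * indicator (annulus n) z \<partial>lborel)
         \<le> ennreal C * (\<integral>\<^sup>+z. ennreal (dpowr q q c (deriv F) z) \<partial>lborel)"
proof -
  obtain C :: real where C: "C > 0" and local:
    "\<And>H \<Phi>. H holomorphic_on UNIV \<Longrightarrow>
       (\<And>z. 0 \<le> \<Phi> z \<and> (\<exists>\<zeta>. dist z \<zeta> \<le> 2 / (1 + norm z) \<and> \<Phi> z \<le> norm (H \<zeta>))) \<Longrightarrow>
       (\<integral>\<^sup>+z. ennreal (\<Phi> z powr q * (1 + norm z) powr (- q) * exp (- c * (norm z)\<^sup>2)) \<partial>lborel)
         \<le> ennreal C * (\<integral>\<^sup>+w. ennreal (dpowr q q c H w) \<partial>lborel)"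
    using weighted_local_sup_bound[OF q less_imp_le[OF c], of q] by blast
  show thesis
  proof (rule that[of "2 powr q * C"])
    show "2 powr q * C > 0" using C by simp
    fix F :: "complex \<Rightarrow> complex" and N M :: nat
    assume F: "F holomorphic_on UNIV" and N: "N \<ge> 5"
    have dF: "deriv F holomorphic_on UNIV" using F by (simp add: holomorphic_deriv)
    have [measurable]: "F \<in> borel_measurable borel" using F by measurable
    define \<delta> where "\<delta> n z = norm (F z - F (shrink n *\<^sub>R z))" for n z
    define \<Psi> where "\<Psi> z = (if real N \<le> (norm z)\<^sup>2 then (1 + norm z) / 2 * \<delta> (nat \<lfloor>(norm z)\<^sup>2\<rfloor>) z else 0)" for z
    have p: "1 + norm z > 0" for z :: complex by (simp add: add_pos_nonneg)
    have \<Psi>: "0 \<le> \<Psi> z \<and> (\<exists>\<zeta>. dist z \<zeta> \<le> 2 / (1 + norm z) \<and> \<Psi> z \<le> norm (deriv F \<zeta>))" for z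
    proof (cases "real N \<le> (norm z)\<^sup>2")
      case False
      then show ?thesis by (auto simp: \<Psi>_def intro!: exI[of _ z])
    next
      case True
      define n where "n = nat \<lfloor>(norm z)\<^sup>2\<rfloor>"
      have zn: "z \<in> annulus n" unfolding n_def by (rule mem_annulus_floor)
      have n: "(norm z)\<^sup>2 < real n + 1" "N \<le> n"
        using True by (auto simp: n_def le_nat_iff le_floor_iff of_nat_nat)
      have n5: "real n \<ge> 5" "n \<ge> 2" using n N by simp_all
      have "real n * 5 \<le> real n * real n" using n5 by (intro mult_left_mono) auto
      then have "real n + 1 \<le> (real n - 1)\<^sup>2" using n5 by (simp add: power2_eq_square algebra_simps)
      then have "(norm z)\<^sup>2 < (real n - 1)\<^sup>2" using n by linarith
      then have "norm z < real n - 1" using n5 by (rule_tac power2_less_imp_less) auto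
      then have "norm z * (1 + norm z) \<le> 2 * real n" using n by (simp add: power2_eq_square algebra_simps)
      then have small: "norm z / real n \<le> 2 / (1 + norm z)" using p[of z] n5 by (simp add: field_simps)
      obtain \<zeta> where \<zeta>: "\<zeta> \<in> closed_segment z (shrink n *\<^sub>R z)" "\<delta> n z \<le> norm (deriv F \<zeta>) * dist z (shrink n *\<^sub>R z)"
        using mean_value_inequality_segment[OF F] unfolding \<delta>_def by blast
      have dist: "dist z (shrink n *\<^sub>R z) \<le> 2 / (1 + norm z)" using shrink_annulus(3)[OF n5(2) zn] small by linarith
      have "dist z \<zeta> \<le> dist z (shrink n *\<^sub>R z)"
        using segment_bound(1)[OF \<zeta>(1)] by (simp add: dist_norm norm_minus_commute)
      then have 1: "dist z \<zeta> \<le> 2 / (1 + norm z)" using dist by linarith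
      have "\<delta> n z \<le> norm (deriv F \<zeta>) * (2 / (1 + norm z))"
        using \<zeta>(2) mult_left_mono[OF dist norm_ge_zero[of "deriv F \<zeta>"]] by linarith
      then have "(1 + norm z) / 2 * \<delta> n z \<le> norm (deriv F \<zeta>)" using p[of z] by (simp add: field_simps)
      then have "\<Psi> z \<le> norm (deriv F \<zeta>)" using True by (simp add: \<Psi>_def n_def)
      moreover have "0 \<le> \<Psi> z" using p[of z] by (simp add: \<Psi>_def \<delta>_def)
      ultimately show ?thesis using 1 by blast
    qed
    define G where "G z = \<Psi> z powr q * (1 + norm z) powr (- q) * exp (- c * (norm z)\<^sup>2)" for z
    have G0: "G z \<ge> 0" for z by (simp add: G_def)
    have [measurable]: "G \<in> borel_measurable borel" unfolding G_def \<Psi>_def \<delta>_def shrink_def by measurable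
    have termwise: "ennreal (wpowr q c (\<lambda>z. F z - F (shrink n *\<^sub>R z)) z) * indicator (annulus n) z \<le> ennreal (2 powr q * G z) * indicator (annulus n) z"
      if "N \<le> n" for n z
    proof (cases "z \<in> annulus n")
      case True
      then have "real N \<le> (norm z)\<^sup>2" "nat \<lfloor>(norm z)\<^sup>2\<rfloor> = n" using that mem_annulus_iff[of z n] by (auto simp: annulus_def)
      then have "\<Psi> z = (1 + norm z) / 2 * \<delta> n z" by (simp add: \<Psi>_def)
      then have "\<delta> n z = 2 * (\<Psi> z / (1 + norm z))" using p[of z] by (simp add: field_simps)
      moreover have "0 \<le> \<Psi> z / (1 + norm z)" using \<Psi>[of z] p[of z] by simp
      ultimately have "\<delta> n z powr q = 2 powr q * (\<Psi> z powr q * (1 + norm z) powr (- q))"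
        using \<Psi>[of z] p[of z] by (simp add: powr_mult powr_divide powr_minus_divide)
      then show ?thesis by (simp add: G_def \<delta>_def mult_ac)
    qed simp
    have "(\<Sum>n\<in>{N..<M}. \<integral>\<^sup>+z. ennreal (wpowr q c (\<lambda>z. F z - F (shrink n *\<^sub>R z)) z) * indicator (annulus n) z \<partial>lborel)
      \<le> (\<Sum>n\<in>{N..<M}. \<integral>\<^sup>+z. ennreal (2 powr q * G z) * indicator (annulus n) z \<partial>lborel)"
      by (intro sum_mono nn_integral_mono termwise) simp
    also have "\<dots> \<le> (\<Sum>n<M. \<integral>\<^sup>+z. ennreal (2 powr q * G z) * indicator (annulus n) z \<partial>lborel)"
      by (intro sum_mono2) auto
    also have "\<dots> = (\<integral>\<^sup>+z. ennreal (2 powr q * G z) * (\<Sum>n<M. indicator (annulus n) z) \<partial>lborel)"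
      unfolding sum_distrib_left by (rule nn_integral_sum[symmetric]) measurable
    also have "\<dots> \<le> (\<integral>\<^sup>+z. ennreal (2 powr q) * ennreal (G z) \<partial>lborel)"
      unfolding sum_indicator_annulus by (intro nn_integral_mono) (simp add: ennreal_mult' split: split_indicator)
    also have "\<dots> = ennreal (2 powr q) * (\<integral>\<^sup>+z. ennreal (G z) \<partial>lborel)" by (rule nn_integral_cmult) measurable
    also have "\<dots> \<le> ennreal (2 powr q) * (ennreal C * (\<integral>\<^sup>+z. ennreal (dpowr q q c (deriv F) z) \<partial>lborel))"
      unfolding G_def by (intro mult_left_mono local[OF dF \<Psi>]) auto
    finally show "(\<Sum>n\<in>{N..<M}. \<integral>\<^sup>+z. ennreal (wpowr q c (\<lambda>z. F z - F (shrink n *\<^sub>R z)) z) * indicator (annulus n) z \<partial>lborel)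
         \<le> ennreal (2 powr q * C) * (\<integral>\<^sup>+z. ennreal (dpowr q q c (deriv F) z) \<partial>lborel)"
      by (simp only: ennreal_mult'[OF powr_ge_zero] mult.assoc)
  qed
qed

text \<open>On a bounded disc the weights are bounded from both sides. There \<open>norm (F z) \<le> R * norm (F' \<zeta>)\<close> for some \<open>\<zeta>\<close> in
  the disc, and the sub-mean value property bounds this by a fixed integral of \<open>F'\<close>.\<close>
lemma disc_mass_bound:
  fixes c q R :: real
  assumes q: "0 < q" and c: "0 < c" and R: "0 < R"
  obtains C :: real where "C > 0" and
    "\<And>F. F holomorphic_on UNIV \<Longrightarrow> F 0 = 0 \<Longrightarrow>
       (\<integral>\<^sup>+z. ennreal (wpowr q c F z) * indicator (ball 0 R) z \<partial>lborel)
         \<le> ennreal C * (\<integral>\<^sup>+z. ennreal (dpowr q q c (deriv F) z) \<partial>lborel)"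
proof -
  obtain C1 :: real where C1: "C1 > 0" and sub: "\<And>H a r. H holomorphic_on UNIV \<Longrightarrow> r > 0 \<Longrightarrow>
       ennreal (norm (H a) powr q) \<le> ennreal (C1 / r\<^sup>2) *
         (\<integral>\<^sup>+w. ennreal (norm (H w) powr q) * indicator (ball a r) w \<partial>lborel)"
    using entire_powr_sub_mean_value[OF q] by blast
  define L where "L = (2 + R) powr q * exp (c * (R + 1)\<^sup>2)"
  define C3 where "C3 = R powr q * (C1 * L)"
  have L: "L > 0" using R by (simp add: L_def)
  then have C3: "C3 > 0" using C1 R by (simp add: C3_def)
  show thesis
  proof (rule that[of "C3 * (pi * R\<^sup>2)"])
    show "C3 * (pi * R\<^sup>2) > 0" using C3 R by simp
    fix F :: "complex \<Rightarrow> complex" assume F: "F holomorphic_on UNIV" and F0: "F 0 = 0"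
    have dF: "deriv F holomorphic_on UNIV" using F by (simp add: holomorphic_deriv)
    have [measurable]: "F \<in> borel_measurable borel" "deriv F \<in> borel_measurable borel" using F dF by measurable
    define V where "V z = dpowr q q c (deriv F) z" for z
    have [measurable]: "V \<in> borel_measurable borel" unfolding V_def by measurable
    define I where "I = (\<integral>\<^sup>+z. ennreal (V z) \<partial>lborel)"
    have near: "ennreal (norm (deriv F w) powr q) * indicator (ball \<zeta> 1) w \<le> ennreal L * ennreal (V w)" if "norm \<zeta> \<le> R" for \<zeta> w
    proof (cases "w \<in> ball \<zeta> 1")
      case True
      have p: "1 + norm w > 0" by (simp add: add_pos_nonneg)
      have "norm w \<le> norm \<zeta> + dist \<zeta> w"
        using norm_triangle_ineq2[of w \<zeta>] by (simp add: dist_norm norm_minus_commute)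
      then have wR: "norm w \<le> R + 1" using True that by simp
      then have "(norm w)\<^sup>2 \<le> (R + 1)\<^sup>2" by (intro power_mono) auto
      then have "exp (c * (norm w)\<^sup>2) \<le> exp (c * (R + 1)\<^sup>2)" using c by simp
      moreover have "(1 + norm w) powr q \<le> (2 + R) powr q" using wR q p by (intro powr_mono2) auto
      ultimately have 1: "(1 + norm w) powr q * exp (c * (norm w)\<^sup>2) \<le> L"
        unfolding L_def by (intro mult_mono) auto
      have "(1 + norm w) powr q * exp (c * (norm w)\<^sup>2) * V w
        = norm (deriv F w) powr q * ((1 + norm w) powr q * (1 + norm w) powr (- q)) * (exp (c * (norm w)\<^sup>2) * exp (- c * (norm w)\<^sup>2))"
        unfolding V_def by (simp only: mult_ac)
      also have "\<dots> = norm (deriv F w) powr q" using p by (simp flip: powr_add exp_add)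
      finally have "norm (deriv F w) powr q = (1 + norm w) powr q * exp (c * (norm w)\<^sup>2) * V w" ..
      also have "\<dots> \<le> L * V w" using 1 by (rule mult_right_mono) (simp add: V_def)
      finally have "ennreal (norm (deriv F w) powr q) \<le> ennreal (L * V w)" by (rule ennreal_leI)
      then show ?thesis using True L by (simp add: ennreal_mult')
    qed simp
    have "(\<integral>\<^sup>+z. ennreal (wpowr q c F z) * indicator (ball 0 R) z \<partial>lborel)
       \<le> (\<integral>\<^sup>+z. (ennreal C3 * I) * indicator (ball (0::complex) R) z \<partial>lborel)"
    proof (rule nn_integral_mono)
      fix z :: complex
      show "ennreal (wpowr q c F z) * indicator (ball 0 R) z \<le> (ennreal C3 * I) * indicator (ball 0 R) z"
      proof (cases "norm z < R")
        case True
        obtain \<zeta> where \<zeta>: "\<zeta> \<in> closed_segment z 0" "norm (F z - F 0) \<le> norm (deriv F \<zeta>) * dist z 0"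
          using mean_value_inequality_segment[OF F] by blast
        have \<zeta>R: "norm \<zeta> \<le> R" using segment_bound(2)[OF \<zeta>(1)] True by simp
        have "norm (F z) \<le> R * norm (deriv F \<zeta>)"
          using \<zeta>(2) F0 mult_left_mono[OF less_imp_le[OF True] norm_ge_zero[of "deriv F \<zeta>"]] by (simp add: mult.commute)
        then have "norm (F z) powr q \<le> R powr q * norm (deriv F \<zeta>) powr q"
          using q powr_mono2[of q "norm (F z)" "R * norm (deriv F \<zeta>)"] by (simp add: powr_mult)
        moreover have "wpowr q c F z \<le> norm (F z) powr q * 1" using c by (intro mult_left_mono) auto
        ultimately have "ennreal (wpowr q c F z) \<le> ennreal (R powr q * norm (deriv F \<zeta>) powr q)"
          by (intro ennreal_leI) linarith
        also have "\<dots> = ennreal (R powr q) * ennreal (norm (deriv F \<zeta>) powr q)" by (simp add: ennreal_mult')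
        also have "\<dots> \<le> ennreal (R powr q) * (ennreal (C1 / 1\<^sup>2) *
            (\<integral>\<^sup>+w. ennreal (norm (deriv F w) powr q) * indicator (ball \<zeta> 1) w \<partial>lborel))"
          by (intro mult_left_mono sub[OF dF]) auto
        also have "\<dots> \<le> ennreal (R powr q) * (ennreal (C1 / 1\<^sup>2) * (\<integral>\<^sup>+w. ennreal L * ennreal (V w) \<partial>lborel))"
          by (intro mult_left_mono nn_integral_mono near \<zeta>R) auto
        also have "\<dots> = ennreal (R powr q) * (ennreal C1 * (ennreal L * I))"
          unfolding I_def by (subst nn_integral_cmult) simp_all
        also have "\<dots> = ennreal C3 * I"
          using C1 by (simp add: C3_def ennreal_mult' mult.assoc)
        finally show ?thesis using True by simp
      qed simp
    qed
    also have "\<dots> = (ennreal C3 * I) * ennreal (pi * R\<^sup>2)"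
      using R by (subst nn_integral_cmult_indicator) (simp_all add: emeasure_disc)
    also have "\<dots> = ennreal (C3 * (pi * R\<^sup>2)) * I"
      by (simp only: ennreal_mult'[OF less_imp_le[OF C3]] mult_ac)
    finally show "(\<integral>\<^sup>+z. ennreal (wpowr q c F z) * indicator (ball 0 R) z \<partial>lborel)
       \<le> ennreal (C3 * (pi * R\<^sup>2)) * (\<integral>\<^sup>+z. ennreal (dpowr q q c (deriv F) z) \<partial>lborel)"
      by (simp add: I_def V_def)
  qed
qed

lemma annulus_mass_finite:
  assumes F: "F holomorphic_on UNIV" and q: "0 < q" and c: "0 < c"
  shows "annulus_mass q c F n < \<infinity>"
proof -
  define R where "R = sqrt (real n + 1)"
  have "compact (F ` cball 0 R)"
    by (intro compact_continuous_image continuous_on_subset[OF holomorphic_on_imp_continuous_on[OF F]]) auto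
  then obtain B where B: "\<And>z. z \<in> cball 0 R \<Longrightarrow> norm (F z) \<le> B"
    by (meson bounded_iff compact_imp_bounded imageI)
  have "annulus_mass q c F n \<le> (\<integral>\<^sup>+z. ennreal (B powr q) * indicator (ball (0::complex) R) z \<partial>lborel)"
    unfolding annulus_mass_def
  proof (rule nn_integral_mono)
    fix z :: complex
    show "ennreal (wpowr q c F z) * indicator (annulus n) z \<le> ennreal (B powr q) * indicator (ball 0 R) z"
    proof (cases "z \<in> annulus n")
      case True
      then have zR: "z \<in> ball 0 R" using annulus_subset_ball unfolding R_def by blast
      then have "norm (F z) \<le> B" by (intro B) simp
      then have "wpowr q c F z \<le> B powr q * 1"
        using q c by (intro mult_mono powr_mono2) auto
      then show ?thesis using True zR by (simp add: ennreal_leI)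
    qed simp
  qed
  also have "\<dots> < \<infinity>"
    by (subst nn_integral_cmult_indicator) (simp_all add: emeasure_disc R_def ennreal_mult_less_top)
  finally show ?thesis .
qed

text \<open>With \<open>a\<close> the masses of the annuli, the recursion reads \<open>a n \<le> \<theta> a (n - 1) + b n\<close> with
  \<open>\<theta> < 1\<close> for large \<open>n\<close>. Since every \<open>a n\<close> is finite, \<open>\<theta> (\<Sum>n<M. a n)\<close> can be absorbed in the partial
  sums, which leaves the bounded disc and the differences, both controlled by the derivative.\<close>
lemma fock_derivative_lower_bound:
  fixes c q :: real
  assumes q: "0 < q" and c: "0 < c"
  obtains C :: real where "C > 0" and
    "\<And>F. F holomorphic_on UNIV \<Longrightarrow> F 0 = 0 \<Longrightarrow>
       (\<integral>\<^sup>+z. ennreal (wpowr q c F z) \<partial>lborel) \<le> ennreal C * (\<integral>\<^sup>+z. ennreal (dpowr q q c (deriv F) z) \<partial>lborel)"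
proof -
  define \<theta> where "\<theta> = exp (- c / 2)"
  have \<theta>: "0 < \<theta>" "\<theta> < 1" using c by (simp_all add: \<theta>_def)
  \<comment> \<open>Half of the gain \<open>exp (- c)\<close> pays for \<open>(1 + \<kappa>) powr q\<close> and for the Jacobian.\<close>
  define \<kappa> where "\<kappa> = exp (c / (4 * q)) - 1"
  have \<kappa>: "\<kappa> > 0" using c q by (simp add: \<kappa>_def)
  have \<kappa>q: "(1 + \<kappa>) powr q = exp (c / 4)" using q by (simp add: \<kappa>_def exp_powr_real)
  define K where "K = (1 + 1 / \<kappa>) powr q"
  have K: "K \<ge> 0" by (simp add: K_def)
  have e1: "exp (c / 4) > 1" using c by simp
  obtain N0 :: nat where N0: "1 / (exp (c / 4) - 1) < real N0" using reals_Archimedean2 by blast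
  define N where "N = N0 + 5"
  have ratio: "(1 + \<kappa>) powr q * exp (- c) / (1 - 1 / real n) \<le> \<theta>" if "n \<ge> N" for n
  proof -
    have n: "real n > 1 / (exp (c / 4) - 1) + 1" "real n \<ge> 5" using that N0 by (auto simp: N_def)
    have "1 / (exp (c / 4) - 1) < real n - 1" using n(1) by linarith
    then have "1 < (real n - 1) * (exp (c / 4) - 1)" using e1 by (subst (asm) pos_divide_less_eq) auto
    then have "real n < exp (c / 4) * (real n - 1)" by (simp add: algebra_simps)
    moreover have "1 / (1 - 1 / real n) = real n / (real n - 1)" using n(2) by (simp add: divide_simps)
    moreover have "real n - 1 > 0" using n(2) by linarith
    ultimately have "1 / (1 - 1 / real n) \<le> exp (c / 4)" by (simp add: pos_divide_le_eq)
    then have "exp (c / 4) * exp (- c) * (1 / (1 - 1 / real n)) \<le> exp (c / 4) * exp (- c) * exp (c / 4)"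
      by (rule mult_left_mono) simp
    also have "\<dots> = \<theta>" by (simp add: \<theta>_def flip: exp_add)
    finally show ?thesis unfolding \<kappa>q by simp
  qed
  obtain C1 :: real where C1: "C1 > 0" and disc: "\<And>F. F holomorphic_on UNIV \<Longrightarrow> F 0 = 0 \<Longrightarrow>
       (\<integral>\<^sup>+z. ennreal (wpowr q c F z) * indicator (ball 0 (sqrt (real N))) z \<partial>lborel)
         \<le> ennreal C1 * (\<integral>\<^sup>+z. ennreal (dpowr q q c (deriv F) z) \<partial>lborel)"
    using disc_mass_bound[OF q c, of "sqrt (real N)"] by (auto simp: N_def)
  obtain C2 :: real where C2: "C2 > 0" and diff: "\<And>F N M. F holomorphic_on UNIV \<Longrightarrow> N \<ge> 5 \<Longrightarrow>
       (\<Sum>n\<in>{N..<M}. \<integral>\<^sup>+z. ennreal (wpowr q c (\<lambda>z. F z - F (shrink n *\<^sub>R z)) z) * indicator (annulus n) z \<partial>lborel)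
         \<le> ennreal C2 * (\<integral>\<^sup>+z. ennreal (dpowr q q c (deriv F) z) \<partial>lborel)"
    using radial_difference_sum_bound[OF q c] by blast
  define C where "C = (C1 + K * C2) / (1 - \<theta>)"
  have C: "C > 0" using C1 K C2 \<theta> by (simp add: C_def add_pos_nonneg)
  show thesis
  proof (rule that[OF C])
    fix F :: "complex \<Rightarrow> complex" assume F: "F holomorphic_on UNIV" and F0: "F 0 = 0"
    have [measurable]: "F \<in> borel_measurable borel" using F by measurable
    define I where "I = (\<integral>\<^sup>+z. ennreal (dpowr q q c (deriv F) z) \<partial>lborel)"
    define a where "a n = annulus_mass q c F n" for n
    define b where "b n = (\<integral>\<^sup>+z. ennreal (wpowr q c (\<lambda>z. F z - F (shrink n *\<^sub>R z)) z) * indicator (annulus n) z \<partial>lborel)" for n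
    have step: "a n \<le> ennreal \<theta> * a (n - 1) + ennreal K * b n" if n: "n \<ge> N" for n
    proof -
      have "a n \<le> ennreal ((1 + \<kappa>) powr q * exp (- c) / (1 - 1 / real n)) * a (n - 1) + ennreal K * b n"
        unfolding a_def b_def K_def by (rule annulus_mass_recursion[OF F q c \<kappa>]) (use n in \<open>simp add: N_def\<close>)
      also have "\<dots> \<le> ennreal \<theta> * a (n - 1) + ennreal K * b n"
        by (intro add_right_mono mult_right_mono ennreal_leI ratio n) simp
      finally show ?thesis .
    qed
    have suma: "(\<Sum>n<N. a n) \<le> ennreal C1 * I"
    proof -
      have "(\<Sum>n<N. a n) = (\<integral>\<^sup>+z. ennreal (wpowr q c F z) * (\<Sum>n<N. indicator (annulus n) z) \<partial>lborel)"
        unfolding a_def annulus_mass_def sum_distrib_left by (rule nn_integral_sum[symmetric]) measurable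
      also have "\<dots> = (\<integral>\<^sup>+z. ennreal (wpowr q c F z) * indicator (ball 0 (sqrt (real N))) z \<partial>lborel)"
      proof -
        have "(norm z)\<^sup>2 < real N \<longleftrightarrow> norm z < sqrt (real N)" for z :: complex
          using real_sqrt_less_iff[of "(norm z)\<^sup>2" "real N"] by simp
        then have "{z::complex. (norm z)\<^sup>2 < real N} = ball 0 (sqrt (real N))"
          by (intro set_eqI) (simp only: mem_Collect_eq mem_ball_0)
        then show ?thesis by (simp only: sum_indicator_annulus)
      qed
      finally show ?thesis using disc[OF F F0] by (simp add: I_def)
    qed
    have sumb: "(\<Sum>n\<in>{N..<M}. b n) \<le> ennreal C2 * I" for M
      unfolding b_def I_def by (rule diff[OF F]) (simp add: N_def)
    have S: "(\<Sum>n<M. a n) \<le> ennreal C * I" for M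
    proof (cases "I = \<infinity>")
      case True
      then show ?thesis using C by (simp add: ennreal_mult_top)
    next
      case False
      define i where "i = enn2real I"
      have i: "I = ennreal i" "i \<ge> 0" using False by (auto simp: i_def less_top)
      define s where "s = enn2real (\<Sum>n<M. a n)"
      have "(\<Sum>n<M. a n) < \<infinity>" using annulus_mass_finite[OF F q c] by (simp add: a_def ennreal_sum_less_top less_top[symmetric])
      then have s: "(\<Sum>n<M. a n) = ennreal s" "s \<ge> 0" by (auto simp: s_def)
      have "(\<Sum>n<M. a n) \<le> (\<Sum>n\<in>{..<N} \<union> {N..<M}. a n)" by (intro sum_mono2) auto
      also have "\<dots> = (\<Sum>n<N. a n) + (\<Sum>n\<in>{N..<M}. a n)" by (intro sum.union_disjoint) auto
      also have "(\<Sum>n\<in>{N..<M}. a n) \<le> (\<Sum>n\<in>{N..<M}. ennreal \<theta> * a (n - 1) + ennreal K * b n)"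
        by (intro sum_mono step) simp
      also have "\<dots> = ennreal \<theta> * (\<Sum>n\<in>{N..<M}. a (n - 1)) + ennreal K * (\<Sum>n\<in>{N..<M}. b n)"
        by (simp add: sum.distrib sum_distrib_left)
      also have "(\<Sum>n\<in>{N..<M}. a (n - 1)) \<le> (\<Sum>n<M. a n)"
      proof -
        have "inj_on (\<lambda>n. n - 1) {N..<M}" by (auto simp: inj_on_def N_def)
        then have "(\<Sum>n\<in>{N..<M}. a (n - 1)) = (\<Sum>n\<in>(\<lambda>n. n - 1) ` {N..<M}. a n)"
          by (simp add: sum.reindex)
        also have "\<dots> \<le> (\<Sum>n<M. a n)" by (intro sum_mono2) auto
        finally show ?thesis .
      qed
      finally have "(\<Sum>n<M. a n) \<le> (\<Sum>n<N. a n) + (ennreal \<theta> * (\<Sum>n<M. a n) + ennreal K * (\<Sum>n\<in>{N..<M}. b n))"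
        by (simp add: add_left_mono add_right_mono mult_left_mono)
      also have "\<dots> \<le> ennreal C1 * I + (ennreal \<theta> * (\<Sum>n<M. a n) + ennreal K * (ennreal C2 * I))"
        by (intro add_mono suma sumb mult_left_mono order_refl) auto
      finally have "ennreal s \<le> ennreal (C1 * i + (\<theta> * s + K * (C2 * i)))"
        unfolding s i using C1 \<theta> K C2 i s
        by (simp add: ennreal_mult'[symmetric] ennreal_plus[symmetric] del: ennreal_plus)
      then have "s \<le> C1 * i + (\<theta> * s + K * (C2 * i))"
        using C1 \<theta> K C2 i s by (subst (asm) ennreal_le_iff) auto
      then have "(1 - \<theta>) * s \<le> (C1 + K * C2) * i" by (simp add: algebra_simps)
      then have "s \<le> C * i" using \<theta> by (simp add: C_def field_simps)
      then show ?thesis unfolding s i using C i by (simp add: ennreal_leI flip: ennreal_mult')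
    qed
    have "(\<integral>\<^sup>+z. ennreal (wpowr q c F z) \<partial>lborel) \<le> (\<integral>\<^sup>+z. (\<Sum>n. ennreal (wpowr q c F z) * indicator (annulus n) z) \<partial>lborel)"
    proof (rule nn_integral_mono)
      fix z :: complex
      have "ennreal (wpowr q c F z) = (\<Sum>n\<in>{nat \<lfloor>(norm z)\<^sup>2\<rfloor>}. ennreal (wpowr q c F z) * indicator (annulus n) z)"
        using mem_annulus_floor[of z] by simp
      also have "\<dots> \<le> (\<Sum>n. ennreal (wpowr q c F z) * indicator (annulus n) z)" by (intro sum_le_suminf) auto
      finally show "ennreal (wpowr q c F z) \<le> (\<Sum>n. ennreal (wpowr q c F z) * indicator (annulus n) z)" .
    qed
    also have "\<dots> = (\<Sum>n. a n)" unfolding a_def annulus_mass_def by (rule nn_integral_suminf) measurable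
    also have "\<dots> \<le> ennreal C * I" unfolding suminf_eq_SUP by (intro SUP_least S)
    finally show "(\<integral>\<^sup>+z. ennreal (wpowr q c F z) \<partial>lborel) \<le> ennreal C * (\<integral>\<^sup>+z. ennreal (dpowr q q c (deriv F) z) \<partial>lborel)"
      by (simp add: I_def)
  qed
qed

section \<open>Fock norms and the metric of the Fock space\<close>

lemma epowr_top [simp]: "epowr top a = top"
  by (simp add: epowr_def)

lemma epowr_ennreal: "x \<ge> 0 \<Longrightarrow> epowr (ennreal x) a = ennreal (x powr a)"
  by (simp add: epowr_def)

lemma epowr_cases:
  obtains "x = \<infinity>" | r where "x = ennreal r" "r \<ge> 0"
  using ennreal_cases[of x] by (metis infinity_ennreal_def)

text \<open>Powers with reciprocal exponents form a Galois connection. It turns bounds on norms into bounds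
  on integrals, infinite values included.\<close>
lemma epowr_le_iff:
  assumes a: "a > 0"
  shows "epowr x a \<le> y \<longleftrightarrow> x \<le> epowr y (1 / a)"
proof (cases x rule: epowr_cases)
  case 1
  then show ?thesis by (cases y rule: epowr_cases) (auto simp: epowr_ennreal top_unique)
next
  case x: (2 r)
  show ?thesis
  proof (cases y rule: epowr_cases)
    case y: (2 s)
    have "r powr a \<le> s \<longleftrightarrow> r \<le> s powr (1 / a)"
    proof
      assume "r powr a \<le> s"
      then have "(r powr a) powr (1 / a) \<le> s powr (1 / a)" using a by (intro powr_mono2) auto
      then show "r \<le> s powr (1 / a)" using a x by (simp add: powr_powr)
    next
      assume "r \<le> s powr (1 / a)"
      then have "r powr a \<le> (s powr (1 / a)) powr a" using a x by (intro powr_mono2) auto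
      then show "r powr a \<le> s" using a y by (simp add: powr_powr)
    qed
    then show ?thesis using x y by (simp add: epowr_ennreal)
  qed (use x in simp)
qed

lemma epowr_mono: "a > 0 \<Longrightarrow> x \<le> y \<Longrightarrow> epowr x a \<le> epowr y a"
  using epowr_le_iff[of a x "epowr y a"] epowr_le_iff[of a y "epowr y a"] by auto

lemma epowr_epowr_inverse: "a > 0 \<Longrightarrow> epowr (epowr x a) (1 / a) = x"
  by (cases x rule: epowr_cases) (auto simp: epowr_ennreal powr_powr)

lemma epowr_less_top_iff: "epowr x a < \<infinity> \<longleftrightarrow> x < \<infinity>"
  by (simp add: epowr_def less_top)

lemma epowr_measurable [measurable (raw)]:
  "f \<in> borel_measurable M \<Longrightarrow> (\<lambda>x. epowr (f x) a) \<in> borel_measurable M"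
proof -
  assume [measurable]: "f \<in> borel_measurable M"
  have "(\<lambda>x. epowr (f x) a) = (\<lambda>x. if f x < top then ennreal (enn2real (f x) powr a) else top)"
    by (auto simp: epowr_def less_top)
  then show ?thesis by simp
qed

abbreviation berezin_integral :: "real \<Rightarrow> real \<Rightarrow> real \<Rightarrow> (complex \<Rightarrow> complex) \<Rightarrow> (complex \<Rightarrow> complex) \<Rightarrow> ennreal" where
  "berezin_integral p q \<alpha> \<psi> g \<equiv> (\<integral>\<^sup>+w. epowr (berezin q \<alpha> \<psi> g w) (p / (p - q)) \<partial>lborel)"

text \<open>The \<open>p\<close>-th power of the norm up to its normalising factor, in a form free of roots.\<close>
definition fock_mass :: "real \<Rightarrow> real \<Rightarrow> (complex \<Rightarrow> complex) \<Rightarrow> ennreal" where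
  "fock_mass p \<alpha> f = (\<integral>\<^sup>+z. ennreal (wpowr p (p * \<alpha> / 2) f z) \<partial>lborel)"

lemma fock_norm_le_iff:
  assumes "p > 0"
  shows "fock_norm p \<alpha> f \<le> y \<longleftrightarrow> ennreal (p * \<alpha> / (2 * pi)) * fock_mass p \<alpha> f \<le> epowr y p"
  unfolding fock_norm_def fock_mass_def using epowr_le_iff[of "1 / p"] assms by simp

lemma fock_norm_powr:
  assumes "p > 0"
  shows "epowr (fock_norm p \<alpha> f) p = ennreal (p * \<alpha> / (2 * pi)) * fock_mass p \<alpha> f"
  unfolding fock_norm_def fock_mass_def using epowr_epowr_inverse[of "1 / p"] assms by simp

lemma fock_space_iff_mass:
  assumes "p > 0" "\<alpha> > 0"
  shows "f \<in> fock_space p \<alpha> \<longleftrightarrow> f holomorphic_on UNIV \<and> fock_mass p \<alpha> f < \<infinity>"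
proof -
  have "fock_norm p \<alpha> f < \<infinity> \<longleftrightarrow> ennreal (p * \<alpha> / (2 * pi)) * fock_mass p \<alpha> f < \<infinity>"
    unfolding fock_norm_def fock_mass_def by (rule epowr_less_top_iff)
  also have "\<dots> \<longleftrightarrow> fock_mass p \<alpha> f < \<infinity>"
    using assms by (auto simp: ennreal_mult_less_top)
  finally show ?thesis by (auto simp: fock_space_def)
qed

lemma fock_mass_cmult:
  assumes f: "f holomorphic_on UNIV"
  shows "fock_mass p \<alpha> (\<lambda>z. c * f z) = ennreal (norm c powr p) * fock_mass p \<alpha> f"
proof -
  have [measurable]: "f \<in> borel_measurable borel" using f by measurable
  show ?thesis unfolding fock_mass_def
    by (subst nn_integral_cmult[symmetric]) (auto simp: norm_mult powr_mult mult.assoc ennreal_mult')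
qed

lemma fock_norm_cmult:
  assumes f: "f holomorphic_on UNIV" and p: "p > 0"
  shows "fock_norm p \<alpha> (\<lambda>z. c * f z) = ennreal (norm c) * fock_norm p \<alpha> f"
proof (cases "c = 0")
  case True
  then show ?thesis using p by (simp add: fock_norm_def epowr_def)
next
  case False
  define x where "x = ennreal (p * \<alpha> / (2 * pi)) * fock_mass p \<alpha> f"
  have "fock_norm p \<alpha> (\<lambda>z. c * f z) = epowr (ennreal (norm c powr p) * x) (1 / p)"
    unfolding fock_norm_def fock_mass_def[symmetric] fock_mass_cmult[OF f] x_def by (simp only: mult.left_commute)
  also have "\<dots> = ennreal (norm c) * epowr x (1 / p)"
  proof (cases x rule: epowr_cases)
    case 1
    then show ?thesis using False by (simp add: ennreal_mult_top epowr_def)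
  next
    case (2 r)
    have "epowr (ennreal (norm c powr p) * ennreal r) (1 / p) = epowr (ennreal (norm c powr p * r)) (1 / p)"
      by (simp add: ennreal_mult')
    also have "\<dots> = ennreal ((norm c powr p * r) powr (1 / p))" using 2 by (intro epowr_ennreal) simp
    also have "(norm c powr p * r) powr (1 / p) = norm c * r powr (1 / p)" using p by (simp add: powr_mult powr_powr)
    finally show ?thesis using 2 by (simp add: epowr_ennreal ennreal_mult')
  qed
  finally show ?thesis by (simp add: fock_norm_def fock_mass_def x_def)
qed

lemma powr_add_le_add_powr:
  fixes a b p :: real
  assumes "0 \<le> a" "0 \<le> b" "0 < p" "p \<le> 1"
  shows "(a + b) powr p \<le> a powr p + b powr p"
proof (cases "a + b = 0")
  case False
  then have s: "a + b > 0" using assms by linarith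
  have frac: "x / (a + b) \<le> (x / (a + b)) powr p" if "0 \<le> x" "x \<le> a + b" for x
  proof (cases "x = 0")
    case False
    then have "(x / (a + b)) powr 1 \<le> (x / (a + b)) powr p"
      using that s assms by (intro powr_mono') auto
    then show ?thesis using that False s by simp
  qed simp
  have "1 = a / (a + b) + b / (a + b)" using s by (simp add: add_divide_distrib[symmetric])
  also have "\<dots> \<le> (a / (a + b)) powr p + (b / (a + b)) powr p"
    using assms by (intro add_mono frac) auto
  also have "\<dots> = (a powr p + b powr p) / (a + b) powr p"
    using assms by (simp add: powr_divide add_divide_distrib)
  finally show ?thesis using s by (simp add: field_simps)
qed (use assms in simp)

text \<open>Convexity of \<open>x powr p\<close> at the points \<open>s / a\<close> and \<open>t / b\<close> with the weights \<open>a / (a + b)\<close> and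
  \<open>b / (a + b)\<close>. If \<open>a\<close> and \<open>b\<close> are the norms of two functions, integration gives Minkowski's
  inequality.\<close>
lemma convex_powr_combination:
  fixes s t a b p :: real
  assumes "0 \<le> s" "0 \<le> t" "0 < a" "0 < b" "1 \<le> p"
  shows "(s + t) powr p \<le> (a + b) powr (p - 1) * (a powr (1 - p) * s powr p + b powr (1 - p) * t powr p)"
proof -
  define u where "u = a / (a + b)"
  have u: "0 < u" "u < 1" "1 - u = b / (a + b)" using assms by (auto simp: u_def field_simps)
  have small: "(v * x) powr p \<le> v * x powr p" if "0 < v" "v < 1" "0 \<le> x" for v x
  proof -
    have "v powr p \<le> v powr 1" using that assms by (intro powr_mono') auto
    then show ?thesis using that by (simp add: powr_mult mult_right_mono)
  qed
  have conv: "((1 - u) * y + u * x) powr p \<le> (1 - u) * y powr p + u * x powr p" if xy: "0 \<le> x" "0 \<le> y" for x y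
  proof -
    consider "x = 0" | "y = 0" | "x > 0" "y > 0"
      by (cases "x = 0"; cases "y = 0") (use xy in auto)
    then show ?thesis
    proof cases
      case 1 then show ?thesis using small[of "1 - u" y] u xy by simp
    next
      case 2 then show ?thesis using small[of u x] u xy by simp
    next
      case 3
      then show ?thesis
        using convex_onD[OF powr_convex[OF assms(5)], of u y x] u by simp
    qed
  qed
  have "(1 - u) * (t / b) + u * (s / a) = (s + t) / (a + b)"
  proof -
    have "(1 - u) * (t / b) = t / (a + b)" "u * (s / a) = s / (a + b)"
      unfolding u(3) using assms by (simp_all add: u_def)
    then show ?thesis by (simp add: add_divide_distrib)
  qed
  then have "((s + t) / (a + b)) powr p \<le> (1 - u) * (t / b) powr p + u * (s / a) powr p"
    using conv[of "s / a" "t / b"] assms by simp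
  then have "(s + t) powr p / (a + b) powr p \<le> b / (a + b) * (t powr p / b powr p) + a / (a + b) * (s powr p / a powr p)"
    unfolding u(3) using assms by (simp add: powr_divide u_def)
  then have "(s + t) powr p \<le> (a + b) powr p * (b / (a + b) * (t powr p / b powr p) + a / (a + b) * (s powr p / a powr p))"
    using assms by (simp add: divide_le_eq mult.commute)
  also have "\<dots> = (a + b) powr (p - 1) * (a powr (1 - p) * s powr p + b powr (1 - p) * t powr p)"
    using assms by (simp add: powr_diff divide_inverse algebra_simps)
  finally show ?thesis .
qed

text \<open>Minkowski's inequality. The norms are increased by \<open>e / 2\<close> because the convexity inequality needs
  positive \<open>a\<close> and \<open>b\<close>.\<close>
lemma fock_norm_triangle:
  assumes f: "f holomorphic_on UNIV" and g: "g holomorphic_on UNIV" and p: "1 \<le> p" and \<alpha>: "0 < \<alpha>"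
  shows "fock_norm p \<alpha> (\<lambda>z. f z + g z) \<le> fock_norm p \<alpha> f + fock_norm p \<alpha> g"
proof (rule ennreal_le_epsilon)
  have [measurable]: "f \<in> borel_measurable borel" "g \<in> borel_measurable borel" using f g by measurable
  fix e :: real
  assume fin: "fock_norm p \<alpha> f + fock_norm p \<alpha> g < top" and e: "0 < e"
  define k where "k = p * \<alpha> / (2 * pi)"
  have k: "k > 0" using p \<alpha> by (simp add: k_def)
  define a where "a = enn2real (fock_norm p \<alpha> f) + e / 2"
  define b where "b = enn2real (fock_norm p \<alpha> g) + e / 2"
  have a: "a > 0" and b: "b > 0" using e by (simp_all add: a_def b_def add_nonneg_pos)
  have na: "fock_norm p \<alpha> f \<le> ennreal a" and nb: "fock_norm p \<alpha> g \<le> ennreal b"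
    using fin e by (auto simp: a_def b_def le_ennreal_iff less_top[symmetric] ennreal_plus intro!: add_increasing2)
  have ma: "ennreal k * fock_mass p \<alpha> f \<le> ennreal (a powr p)" and mb: "ennreal k * fock_mass p \<alpha> g \<le> ennreal (b powr p)"
    using na nb p a b by (simp_all add: fock_norm_le_iff k_def epowr_ennreal)
  define P where "P = (a + b) powr (p - 1)"
  have "fock_mass p \<alpha> (\<lambda>z. f z + g z)
     \<le> (\<integral>\<^sup>+z. ennreal (P * a powr (1 - p)) * ennreal (wpowr p (p * \<alpha> / 2) f z)
          + ennreal (P * b powr (1 - p)) * ennreal (wpowr p (p * \<alpha> / 2) g z) \<partial>lborel)"
    unfolding fock_mass_def
  proof (rule nn_integral_mono)
    fix z :: complex
    define w where "w = exp (- (p * \<alpha> / 2) * (norm z)\<^sup>2)"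
    have w: "w \<ge> 0" by (simp add: w_def)
    have "norm (f z + g z) powr p \<le> (norm (f z) + norm (g z)) powr p"
      using p by (intro powr_mono2 norm_triangle_ineq) auto
    also have "\<dots> \<le> P * (a powr (1 - p) * norm (f z) powr p + b powr (1 - p) * norm (g z) powr p)"
      unfolding P_def using a b p by (intro convex_powr_combination) auto
    finally have "norm (f z + g z) powr p * w \<le> P * (a powr (1 - p) * norm (f z) powr p + b powr (1 - p) * norm (g z) powr p) * w"
      using w by (rule mult_right_mono)
    also have "\<dots> = P * a powr (1 - p) * (norm (f z) powr p * w) + P * b powr (1 - p) * (norm (g z) powr p * w)"
      by (simp add: algebra_simps)
    finally have "ennreal (norm (f z + g z) powr p * w) \<le> ennreal (P * a powr (1 - p) * (norm (f z) powr p * w) + P * b powr (1 - p) * (norm (g z) powr p * w))"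
      by (rule ennreal_leI)
    also have "\<dots> = ennreal (P * a powr (1 - p)) * ennreal (norm (f z) powr p * w) + ennreal (P * b powr (1 - p)) * ennreal (norm (g z) powr p * w)"
      using w by (subst ennreal_plus) (simp_all add: P_def ennreal_mult')
    finally show "ennreal (norm (f z + g z) powr p * exp (- (p * \<alpha> / 2) * (norm z)\<^sup>2)) \<le>
       ennreal (P * a powr (1 - p)) * ennreal (wpowr p (p * \<alpha> / 2) f z)
          + ennreal (P * b powr (1 - p)) * ennreal (wpowr p (p * \<alpha> / 2) g z)"
      by (simp add: w_def)
  qed
  also have "\<dots> = ennreal (P * a powr (1 - p)) * fock_mass p \<alpha> f + ennreal (P * b powr (1 - p)) * fock_mass p \<alpha> g"
    unfolding fock_mass_def by (subst nn_integral_add) (simp_all add: nn_integral_cmult)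
  finally have "ennreal k * fock_mass p \<alpha> (\<lambda>z. f z + g z)
     \<le> ennreal k * (ennreal (P * a powr (1 - p)) * fock_mass p \<alpha> f + ennreal (P * b powr (1 - p)) * fock_mass p \<alpha> g)"
    by (rule mult_left_mono) simp
  also have "\<dots> = ennreal (P * a powr (1 - p)) * (ennreal k * fock_mass p \<alpha> f) + ennreal (P * b powr (1 - p)) * (ennreal k * fock_mass p \<alpha> g)"
    by (simp only: distrib_left mult.left_commute)
  also have "\<dots> \<le> ennreal (P * a powr (1 - p)) * ennreal (a powr p) + ennreal (P * b powr (1 - p)) * ennreal (b powr p)"
    by (intro add_mono mult_left_mono ma mb) auto
  also have "\<dots> = ennreal (P * a powr (1 - p) * a powr p + P * b powr (1 - p) * b powr p)"
    by (subst ennreal_plus) (simp_all add: P_def ennreal_mult')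
  also have "P * a powr (1 - p) * a powr p + P * b powr (1 - p) * b powr p = (a + b) powr p"
  proof -
    have "P * a powr (1 - p) * a powr p + P * b powr (1 - p) * b powr p = P * (a powr (1 - p + p) + b powr (1 - p + p))"
      by (simp only: powr_add distrib_left mult.assoc)
    also have "\<dots> = P * (a + b) powr 1" using a b by simp
    also have "\<dots> = (a + b) powr p" by (simp only: P_def flip: powr_add) simp
    finally show ?thesis .
  qed
  finally have "fock_norm p \<alpha> (\<lambda>z. f z + g z) \<le> ennreal (a + b)"
    using p a b epowr_ennreal[of "a + b" p] by (simp add: fock_norm_le_iff k_def del: ennreal_plus)
  also have "a + b = enn2real (fock_norm p \<alpha> f) + enn2real (fock_norm p \<alpha> g) + e" by (simp add: a_def b_def)
  also have "ennreal \<dots> = fock_norm p \<alpha> f + fock_norm p \<alpha> g + ennreal e"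
    using fin e by (simp add: ennreal_plus less_top[symmetric])
  finally show "fock_norm p \<alpha> (\<lambda>z. f z + g z) \<le> fock_norm p \<alpha> f + fock_norm p \<alpha> g + ennreal e" .
qed

lemma fock_mass_triangle:
  assumes f: "f holomorphic_on UNIV" and g: "g holomorphic_on UNIV" and p: "0 < p" "p \<le> 1"
  shows "fock_mass p \<alpha> (\<lambda>z. f z + g z) \<le> fock_mass p \<alpha> f + fock_mass p \<alpha> g"
proof -
  have [measurable]: "f \<in> borel_measurable borel" "g \<in> borel_measurable borel" using f g by measurable
  have "fock_mass p \<alpha> (\<lambda>z. f z + g z) \<le> (\<integral>\<^sup>+z. ennreal (wpowr p (p * \<alpha> / 2) f z)
          + ennreal (wpowr p (p * \<alpha> / 2) g z) \<partial>lborel)"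
    unfolding fock_mass_def
  proof (rule nn_integral_mono)
    fix z :: complex
    have "norm (f z + g z) powr p \<le> (norm (f z) + norm (g z)) powr p"
      using p by (intro powr_mono2 norm_triangle_ineq) auto
    also have "\<dots> \<le> norm (f z) powr p + norm (g z) powr p"
      using p by (intro powr_add_le_add_powr) auto
    finally have "norm (f z + g z) powr p * exp (- (p * \<alpha> / 2) * (norm z)\<^sup>2) \<le> (norm (f z) powr p + norm (g z) powr p) * exp (- (p * \<alpha> / 2) * (norm z)\<^sup>2)"
      by (rule mult_right_mono) simp
    then show "ennreal (norm (f z + g z) powr p * exp (- (p * \<alpha> / 2) * (norm z)\<^sup>2)) \<le>
       ennreal (wpowr p (p * \<alpha> / 2) f z) + ennreal (wpowr p (p * \<alpha> / 2) g z)"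
      by (simp add: distrib_right ennreal_leI flip: ennreal_plus)
  qed
  also have "\<dots> = fock_mass p \<alpha> f + fock_mass p \<alpha> g"
    unfolding fock_mass_def by (rule nn_integral_add) measurable
  finally show ?thesis .
qed

text \<open>Minkowski's inequality for \<open>p \<ge> 1\<close>, and subadditivity of \<open>x powr p\<close> for \<open>p < 1\<close>.\<close>
lemma fock_norm_powr_triangle:
  assumes f: "f holomorphic_on UNIV" and g: "g holomorphic_on UNIV" and p: "0 < p" and \<alpha>: "0 < \<alpha>"
  shows "epowr (fock_norm p \<alpha> (\<lambda>z. f z + g z)) (min 1 p)
     \<le> epowr (fock_norm p \<alpha> f) (min 1 p) + epowr (fock_norm p \<alpha> g) (min 1 p)"
proof (cases "1 \<le> p")
  case True
  have "epowr x 1 = x" for x by (cases x rule: epowr_cases) (auto simp: epowr_ennreal)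
  then show ?thesis using fock_norm_triangle[OF f g True \<alpha>] True by simp
next
  case False
  then show ?thesis
    using mult_left_mono[OF fock_mass_triangle[OF f g p], of "ennreal (p * \<alpha> / (2 * pi))" \<alpha>] p
    by (simp add: fock_norm_powr distrib_left min_def)
qed

lemma fock_norm_eq_0_imp:
  assumes f: "f holomorphic_on UNIV" and p: "0 < p" and \<alpha>: "0 < \<alpha>" and 0: "fock_norm p \<alpha> f = 0"
  shows "f = (\<lambda>z. 0)"
proof
  fix z
  have [measurable]: "f \<in> borel_measurable borel" using f by measurable
  have "ennreal (p * \<alpha> / (2 * pi)) * fock_mass p \<alpha> f = 0"
    using fock_norm_powr[OF p, of \<alpha> f] 0 p by (simp add: epowr_def)
  then have "fock_mass p \<alpha> f = 0" using p \<alpha> by simp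
  then have "AE z in lborel. f z = 0"
    unfolding fock_mass_def by (subst (asm) nn_integral_0_iff_AE) (auto simp: ennreal_eq_0_iff mult_le_0_iff not_le)
  moreover have "closed {z. f z = 0}"
    using holomorphic_on_imp_continuous_on[OF f] by (intro closed_Collect_eq) auto
  ultimately show "f z = 0"
    using mem_closed_if_AE_lebesgue[of "{z. f z = 0}" z] by (auto intro: AE_completion)
qed

lemma fock_space_diff:
  assumes f: "f \<in> fock_space p \<alpha>" and g: "g \<in> fock_space p \<alpha>" and p: "0 < p" and \<alpha>: "0 < \<alpha>"
  shows "(\<lambda>z. f z - g z) \<in> fock_space p \<alpha>"
proof -
  have hol: "f holomorphic_on UNIV" "g holomorphic_on UNIV" using f g by (auto simp: fock_space_def)
  have neg: "(\<lambda>z. - 1 * g z) holomorphic_on UNIV" using hol by (intro holomorphic_intros)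
  have "epowr (fock_norm p \<alpha> (\<lambda>z. f z + - 1 * g z)) (min 1 p)
     \<le> epowr (fock_norm p \<alpha> f) (min 1 p) + epowr (fock_norm p \<alpha> (\<lambda>z. - 1 * g z)) (min 1 p)"
    by (rule fock_norm_powr_triangle[OF hol(1) neg p \<alpha>])
  also have "\<dots> < \<infinity>"
    unfolding fock_norm_cmult[OF hol(2) p] using f g by (auto simp: fock_space_def ennreal_add_less_top epowr_less_top_iff[unfolded infinity_ennreal_def])
  finally have "fock_norm p \<alpha> (\<lambda>z. f z - g z) < \<infinity>" by (simp add: epowr_less_top_iff[unfolded infinity_ennreal_def])
  then show ?thesis using hol by (auto simp: fock_space_def intro!: holomorphic_intros)
qed

lemma fock_dist_eq:
  assumes "(\<lambda>z. f z - g z) \<in> fock_space p \<alpha>" "p > 0"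
  shows "ennreal (fock_dist p \<alpha> f g) = epowr (fock_norm p \<alpha> (\<lambda>z. f z - g z)) (min 1 p)"
proof -
  have "fock_norm p \<alpha> (\<lambda>z. f z - g z) \<noteq> \<infinity>"
    using assms by (auto simp: fock_space_def)
  then show ?thesis by (simp add: fock_dist_def epowr_def)
qed

lemma fock_dist_nonneg [simp]: "0 \<le> fock_dist p \<alpha> f g"
  by (simp add: fock_dist_def)

lemma Metric_space_fock:
  assumes p: "0 < p" and \<alpha>: "0 < \<alpha>"
  shows "Metric_space (fock_space p \<alpha>) (fock_dist p \<alpha>)"
proof
  fix f g h :: "complex \<Rightarrow> complex"
  show "0 \<le> fock_dist p \<alpha> f g" by (simp add: fock_dist_def)
  show "fock_dist p \<alpha> f g = fock_dist p \<alpha> g f"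
    by (simp add: fock_dist_def fock_norm_def norm_minus_commute)
  assume f: "f \<in> fock_space p \<alpha>" and g: "g \<in> fock_space p \<alpha>"
  note fg = fock_space_diff[OF f g p \<alpha>]
  show "fock_dist p \<alpha> f g = 0 \<longleftrightarrow> f = g"
  proof
    assume "fock_dist p \<alpha> f g = 0"
    then have "fock_norm p \<alpha> (\<lambda>z. f z - g z) = 0"
      using fg by (auto simp: fock_dist_def fock_space_def enn2real_eq_0_iff)
    then have "(\<lambda>z. f z - g z) = (\<lambda>z. 0)"
      using fg p \<alpha> by (intro fock_norm_eq_0_imp) (auto simp: fock_space_def)
    then show "f = g" by (metis eq_iff_diff_eq_0 ext)
  next
    assume "f = g"
    then show "fock_dist p \<alpha> f g = 0" using p by (simp add: fock_dist_def fock_norm_def epowr_def)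
  qed
  assume h: "h \<in> fock_space p \<alpha>"
  note gh = fock_space_diff[OF g h p \<alpha>] and fh = fock_space_diff[OF f h p \<alpha>]
  have "epowr (fock_norm p \<alpha> (\<lambda>z. (f z - g z) + (g z - h z))) (min 1 p)
     \<le> epowr (fock_norm p \<alpha> (\<lambda>z. f z - g z)) (min 1 p) + epowr (fock_norm p \<alpha> (\<lambda>z. g z - h z)) (min 1 p)"
    using fg gh by (intro fock_norm_powr_triangle[OF _ _ p \<alpha>]) (auto simp: fock_space_def)
  then have "ennreal (fock_dist p \<alpha> f h) \<le> ennreal (fock_dist p \<alpha> f g) + ennreal (fock_dist p \<alpha> g h)"
    using fg gh fh p by (simp add: fock_dist_eq)
  then show "fock_dist p \<alpha> f h \<le> fock_dist p \<alpha> f g + fock_dist p \<alpha> g h"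
    by (simp flip: ennreal_plus)
qed

section \<open>The Volterra operator\<close>

lemma volterra_comp_has_derivative:
  assumes f: "f holomorphic_on UNIV" and g: "g holomorphic_on UNIV" and \<psi>: "\<psi> holomorphic_on UNIV"
  shows "(volterra_comp g \<psi> f has_field_derivative f (\<psi> z) * deriv g z) (at z)"
proof -
  have hol: "(\<lambda>w. f (\<psi> w) * deriv g w) holomorphic_on UNIV"
    using entire_compose[OF f \<psi>] holomorphic_deriv[OF g] by (intro holomorphic_on_mult) auto
  obtain P where P: "\<And>z. (P has_field_derivative f (\<psi> z) * deriv g z) (at z)"
    using holomorphic_convex_primitive'[OF convex_UNIV open_UNIV hol] by auto
  have "volterra_comp g \<psi> f = (\<lambda>z. P z - P 0)"
  proof
    fix z
    have "((\<lambda>w. f (\<psi> w) * deriv g w) has_contour_integral (P (pathfinish (linepath 0 z)) - P (pathstart (linepath 0 z)))) (linepath 0 z)"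
      by (rule contour_integral_primitive[OF has_field_derivative_at_within[OF P] valid_path_linepath subset_UNIV])
    then show "volterra_comp g \<psi> f z = P z - P 0"
      unfolding volterra_comp_def by (simp add: contour_integral_unique)
  qed
  then show ?thesis using P by (auto intro!: derivative_eq_intros)
qed

lemma volterra_comp_0: "volterra_comp g \<psi> f 0 = 0"
  by (simp add: volterra_comp_def)

lemma volterra_comp_holomorphic:
  assumes "f holomorphic_on UNIV" "g holomorphic_on UNIV" "\<psi> holomorphic_on UNIV"
  shows "volterra_comp g \<psi> f holomorphic_on UNIV"
  using volterra_comp_has_derivative[OF assms] holomorphic_on_open[of UNIV] by auto

lemma deriv_volterra_comp:
  assumes "f holomorphic_on UNIV" "g holomorphic_on UNIV" "\<psi> holomorphic_on UNIV"
  shows "deriv (volterra_comp g \<psi> f) z = f (\<psi> z) * deriv g z"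
  using volterra_comp_has_derivative[OF assms] by (rule DERIV_imp_deriv)

lemma volterra_comp_contour_integrable:
  assumes "f holomorphic_on UNIV" "g holomorphic_on UNIV" "\<psi> holomorphic_on UNIV"
  shows "(\<lambda>w. f (\<psi> w) * deriv g w) contour_integrable_on linepath a b"
proof -
  have "(\<lambda>w. f (\<psi> w) * deriv g w) holomorphic_on UNIV"
    using entire_compose[OF assms(1,3)] holomorphic_deriv[OF assms(2)] by (intro holomorphic_on_mult) auto
  then show ?thesis
    by (intro contour_integrable_continuous_linepath continuous_on_subset[OF holomorphic_on_imp_continuous_on]) auto
qed

lemma volterra_comp_diff:
  assumes f: "f holomorphic_on UNIV" and h: "h holomorphic_on UNIV" and gp: "g holomorphic_on UNIV" "\<psi> holomorphic_on UNIV"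
  shows "volterra_comp g \<psi> (\<lambda>z. f z - h z) = (\<lambda>z. volterra_comp g \<psi> f z - volterra_comp g \<psi> h z)"
  using contour_integral_diff[OF volterra_comp_contour_integrable[OF f gp] volterra_comp_contour_integrable[OF h gp]]
  unfolding volterra_comp_def left_diff_distrib by (intro ext)

lemma volterra_comp_cmult:
  assumes f: "f holomorphic_on UNIV" and gp: "g holomorphic_on UNIV" "\<psi> holomorphic_on UNIV"
  shows "volterra_comp g \<psi> (\<lambda>z. c * f z) = (\<lambda>z. c * volterra_comp g \<psi> f z)"
  using contour_integral_lmul[OF volterra_comp_contour_integrable[OF f gp], of _ _ c]
  unfolding volterra_comp_def mult.assoc by (intro ext)

section \<open>The operator as an embedding, and the Berezin transform as a convolution\<close>

text \<open>The weight for which \<open>norm (F' z) powr q / (1 + norm z) powr q * exp (- (q * \<alpha> / 2) * (norm z)\<^sup>2)\<close> with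
  \<open>F = volterra_comp g \<psi> f\<close> becomes the Fock integrand of \<open>f\<close> at \<open>\<psi> z\<close> times a factor that does not
  involve \<open>f\<close>.\<close>
definition carleson_density :: "real \<Rightarrow> real \<Rightarrow> (complex \<Rightarrow> complex) \<Rightarrow> (complex \<Rightarrow> complex) \<Rightarrow> complex \<Rightarrow> real" where
  "carleson_density q \<alpha> \<psi> g z =
     norm (deriv g z) powr q / (1 + norm z) powr q * exp (q * \<alpha> / 2 * ((norm (\<psi> z))\<^sup>2 - (norm z)\<^sup>2))"

text \<open>The \<open>q\<close>-th power of the norm of \<open>f\<close> against the image under \<open>\<psi>\<close> of \<open>carleson_density\<close>. Boundedness of
  the operator means that the Fock space embeds into this weighted space.\<close>
definition embedding_mass :: "real \<Rightarrow> real \<Rightarrow> (complex \<Rightarrow> complex) \<Rightarrow> (complex \<Rightarrow> complex) \<Rightarrow> (complex \<Rightarrow> complex) \<Rightarrow> ennreal" where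
  "embedding_mass q \<alpha> \<psi> g f =
     (\<integral>\<^sup>+z. ennreal (carleson_density q \<alpha> \<psi> g z) *
        ennreal (wpowr q (q * \<alpha> / 2) f (\<psi> z)) \<partial>lborel)"

lemma carleson_density_nonneg [simp]: "0 \<le> carleson_density q \<alpha> \<psi> g z"
  by (simp add: carleson_density_def)

lemma carleson_density_measurable:
  assumes "g holomorphic_on UNIV" "\<psi> holomorphic_on UNIV"
  shows "carleson_density q \<alpha> \<psi> g \<in> borel_measurable borel"
proof -
  have [measurable]: "\<psi> \<in> borel_measurable borel" "deriv g \<in> borel_measurable borel"
    using assms holomorphic_deriv[OF assms(1)] by (auto intro: entire_measurable)
  show ?thesis unfolding carleson_density_def by measurable
qed

lemma norm_diff_sq_complex: "(norm (a - b))\<^sup>2 = (norm a)\<^sup>2 + (norm b)\<^sup>2 - 2 * Re (a * cnj b)"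
  unfolding cmod_power2 by (simp add: power2_eq_square algebra_simps)

text \<open>Completing the square in the exponent.\<close>
lemma berezin_eq_gaussian:
  "berezin q \<alpha> \<psi> g w = (\<integral>\<^sup>+z. ennreal (carleson_density q \<alpha> \<psi> g z) * ennreal (exp (- (q * \<alpha> / 2) * (dist (\<psi> z) w)\<^sup>2)) \<partial>lborel)"
  unfolding berezin_def
proof (intro nn_integral_cong)
  fix z
  have "q * \<alpha> / 2 * (2 * Re (\<psi> z * cnj w) - (norm z)\<^sup>2 - (norm w)\<^sup>2)
      = q * \<alpha> / 2 * ((norm (\<psi> z))\<^sup>2 - (norm z)\<^sup>2) + - (q * \<alpha> / 2) * (dist (\<psi> z) w)\<^sup>2"
    unfolding dist_norm norm_diff_sq_complex by (simp add: algebra_simps)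
  then have "exp (q * \<alpha> / 2 * (2 * Re (\<psi> z * cnj w) - (norm z)\<^sup>2 - (norm w)\<^sup>2)) * (norm (deriv g z) powr q / (1 + norm z) powr q)
     = carleson_density q \<alpha> \<psi> g z * exp (- (q * \<alpha> / 2) * (dist (\<psi> z) w)\<^sup>2)"
    by (simp only: exp_add carleson_density_def mult_ac)
  then show "ennreal (exp (q * \<alpha> / 2 * (2 * Re (\<psi> z * cnj w) - (norm z)\<^sup>2 - (norm w)\<^sup>2)) * (norm (deriv g z) powr q / (1 + norm z) powr q))
     = ennreal (carleson_density q \<alpha> \<psi> g z) * ennreal (exp (- (q * \<alpha> / 2) * (dist (\<psi> z) w)\<^sup>2))"
    by (simp add: ennreal_mult')
qed

lemma berezin_measurable:
  assumes "g holomorphic_on UNIV" "\<psi> holomorphic_on UNIV"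
  shows "berezin q \<alpha> \<psi> g \<in> borel_measurable borel"
proof -
  have [measurable]: "\<psi> \<in> borel_measurable borel" "carleson_density q \<alpha> \<psi> g \<in> borel_measurable borel"
    using assms carleson_density_measurable[OF assms] by (auto intro: entire_measurable)
  show ?thesis unfolding berezin_eq_gaussian by measurable
qed

text \<open>The Littlewood--Paley description of the Fock norm, applied to \<open>volterra_comp g \<psi> f\<close>.\<close>
lemma volterra_mass_equiv_embedding_mass:
  fixes q \<alpha> :: real
  assumes q: "0 < q" and \<alpha>: "0 < \<alpha>"
  obtains C :: real where "C > 0" and
    "\<And>f g \<psi>. \<lbrakk>f holomorphic_on UNIV; g holomorphic_on UNIV; \<psi> holomorphic_on UNIV\<rbrakk> \<Longrightarrow>
       fock_mass q \<alpha> (volterra_comp g \<psi> f) \<le> ennreal C * embedding_mass q \<alpha> \<psi> g f"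
    "\<And>f g \<psi>. \<lbrakk>f holomorphic_on UNIV; g holomorphic_on UNIV; \<psi> holomorphic_on UNIV\<rbrakk> \<Longrightarrow>
       embedding_mass q \<alpha> \<psi> g f \<le> ennreal C * fock_mass q \<alpha> (volterra_comp g \<psi> f)"
proof -
  define c where "c = q * \<alpha> / 2"
  have c: "c > 0" using q \<alpha> by (simp add: c_def)
  obtain C1 :: real where C1: "C1 > 0" and up: "\<And>F. F holomorphic_on UNIV \<Longrightarrow>
       (\<integral>\<^sup>+z. ennreal (dpowr q q c (deriv F) z) \<partial>lborel)
         \<le> ennreal C1 * (\<integral>\<^sup>+z. ennreal (wpowr q c F z) \<partial>lborel)"
    using fock_derivative_upper_bound[OF q less_imp_le[OF c]] by blast
  obtain C2 :: real where C2: "C2 > 0" and lo: "\<And>F. F holomorphic_on UNIV \<Longrightarrow> F 0 = 0 \<Longrightarrow>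
       (\<integral>\<^sup>+z. ennreal (wpowr q c F z) \<partial>lborel)
         \<le> ennreal C2 * (\<integral>\<^sup>+z. ennreal (dpowr q q c (deriv F) z) \<partial>lborel)"
    using fock_derivative_lower_bound[OF q c] by blast
  have eq: "(\<integral>\<^sup>+z. ennreal (norm (deriv (volterra_comp g \<psi> f) z) powr q * (1 + norm z) powr (- q) * exp (- c * (norm z)\<^sup>2)) \<partial>lborel)
      = embedding_mass q \<alpha> \<psi> g f"
    if "f holomorphic_on UNIV" "g holomorphic_on UNIV" "\<psi> holomorphic_on UNIV" for f g \<psi>
    unfolding embedding_mass_def
  proof (intro nn_integral_cong)
    fix z
    have "- c * (norm z)\<^sup>2 = c * ((norm (\<psi> z))\<^sup>2 - (norm z)\<^sup>2) + - c * (norm (\<psi> z))\<^sup>2" by (simp add: algebra_simps)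
    then have e: "exp (- c * (norm z)\<^sup>2) = exp (c * ((norm (\<psi> z))\<^sup>2 - (norm z)\<^sup>2)) * exp (- c * (norm (\<psi> z))\<^sup>2)"
      by (simp only: exp_add)
    have "norm (deriv (volterra_comp g \<psi> f) z) powr q * (1 + norm z) powr (- q) * exp (- c * (norm z)\<^sup>2)
      = carleson_density q \<alpha> \<psi> g z * (wpowr q (q * \<alpha> / 2) f (\<psi> z))"
      unfolding deriv_volterra_comp[OF that] e carleson_density_def c_def[symmetric]
      by (simp add: norm_mult powr_mult powr_minus divide_inverse)
    then show "ennreal (norm (deriv (volterra_comp g \<psi> f) z) powr q * (1 + norm z) powr (- q) * exp (- c * (norm z)\<^sup>2))
      = ennreal (carleson_density q \<alpha> \<psi> g z) * ennreal (wpowr q (q * \<alpha> / 2) f (\<psi> z))"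
      by (simp add: ennreal_mult')
  qed
  show thesis
  proof (rule that[of "max C1 C2"])
    show "max C1 C2 > 0" using C1 by simp
    fix f g \<psi> :: "complex \<Rightarrow> complex"
    assume h: "f holomorphic_on UNIV" "g holomorphic_on UNIV" "\<psi> holomorphic_on UNIV"
    have "fock_mass q \<alpha> (volterra_comp g \<psi> f) \<le> ennreal C2 * embedding_mass q \<alpha> \<psi> g f"
      using lo[OF volterra_comp_holomorphic[OF h] volterra_comp_0] unfolding eq[OF h] by (simp add: fock_mass_def c_def)
    also have "\<dots> \<le> ennreal (max C1 C2) * embedding_mass q \<alpha> \<psi> g f" by (intro mult_right_mono ennreal_leI) auto
    finally show "fock_mass q \<alpha> (volterra_comp g \<psi> f) \<le> ennreal (max C1 C2) * embedding_mass q \<alpha> \<psi> g f" .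
    have "embedding_mass q \<alpha> \<psi> g f \<le> ennreal C1 * fock_mass q \<alpha> (volterra_comp g \<psi> f)"
      using up[OF volterra_comp_holomorphic[OF h]] unfolding eq[OF h] by (simp add: fock_mass_def c_def)
    also have "\<dots> \<le> ennreal (max C1 C2) * fock_mass q \<alpha> (volterra_comp g \<psi> f)" by (intro mult_right_mono ennreal_leI) auto
    finally show "embedding_mass q \<alpha> \<psi> g f \<le> ennreal (max C1 C2) * fock_mass q \<alpha> (volterra_comp g \<psi> f)" .
  qed
qed

text \<open>The modulus of \<open>f w * exp (- \<alpha> * w * cnj \<zeta>)\<close> carries, up to a factor depending on \<open>\<zeta>\<close> alone, the weight
  \<open>exp (- (\<alpha> / 2) * (norm w)\<^sup>2)\<close> times \<open>exp ((\<alpha> / 2) * (dist \<zeta> w)\<^sup>2)\<close>. The last factor is bounded on the unit disc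
  around \<open>\<zeta>\<close>, and so the sub-mean value property there gives the estimate, with the Gaussian of the
  Berezin transform inserted.\<close>
lemma fock_pointwise_gaussian_bound:
  fixes q \<alpha> :: real
  assumes q: "0 < q" and \<alpha>: "0 < \<alpha>"
  obtains C :: real where "C > 0" and
    "\<And>f \<zeta>. f holomorphic_on UNIV \<Longrightarrow>
       ennreal (wpowr q (q * \<alpha> / 2) f \<zeta>) \<le> ennreal C *
         (\<integral>\<^sup>+w. ennreal (wpowr q (q * \<alpha> / 2) f w) * ennreal (exp (- (q * \<alpha> / 2) * (dist \<zeta> w)\<^sup>2)) \<partial>lborel)"
proof -
  define c where "c = q * \<alpha> / 2"
  have c: "c > 0" using q \<alpha> by (simp add: c_def)
  obtain C1 :: real where C1: "C1 > 0" and sub: "\<And>H a r. H holomorphic_on UNIV \<Longrightarrow> r > 0 \<Longrightarrow>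
       ennreal (norm (H a) powr q) \<le> ennreal (C1 / r\<^sup>2) *
         (\<integral>\<^sup>+w. ennreal (norm (H w) powr q) * indicator (ball a r) w \<partial>lborel)"
    using entire_powr_sub_mean_value[OF q] by blast
  show thesis
  proof (rule that[of "C1 * exp (2 * c)"])
    show "C1 * exp (2 * c) > 0" using C1 by simp
    fix f :: "complex \<Rightarrow> complex" and \<zeta>
    assume f: "f holomorphic_on UNIV"
    have [measurable]: "f \<in> borel_measurable borel" using f by measurable
    define G where "G w = f w * exp (- of_real \<alpha> * w * cnj \<zeta>)" for w
    have G: "G holomorphic_on UNIV" unfolding G_def using f by (intro holomorphic_intros) auto
    have [measurable]: "G \<in> borel_measurable borel" using G by measurable
    have nG: "norm (G w) powr q = norm (f w) powr q * exp (- (2 * c) * Re (w * cnj \<zeta>))" for w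
    proof -
      have "norm (G w) powr q = norm (f w) powr q * exp (- \<alpha> * Re (w * cnj \<zeta>)) powr q"
        by (simp add: G_def norm_mult powr_mult mult.assoc)
      also have "exp (- \<alpha> * Re (w * cnj \<zeta>)) powr q = exp (- (2 * c) * Re (w * cnj \<zeta>))"
        by (simp add: exp_powr_real c_def mult_ac)
      finally show ?thesis .
    qed
    define X where "X w = wpowr q c f w * exp (- c * (dist \<zeta> w)\<^sup>2)" for w
    have X0: "X w \<ge> 0" for w by (simp add: X_def)
    have key: "exp (- c * (norm \<zeta>)\<^sup>2) * (norm (G w) powr q * exp (2 * c * (norm \<zeta>)\<^sup>2)) = X w * exp (2 * c * (dist \<zeta> w)\<^sup>2)" for w
    proof -
      have "dist \<zeta> w = norm (w - \<zeta>)" by (simp add: dist_norm norm_minus_commute)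
      then have d: "(dist \<zeta> w)\<^sup>2 = (norm w)\<^sup>2 + (norm \<zeta>)\<^sup>2 - 2 * Re (w * cnj \<zeta>)" by (simp only: norm_diff_sq_complex)
      have "X w * exp (2 * c * (dist \<zeta> w)\<^sup>2) = norm (f w) powr q * exp (- c * (norm w)\<^sup>2 + - c * (dist \<zeta> w)\<^sup>2 + 2 * c * (dist \<zeta> w)\<^sup>2)"
        by (simp only: X_def exp_add mult_ac)
      also have "- c * (norm w)\<^sup>2 + - c * (dist \<zeta> w)\<^sup>2 + 2 * c * (dist \<zeta> w)\<^sup>2 = - c * (norm \<zeta>)\<^sup>2 + - (2 * c) * Re (w * cnj \<zeta>) + 2 * c * (norm \<zeta>)\<^sup>2"
        unfolding d by (simp add: algebra_simps)
      finally show ?thesis unfolding nG by (simp only: exp_add mult_ac)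
    qed
    have "ennreal (wpowr q c f \<zeta>) = ennreal (exp (c * (norm \<zeta>)\<^sup>2)) * ennreal (norm (G \<zeta>) powr q)"
    proof -
      have "Re (\<zeta> * cnj \<zeta>) = (norm \<zeta>)\<^sup>2"
        unfolding cmod_power2 by (simp add: power2_eq_square)
      then have "exp (c * (norm \<zeta>)\<^sup>2) * norm (G \<zeta>) powr q = norm (f \<zeta>) powr q * exp (c * (norm \<zeta>)\<^sup>2 + - (2 * c) * (norm \<zeta>)\<^sup>2)"
        unfolding nG by (simp only: exp_add mult_ac)
      also have "c * (norm \<zeta>)\<^sup>2 + - (2 * c) * (norm \<zeta>)\<^sup>2 = - c * (norm \<zeta>)\<^sup>2" by (simp add: algebra_simps)
      finally show ?thesis by (simp flip: ennreal_mult')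
    qed
    also have "\<dots> \<le> ennreal (exp (c * (norm \<zeta>)\<^sup>2)) * (ennreal (C1 / 1\<^sup>2) * (\<integral>\<^sup>+w. ennreal (norm (G w) powr q) * indicator (ball \<zeta> 1) w \<partial>lborel))"
      by (intro mult_left_mono sub[OF G]) auto
    also have "\<dots> = ennreal C1 * (ennreal (exp (c * (norm \<zeta>)\<^sup>2)) * (\<integral>\<^sup>+w. ennreal (norm (G w) powr q) * indicator (ball \<zeta> 1) w \<partial>lborel))"
      by (simp add: mult.left_commute)
    also have "ennreal (exp (c * (norm \<zeta>)\<^sup>2)) * (\<integral>\<^sup>+w. ennreal (norm (G w) powr q) * indicator (ball \<zeta> 1) w \<partial>lborel)
       = (\<integral>\<^sup>+w. ennreal (exp (c * (norm \<zeta>)\<^sup>2)) * (ennreal (norm (G w) powr q) * indicator (ball \<zeta> 1) w) \<partial>lborel)"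
      by (intro nn_integral_cmult[symmetric]) measurable
    also have "\<dots> \<le> (\<integral>\<^sup>+w. ennreal (exp (2 * c)) * ennreal (X w) \<partial>lborel)"
    proof (rule nn_integral_mono)
      fix w
      show "ennreal (exp (c * (norm \<zeta>)\<^sup>2)) * (ennreal (norm (G w) powr q) * indicator (ball \<zeta> 1) w) \<le> ennreal (exp (2 * c)) * ennreal (X w)"
      proof (cases "w \<in> ball \<zeta> 1")
        case True
        then have "(dist \<zeta> w)\<^sup>2 \<le> 1\<^sup>2" by (intro power_mono) auto
        then have "exp (2 * c * (dist \<zeta> w)\<^sup>2) \<le> exp (2 * c)" using c by simp
        moreover have "exp (c * (norm \<zeta>)\<^sup>2) = exp (- c * (norm \<zeta>)\<^sup>2) * exp (2 * c * (norm \<zeta>)\<^sup>2)"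
          by (simp flip: exp_add)
        ultimately have "exp (c * (norm \<zeta>)\<^sup>2) * norm (G w) powr q \<le> exp (2 * c) * X w"
          using key[of w] mult_left_mono[of "exp (2 * c * (dist \<zeta> w)\<^sup>2)" "exp (2 * c)" "X w"] X0[of w] by (simp add: mult_ac)
        then show ?thesis using True X0[of w] by (simp add: ennreal_leI flip: ennreal_mult')
      qed simp
    qed
    also have "\<dots> = ennreal (exp (2 * c)) * (\<integral>\<^sup>+w. ennreal (X w) \<partial>lborel)"
      unfolding X_def by (rule nn_integral_cmult) measurable
    finally have "ennreal (wpowr q c f \<zeta>) \<le> ennreal C1 * (ennreal (exp (2 * c)) * (\<integral>\<^sup>+w. ennreal (X w) \<partial>lborel))"
      by (simp add: mult_left_mono)
    also have "\<dots> = ennreal (C1 * exp (2 * c)) * (\<integral>\<^sup>+w. ennreal (X w) \<partial>lborel)"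
      using C1 by (simp add: ennreal_mult' mult.assoc)
    finally show "ennreal (wpowr q (q * \<alpha> / 2) f \<zeta>) \<le> ennreal (C1 * exp (2 * c)) *
         (\<integral>\<^sup>+w. ennreal (wpowr q (q * \<alpha> / 2) f w) * ennreal (exp (- (q * \<alpha> / 2) * (dist \<zeta> w)\<^sup>2)) \<partial>lborel)"
      unfolding c_def[symmetric] by (simp add: X_def ennreal_mult')
  qed
qed

text \<open>Integrate the pointwise bound against the image measure and exchange the integrals.\<close>
lemma embedding_mass_le_berezin:
  fixes q \<alpha> :: real
  assumes q: "0 < q" and \<alpha>: "0 < \<alpha>"
  obtains C :: real where "C > 0" and
    "\<And>f g \<psi>. \<lbrakk>f holomorphic_on UNIV; g holomorphic_on UNIV; \<psi> holomorphic_on UNIV\<rbrakk> \<Longrightarrow>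
       embedding_mass q \<alpha> \<psi> g f \<le> ennreal C *
         (\<integral>\<^sup>+w. ennreal (wpowr q (q * \<alpha> / 2) f w) * berezin q \<alpha> \<psi> g w \<partial>lborel)"
proof -
  define c where "c = q * \<alpha> / 2"
  obtain C :: real where C: "C > 0" and pt: "\<And>f \<zeta>. f holomorphic_on UNIV \<Longrightarrow>
       ennreal (wpowr q c f \<zeta>) \<le> ennreal C *
         (\<integral>\<^sup>+w. ennreal (wpowr q c f w) * ennreal (exp (- c * (dist \<zeta> w)\<^sup>2)) \<partial>lborel)"
    using fock_pointwise_gaussian_bound[OF q \<alpha>] unfolding c_def by blast
  show thesis
  proof (rule that[OF C])
    fix f g \<psi> :: "complex \<Rightarrow> complex"
    assume h: "f holomorphic_on UNIV" "g holomorphic_on UNIV" "\<psi> holomorphic_on UNIV"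
    define D where "D z = ennreal (carleson_density q \<alpha> \<psi> g z)" for z
    define E where "E w = ennreal (wpowr q c f w)" for w
    have [measurable]: "D \<in> borel_measurable borel" "\<psi> \<in> borel_measurable borel" "f \<in> borel_measurable borel"
      using carleson_density_measurable[OF h(2,3)] h by (auto simp: D_def[abs_def] intro: entire_measurable)
    have [measurable]: "E \<in> borel_measurable borel" unfolding E_def by measurable
    have "embedding_mass q \<alpha> \<psi> g f \<le> (\<integral>\<^sup>+z. D z * (ennreal C * (\<integral>\<^sup>+w. E w * ennreal (exp (- c * (dist (\<psi> z) w)\<^sup>2)) \<partial>lborel)) \<partial>lborel)"
      unfolding embedding_mass_def D_def E_def c_def[symmetric] by (intro nn_integral_mono mult_left_mono pt h) auto
    also have "\<dots> = ennreal C * (\<integral>\<^sup>+z. (\<integral>\<^sup>+w. E w * (D z * ennreal (exp (- c * (dist (\<psi> z) w)\<^sup>2))) \<partial>lborel) \<partial>lborel)"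
      by (simp add: nn_integral_cmult[symmetric] mult_ac)
    also have "(\<integral>\<^sup>+z. (\<integral>\<^sup>+w. E w * (D z * ennreal (exp (- c * (dist (\<psi> z) w)\<^sup>2))) \<partial>lborel) \<partial>lborel)
       = (\<integral>\<^sup>+w. (\<integral>\<^sup>+z. E w * (D z * ennreal (exp (- c * (dist (\<psi> z) w)\<^sup>2))) \<partial>lborel) \<partial>lborel)"
      by (rule lborel_pair.Fubini'[symmetric]) measurable
    also have "\<dots> = (\<integral>\<^sup>+w. E w * berezin q \<alpha> \<psi> g w \<partial>lborel)"
      unfolding berezin_eq_gaussian D_def[symmetric] c_def[symmetric] by (intro nn_integral_cong nn_integral_cmult) measurable
    finally show "embedding_mass q \<alpha> \<psi> g f \<le> ennreal C *
         (\<integral>\<^sup>+w. ennreal (wpowr q (q * \<alpha> / 2) f w) * berezin q \<alpha> \<psi> g w \<partial>lborel)"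
      by (simp add: E_def c_def)
  qed
qed

text \<open>A substitute for Young's inequality with the exponents \<open>p / q\<close> and \<open>p / (p - q)\<close>: the first summand
  dominates if \<open>B \<le> \<theta> * X powr (p - q)\<close>, the second one otherwise. The optimal \<open>\<theta>\<close> yields Hoelder's
  inequality, and a small \<open>\<theta>\<close> yields compactness.\<close>
lemma powr_mult_le_split:
  fixes X \<theta> p q :: real and B :: ennreal
  assumes q: "0 < q" and qp: "q < p" and X: "0 \<le> X" and \<theta>: "0 < \<theta>"
  shows "ennreal (X powr q) * B \<le> ennreal (\<theta> * X powr p) + ennreal (\<theta> powr (- (q / (p - q)))) * epowr B (p / (p - q))"
proof (cases B rule: epowr_cases)
  case 1
  then show ?thesis using \<theta> by (simp add: ennreal_mult_top)
next
  case (2 b)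
  have "X powr q * b \<le> \<theta> * X powr p + \<theta> powr (- (q / (p - q))) * b powr (p / (p - q))"
  proof (cases "b \<le> \<theta> * X powr (p - q)")
    case True
    then have "X powr q * b \<le> X powr q * (\<theta> * X powr (p - q))" by (rule mult_left_mono) simp
    also have "\<dots> = \<theta> * X powr p" by (simp add: mult.left_commute flip: powr_add)
    finally show ?thesis by (simp add: add_increasing2)
  next
    case False
    have b: "b > 0" using False 2 \<theta> by (metis less_eq_real_def mult_nonneg_nonneg powr_ge_zero)
    have "X powr (p - q) \<le> b / \<theta>" using False \<theta> by (simp add: field_simps)
    then have "(X powr (p - q)) powr (q / (p - q)) \<le> (b / \<theta>) powr (q / (p - q))"
      using q qp by (intro powr_mono2) auto
    then have "X powr q \<le> (b / \<theta>) powr (q / (p - q))" using qp by (simp add: powr_powr)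
    then have "X powr q * b \<le> (b / \<theta>) powr (q / (p - q)) * b powr 1" using b by (simp add: mult_right_mono)
    also have "\<dots> = \<theta> powr (- (q / (p - q))) * b powr (q / (p - q) + 1)"
      using b \<theta> by (simp add: powr_divide powr_minus powr_add field_simps)
    also have "q / (p - q) + 1 = p / (p - q)" using qp by (simp add: field_simps)
    finally show ?thesis using \<theta> by (simp add: add_increasing)
  qed
  then have "ennreal (X powr q * b) \<le> ennreal (\<theta> * X powr p + \<theta> powr (- (q / (p - q))) * b powr (p / (p - q)))"
    by (rule ennreal_leI)
  also have "\<dots> = ennreal (\<theta> * X powr p) + ennreal (\<theta> powr (- (q / (p - q)))) * ennreal (b powr (p / (p - q)))"
    using \<theta> by (subst ennreal_plus) (simp_all add: ennreal_mult')
  finally show ?thesis using 2 by (simp add: epowr_ennreal ennreal_mult')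
qed

section \<open>From the Berezin transform to boundedness and compactness\<close>

lemma fock_space_holomorphic: "f \<in> fock_space p \<alpha> \<Longrightarrow> f holomorphic_on UNIV"
  by (simp add: fock_space_def)

lemma volterra_comp_bound_from_unit_ball:
  assumes p: "0 < p" and q: "0 < q" and \<alpha>: "0 < \<alpha>"
    and g: "g holomorphic_on UNIV" and \<psi>: "\<psi> holomorphic_on UNIV"
    and ball: "\<And>f. f \<in> fock_space p \<alpha> \<Longrightarrow> fock_norm p \<alpha> f \<le> 1 \<Longrightarrow> fock_norm q \<alpha> (volterra_comp g \<psi> f) \<le> M"
    and f: "f \<in> fock_space p \<alpha>"
  shows "fock_norm q \<alpha> (volterra_comp g \<psi> f) \<le> M * fock_norm p \<alpha> f"
proof -
  note hf = fock_space_holomorphic[OF f]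
  define N where "N = enn2real (fock_norm p \<alpha> f)"
  have N: "fock_norm p \<alpha> f = ennreal N" "N \<ge> 0" using f by (auto simp: N_def fock_space_def)
  show ?thesis
  proof (cases "N = 0")
    case True
    then have "f = (\<lambda>z. 0)" using N by (intro fock_norm_eq_0_imp[OF hf p \<alpha>]) simp
    then have "volterra_comp g \<psi> f = (\<lambda>z. 0)" by (auto simp: volterra_comp_def)
    then show ?thesis using q by (simp add: fock_norm_def epowr_def)
  next
    case False
    then have N0: "N > 0" using N by simp
    define u where "u z = of_real (1 / N) * f z" for z
    have hu: "u holomorphic_on UNIV" unfolding u_def using hf by (intro holomorphic_intros)
    have nu: "fock_norm p \<alpha> u = ennreal (1 / N) * ennreal N"
      using fock_norm_cmult[OF hf p, of \<alpha> "of_real (1 / N)"] N N0 by (simp add: u_def[abs_def] norm_divide)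
    then have nu1: "fock_norm p \<alpha> u = 1" using N0 by (simp flip: ennreal_mult')
    then have "u \<in> fock_space p \<alpha>" using hu by (simp add: fock_space_def)
    from ball[OF this] have le: "fock_norm q \<alpha> (volterra_comp g \<psi> u) \<le> M" by (simp add: nu1)
    have "volterra_comp g \<psi> f = (\<lambda>z. of_real N * volterra_comp g \<psi> u z)"
      unfolding u_def[abs_def] volterra_comp_cmult[OF hf g \<psi>] using N0 by simp
    then have "fock_norm q \<alpha> (volterra_comp g \<psi> f) = ennreal N * fock_norm q \<alpha> (volterra_comp g \<psi> u)"
      using fock_norm_cmult[OF volterra_comp_holomorphic[OF hu g \<psi>] q, of \<alpha> "of_real N"] N0 by simp
    also have "\<dots> \<le> ennreal N * M" by (intro mult_left_mono le) simp
    finally show ?thesis unfolding N(1) by (simp add: mult.commute)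
  qed
qed

lemma fock_mass_unit_ball:
  assumes "0 < p" "0 < \<alpha>" "fock_norm p \<alpha> f \<le> 1"
  shows "fock_mass p \<alpha> f \<le> ennreal (2 * pi / (p * \<alpha>))"
proof -
  have "ennreal (p * \<alpha> / (2 * pi)) * fock_mass p \<alpha> f \<le> 1"
    using assms fock_norm_le_iff[of p \<alpha> f 1] epowr_ennreal[of 1 p] by simp
  then have "ennreal (2 * pi / (p * \<alpha>)) * (ennreal (p * \<alpha> / (2 * pi)) * fock_mass p \<alpha> f) \<le> ennreal (2 * pi / (p * \<alpha>)) * 1"
    by (rule mult_left_mono) simp
  also have "ennreal (2 * pi / (p * \<alpha>)) * (ennreal (p * \<alpha> / (2 * pi)) * fock_mass p \<alpha> f) = ennreal (2 * pi / (p * \<alpha>) * (p * \<alpha> / (2 * pi))) * fock_mass p \<alpha> f"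
    using assms by (subst ennreal_mult') (simp_all add: mult.assoc)
  also have "2 * pi / (p * \<alpha>) * (p * \<alpha> / (2 * pi)) = 1" using assms by simp
  finally show ?thesis by simp
qed

lemma fock_weight_powr:
  fixes x \<alpha> s n :: real
  assumes "0 \<le> x"
  shows "x powr s * exp (- (s * \<alpha> / 2) * n) = (x * exp (- (\<alpha> / 2) * n)) powr s"
  using assms by (simp add: powr_mult exp_powr_real mult_ac)

lemma weighted_berezin_le_split:
  assumes q: "0 < q" and qp: "q < p" and \<theta>: "0 < \<theta>"
  shows "ennreal (wpowr q (q * \<alpha> / 2) f w) * B
    \<le> ennreal \<theta> * ennreal (norm (f w) powr p * exp (- (p * \<alpha> / 2) * (norm (w::complex))\<^sup>2))
      + ennreal (\<theta> powr (- (q / (p - q)))) * epowr B (p / (p - q))"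
proof -
  define X where "X = norm (f w) * exp (- (\<alpha> / 2) * (norm w)\<^sup>2)"
  have X: "X \<ge> 0" by (simp add: X_def)
  show ?thesis
    unfolding fock_weight_powr[OF norm_ge_zero] X_def[symmetric]
    using powr_mult_le_split[OF q qp X \<theta>, of B] \<theta> by (simp add: ennreal_mult')
qed

lemma embedding_mass_le_split:
  fixes p q \<alpha> :: real
  assumes q: "0 < q" and qp: "q < p" and \<alpha>: "0 < \<alpha>"
  obtains C :: real where "C > 0" and
    "\<And>f g \<psi> \<theta>. \<lbrakk>f holomorphic_on UNIV; g holomorphic_on UNIV; \<psi> holomorphic_on UNIV; 0 < \<theta>\<rbrakk> \<Longrightarrow>
       embedding_mass q \<alpha> \<psi> g f \<le> ennreal C * (ennreal \<theta> * fock_mass p \<alpha> f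
         + ennreal (\<theta> powr (- (q / (p - q)))) * (berezin_integral p q \<alpha> \<psi> g))"
proof -
  obtain C :: real where C: "C > 0" and le:
    "\<And>f g \<psi>. \<lbrakk>f holomorphic_on UNIV; g holomorphic_on UNIV; \<psi> holomorphic_on UNIV\<rbrakk> \<Longrightarrow>
       embedding_mass q \<alpha> \<psi> g f \<le> ennreal C *
         (\<integral>\<^sup>+w. ennreal (wpowr q (q * \<alpha> / 2) f w) * berezin q \<alpha> \<psi> g w \<partial>lborel)"
    using embedding_mass_le_berezin[OF q \<alpha>] by blast
  show thesis
  proof (rule that[OF C])
    fix f g \<psi> :: "complex \<Rightarrow> complex" and \<theta> :: real
    assume h: "f holomorphic_on UNIV" "g holomorphic_on UNIV" "\<psi> holomorphic_on UNIV" and \<theta>: "0 < \<theta>"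
    have [measurable]: "f \<in> borel_measurable borel" "berezin q \<alpha> \<psi> g \<in> borel_measurable borel"
      using h berezin_measurable by (auto intro: entire_measurable)
    have "(\<integral>\<^sup>+w. ennreal (wpowr q (q * \<alpha> / 2) f w) * berezin q \<alpha> \<psi> g w \<partial>lborel)
      \<le> (\<integral>\<^sup>+w. ennreal \<theta> * ennreal (wpowr p (p * \<alpha> / 2) f w)
      + ennreal (\<theta> powr (- (q / (p - q)))) * epowr (berezin q \<alpha> \<psi> g w) (p / (p - q)) \<partial>lborel)"
      by (intro nn_integral_mono weighted_berezin_le_split q qp \<theta>)
    also have "\<dots> = ennreal \<theta> * fock_mass p \<alpha> f
         + ennreal (\<theta> powr (- (q / (p - q)))) * (berezin_integral p q \<alpha> \<psi> g)"
      unfolding fock_mass_def by (subst nn_integral_add) (simp_all add: nn_integral_cmult)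
    finally show "embedding_mass q \<alpha> \<psi> g f \<le> ennreal C * (ennreal \<theta> * fock_mass p \<alpha> f
         + ennreal (\<theta> powr (- (q / (p - q)))) * (berezin_integral p q \<alpha> \<psi> g))"
      using le[OF h] by (meson mult_left_mono order_trans zero_le)
  qed
qed

text \<open>The optimal parameter is \<open>\<theta> = b powr ((p - q) / p)\<close>, where \<open>b\<close> is the integral of the power of the
  Berezin transform. It may vanish, and then only larger \<open>\<theta>\<close> are admissible; hence the bound is shown
  for all \<open>\<theta> > 0\<close> above it and a limit is taken.\<close>
lemma volterra_comp_norm_le_berezin:
  fixes p q \<alpha> :: real
  assumes q: "0 < q" and qp: "q < p" and \<alpha>: "0 < \<alpha>"
  obtains C :: real where "C > 0" and
    "\<And>f g \<psi>. \<lbrakk>g holomorphic_on UNIV; \<psi> holomorphic_on UNIV; f \<in> fock_space p \<alpha>; fock_norm p \<alpha> f \<le> 1\<rbrakk> \<Longrightarrow>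
       fock_norm q \<alpha> (volterra_comp g \<psi> f) \<le> ennreal C *
         epowr (berezin_integral p q \<alpha> \<psi> g) ((p - q) / (p * q))"
proof -
  have p: "p > 0" using q qp by simp
  obtain C1 :: real where C1: "C1 > 0" and split:
    "\<And>f g \<psi> \<theta>. \<lbrakk>f holomorphic_on UNIV; g holomorphic_on UNIV; \<psi> holomorphic_on UNIV; 0 < \<theta>\<rbrakk> \<Longrightarrow>
       embedding_mass q \<alpha> \<psi> g f \<le> ennreal C1 * (ennreal \<theta> * fock_mass p \<alpha> f
         + ennreal (\<theta> powr (- (q / (p - q)))) * (berezin_integral p q \<alpha> \<psi> g))"
    using embedding_mass_le_split[OF q qp \<alpha>] by blast
  obtain C2 :: real where C2: "C2 > 0" and equiv:
    "\<And>f g \<psi>. \<lbrakk>f holomorphic_on UNIV; g holomorphic_on UNIV; \<psi> holomorphic_on UNIV\<rbrakk> \<Longrightarrow>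
       fock_mass q \<alpha> (volterra_comp g \<psi> f) \<le> ennreal C2 * embedding_mass q \<alpha> \<psi> g f"
    using volterra_mass_equiv_embedding_mass[OF q \<alpha>] by metis
  define m where "m = 2 * pi / (p * \<alpha>)"
  have m: "m > 0" using p \<alpha> by (simp add: m_def)
  define C3 where "C3 = C2 * (C1 * (m + 1))"
  have C3: "C3 > 0" using C1 C2 m by (simp add: C3_def)
  define k where "k = q * \<alpha> / (2 * pi)"
  have k: "k > 0" using q \<alpha> by (simp add: k_def)
  show thesis
  proof (rule that[of "(k * C3) powr (1 / q)"])
    show "(k * C3) powr (1 / q) > 0" using k C3 by simp
    fix f g \<psi> :: "complex \<Rightarrow> complex"
    assume g: "g holomorphic_on UNIV" and \<psi>: "\<psi> holomorphic_on UNIV" and f: "f \<in> fock_space p \<alpha>"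
      and nf: "fock_norm p \<alpha> f \<le> 1"
    note hf = fock_space_holomorphic[OF f]
    define I where "I = (berezin_integral p q \<alpha> \<psi> g)"
    show "fock_norm q \<alpha> (volterra_comp g \<psi> f) \<le> ennreal ((k * C3) powr (1 / q)) *
         epowr (berezin_integral p q \<alpha> \<psi> g) ((p - q) / (p * q))"
      unfolding I_def[symmetric]
    proof (cases I rule: epowr_cases)
      case 1
      then show "fock_norm q \<alpha> (volterra_comp g \<psi> f) \<le> ennreal ((k * C3) powr (1 / q)) * epowr I ((p - q) / (p * q))"
        using k C3 by (simp add: ennreal_mult_top)
    next
      case I: (2 b)
      define s where "s = b powr ((p - q) / p)"
      have s: "s \<ge> 0" by (simp add: s_def)
      have sb: "s powr (p / (p - q)) = b" using I p qp by (simp add: s_def powr_powr)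
      have le: "fock_mass q \<alpha> (volterra_comp g \<psi> f) \<le> ennreal (C3 * \<theta>)" if \<theta>: "\<theta> > 0" "s \<le> \<theta>" for \<theta>
      proof -
        have "b \<le> \<theta> powr (p / (p - q))"
          using powr_mono2[of "p / (p - q)" s \<theta>] p qp s \<theta> sb by simp
        then have "\<theta> powr (- (q / (p - q))) * b \<le> \<theta> powr (- (q / (p - q))) * \<theta> powr (p / (p - q))"
          by (rule mult_left_mono) simp
        also have "\<dots> = \<theta> powr (- (q / (p - q)) + p / (p - q))" by (rule powr_add[symmetric])
        also have "- (q / (p - q)) + p / (p - q) = 1" using qp by (simp add: divide_simps)
        also have "\<theta> powr 1 = \<theta>" using \<theta> by simp
        finally have b: "\<theta> powr (- (q / (p - q))) * b \<le> \<theta>" .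
        have "ennreal \<theta> * fock_mass p \<alpha> f + ennreal (\<theta> powr (- (q / (p - q)))) * I
          \<le> ennreal \<theta> * ennreal m + ennreal (\<theta> powr (- (q / (p - q))) * b)"
          unfolding I(1) m_def using fock_mass_unit_ball[OF p \<alpha> nf] by (intro add_mono mult_left_mono) (simp_all add: ennreal_mult')
        also have "\<dots> \<le> ennreal \<theta> * ennreal m + ennreal \<theta>" by (intro add_mono ennreal_leI b) simp
        also have "\<dots> = ennreal ((m + 1) * \<theta>)"
          using \<theta> m by (simp add: algebra_simps flip: ennreal_mult' ennreal_plus)
        finally have "embedding_mass q \<alpha> \<psi> g f \<le> ennreal C1 * ennreal ((m + 1) * \<theta>)"
          using split[OF hf g \<psi> \<theta>(1)] unfolding I_def[symmetric] by (meson mult_left_mono order_trans zero_le)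
        then have "fock_mass q \<alpha> (volterra_comp g \<psi> f) \<le> ennreal C2 * (ennreal C1 * ennreal ((m + 1) * \<theta>))"
          using equiv[OF hf g \<psi>] by (meson mult_left_mono order_trans zero_le)
        also have "\<dots> = ennreal (C3 * \<theta>)"
          using C1 C2 by (simp add: C3_def mult.assoc flip: ennreal_mult')
        finally show ?thesis .
      qed
      have "fock_mass q \<alpha> (volterra_comp g \<psi> f) \<le> ennreal (C3 * s)"
      proof (rule ennreal_le_epsilon)
        fix e :: real assume e: "e > 0"
        have "fock_mass q \<alpha> (volterra_comp g \<psi> f) \<le> ennreal (C3 * (s + e / C3))"
          using e C3 s by (intro le) (auto intro: add_nonneg_pos)
        also have "C3 * (s + e / C3) = C3 * s + e" using C3 by (simp add: field_simps)
        also have "ennreal (C3 * s + e) = ennreal (C3 * s) + ennreal e" using C3 s e by (intro ennreal_plus) auto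
        finally show "fock_mass q \<alpha> (volterra_comp g \<psi> f) \<le> ennreal (C3 * s) + ennreal e" .
      qed
      then have "ennreal k * fock_mass q \<alpha> (volterra_comp g \<psi> f) \<le> ennreal k * ennreal (C3 * s)"
        by (rule mult_left_mono) simp
      also have "\<dots> = ennreal (k * C3 * s)" using k by (simp add: mult.assoc flip: ennreal_mult')
      also have "\<dots> = epowr (ennreal ((k * C3 * s) powr (1 / q))) q"
        using q k C3 s by (simp add: epowr_ennreal powr_powr)
      finally have "fock_norm q \<alpha> (volterra_comp g \<psi> f) \<le> ennreal ((k * C3 * s) powr (1 / q))"
        unfolding k_def by (simp add: fock_norm_le_iff[OF q])
      also have "(k * C3 * s) powr (1 / q) = (k * C3) powr (1 / q) * b powr ((p - q) / (p * q))"
        by (simp add: powr_mult s_def powr_powr)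
      also have "ennreal \<dots> = ennreal ((k * C3) powr (1 / q)) * epowr I ((p - q) / (p * q))"
        using I by (simp add: epowr_ennreal ennreal_mult')
      finally show "fock_norm q \<alpha> (volterra_comp g \<psi> f) \<le> ennreal ((k * C3) powr (1 / q)) * epowr I ((p - q) / (p * q))" .
    qed
  qed
qed

text \<open>Let \<open>E n\<close> and \<open>P n\<close> be the Fock integrands of \<open>u n\<close> with exponents \<open>q\<close> and \<open>p\<close>. The excess of
  \<open>E n * berezin q \<alpha> \<psi> g\<close> over \<open>\<theta> * P n\<close> is dominated by an integrable function and tends to \<open>0\<close> wherever the
  Berezin transform is finite. What is left is at most \<open>\<theta>\<close> times a fixed constant.\<close>
lemma embedding_mass_tendsto_0:
  fixes p q \<alpha> K :: real
  assumes q: "0 < q" and qp: "q < p" and \<alpha>: "0 < \<alpha>"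
    and g: "g holomorphic_on UNIV" and \<psi>: "\<psi> holomorphic_on UNIV"
    and B: "(berezin_integral p q \<alpha> \<psi> g) < \<infinity>"
    and u: "\<And>n. u n holomorphic_on UNIV" and K: "K > 0" "\<And>n::nat. fock_mass p \<alpha> (u n) \<le> ennreal K"
    and lim: "\<And>w. (\<lambda>n. u n w) \<longlonglongrightarrow> 0"
  shows "(\<lambda>n. embedding_mass q \<alpha> \<psi> g (u n)) \<longlonglongrightarrow> 0"
proof (rule order_tendstoI)
  have [measurable]: "berezin q \<alpha> \<psi> g \<in> borel_measurable borel" "\<And>n. u n \<in> borel_measurable borel"
    using berezin_measurable[OF g \<psi>] u by (auto intro: entire_measurable)
  obtain C :: real where C: "C > 0" and le:
    "\<And>f g \<psi>. \<lbrakk>f holomorphic_on UNIV; g holomorphic_on UNIV; \<psi> holomorphic_on UNIV\<rbrakk> \<Longrightarrow>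
       embedding_mass q \<alpha> \<psi> g f \<le> ennreal C *
         (\<integral>\<^sup>+w. ennreal (wpowr q (q * \<alpha> / 2) f w) * berezin q \<alpha> \<psi> g w \<partial>lborel)"
    using embedding_mass_le_berezin[OF q \<alpha>] by blast
  fix a :: ennreal assume "0 < a"
  then obtain e where e: "e > 0" "ennreal e \<le> a"
    by (cases a rule: epowr_cases) (auto intro: that[of 1])
  define \<theta> where "\<theta> = e / (2 * C * K)"
  have \<theta>: "\<theta> > 0" using e C K by (simp add: \<theta>_def)
  define E where "E n w = ennreal (norm (u n w) powr q * exp (- (q * \<alpha> / 2) * (norm w)\<^sup>2))" for n w
  define P where "P n w = ennreal (norm (u n w) powr p * exp (- (p * \<alpha> / 2) * (norm w)\<^sup>2))" for n w
  have [measurable]: "E n \<in> borel_measurable borel" "P n \<in> borel_measurable borel" for n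
    unfolding E_def P_def by measurable
  define Y where "Y n w = E n w * berezin q \<alpha> \<psi> g w - ennreal \<theta> * P n w" for n w
  have "(\<lambda>n. \<integral>\<^sup>+w. Y n w \<partial>lborel) \<longlonglongrightarrow> (\<integral>\<^sup>+w. 0 \<partial>(lborel :: complex measure))"
  proof (rule nn_integral_dominated_convergence)
    show "AE w in lborel. Y n w \<le> ennreal (\<theta> powr (- (q / (p - q)))) * epowr (berezin q \<alpha> \<psi> g w) (p / (p - q))" for n
      unfolding Y_def E_def P_def ennreal_minus_le_iff
      using weighted_berezin_le_split[OF q qp \<theta>] by (intro AE_I2) (auto simp: ennreal_mult_eq_top_iff)
    show "(\<integral>\<^sup>+w. ennreal (\<theta> powr (- (q / (p - q)))) * epowr (berezin q \<alpha> \<psi> g w) (p / (p - q)) \<partial>lborel) < \<infinity>"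
      using B by (simp add: nn_integral_cmult ennreal_mult_less_top)
    have "AE w in lborel. epowr (berezin q \<alpha> \<psi> g w) (p / (p - q)) \<noteq> \<infinity>"
      using B by (intro nn_integral_PInf_AE) auto
    then show "AE w in lborel. (\<lambda>n. Y n w) \<longlonglongrightarrow> 0"
    proof eventually_elim
      case (elim w)
      then obtain b where b: "berezin q \<alpha> \<psi> g w = ennreal b" "b \<ge> 0"
        by (cases "berezin q \<alpha> \<psi> g w" rule: epowr_cases) auto
      have "(\<lambda>n. norm (u n w) powr q) \<longlonglongrightarrow> 0"
        using q lim[of w] by (intro tendsto_zero_powrI[where b=q]) (auto intro: tendsto_norm_zero)
      then have "(\<lambda>n. norm (u n w) powr q * exp (- (q * \<alpha> / 2) * (norm w)\<^sup>2) * b) \<longlonglongrightarrow> 0"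
        by (intro tendsto_mult_left_zero)
      from tendsto_ennrealI[OF this] have lim0: "(\<lambda>n. E n w * berezin q \<alpha> \<psi> g w) \<longlonglongrightarrow> 0"
        unfolding E_def b(1) by (simp add: ennreal_mult')
      show ?case
        by (rule tendsto_sandwich[OF _ _ tendsto_const lim0]) (auto simp: Y_def intro: diff_le_self_ennreal)
    qed
  qed (unfold Y_def, measurable)
  then have "(\<lambda>n. ennreal C * (\<integral>\<^sup>+w. Y n w \<partial>lborel)) \<longlonglongrightarrow> ennreal C * 0"
    by (intro ennreal_tendsto_cmult) auto
  then have ev: "\<forall>\<^sub>F n in sequentially. ennreal C * (\<integral>\<^sup>+w. Y n w \<partial>lborel) < ennreal (e / 2)"
    by (rule order_tendstoD) (use e in auto)
  show "\<forall>\<^sub>F n in sequentially. embedding_mass q \<alpha> \<psi> g (u n) < a"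
    using ev
  proof eventually_elim
    case (elim n)
    have "(\<integral>\<^sup>+w. E n w * berezin q \<alpha> \<psi> g w \<partial>lborel) \<le> (\<integral>\<^sup>+w. Y n w + ennreal \<theta> * P n w \<partial>lborel)"
    proof (rule nn_integral_mono)
      fix w
      show "E n w * berezin q \<alpha> \<psi> g w \<le> Y n w + ennreal \<theta> * P n w"
        unfolding Y_def by (cases "ennreal \<theta> * P n w \<le> E n w * berezin q \<alpha> \<psi> g w")
          (auto simp: diff_add_cancel_ennreal add_increasing)
    qed
    also have "\<dots> = (\<integral>\<^sup>+w. Y n w \<partial>lborel) + ennreal \<theta> * fock_mass p \<alpha> (u n)"
      unfolding fock_mass_def P_def[symmetric] Y_def by (subst nn_integral_add) (auto simp: nn_integral_cmult)
    also have "\<dots> \<le> (\<integral>\<^sup>+w. Y n w \<partial>lborel) + ennreal \<theta> * ennreal K"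
      by (intro add_left_mono mult_left_mono K) auto
    finally have "ennreal C * (\<integral>\<^sup>+w. E n w * berezin q \<alpha> \<psi> g w \<partial>lborel)
       \<le> ennreal C * ((\<integral>\<^sup>+w. Y n w \<partial>lborel) + ennreal \<theta> * ennreal K)"
      by (rule mult_left_mono) simp
    also have "\<dots> = ennreal C * (\<integral>\<^sup>+w. Y n w \<partial>lborel) + ennreal (e / 2)"
    proof -
      have "C * (\<theta> * K) = e / 2" using C K by (simp add: \<theta>_def field_simps)
      moreover have "ennreal C * (ennreal \<theta> * ennreal K) = ennreal (C * (\<theta> * K))"
        using C \<theta> by (simp add: ennreal_mult')
      ultimately show ?thesis by (simp only: distrib_left)
    qed
    finally have "embedding_mass q \<alpha> \<psi> g (u n) \<le> ennreal C * (\<integral>\<^sup>+w. Y n w \<partial>lborel) + ennreal (e / 2)"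
      using le[OF u g \<psi>, of n] by (simp add: E_def)
    also have "\<dots> < ennreal e"
      using elim e by (cases "ennreal C * (\<integral>\<^sup>+w. Y n w \<partial>lborel)" rule: epowr_cases)
        (auto simp: ennreal_less_iff simp flip: ennreal_plus)
    finally show ?case using e(2) by (rule less_le_trans)
  qed
qed simp

lemma fock_unit_ball_locally_bounded:
  fixes p \<alpha> :: real
  assumes p: "0 < p" and \<alpha>: "0 < \<alpha>"
  obtains M :: "real \<Rightarrow> real" where
    "\<And>f z R. f holomorphic_on UNIV \<Longrightarrow> fock_norm p \<alpha> f \<le> 1 \<Longrightarrow> norm z \<le> R \<Longrightarrow> norm (f z) \<le> M R"
proof -
  define c where "c = p * \<alpha> / 2"
  have c: "c > 0" using p \<alpha> by (simp add: c_def)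
  obtain C :: real where C: "C > 0" and pt: "\<And>f \<zeta>. f holomorphic_on UNIV \<Longrightarrow>
       ennreal (wpowr p c f \<zeta>) \<le> ennreal C *
         (\<integral>\<^sup>+w. ennreal (wpowr p c f w) * ennreal (exp (- c * (dist \<zeta> w)\<^sup>2)) \<partial>lborel)"
    using fock_pointwise_gaussian_bound[OF p \<alpha>] unfolding c_def by blast
  define m where "m = 2 * pi / (p * \<alpha>)"
  have m: "m > 0" using p \<alpha> by (simp add: m_def)
  show thesis
  proof (rule that[of "\<lambda>R. (C * m * exp (c * R\<^sup>2)) powr (1 / p)"])
    fix f :: "complex \<Rightarrow> complex" and z :: complex and R :: real
    assume f: "f holomorphic_on UNIV" and nf: "fock_norm p \<alpha> f \<le> 1" and z: "norm z \<le> R"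
    have "ennreal (wpowr p c f z) \<le> ennreal C *
         (\<integral>\<^sup>+w. ennreal (wpowr p c f w) * ennreal (exp (- c * (dist z w)\<^sup>2)) \<partial>lborel)"
      by (rule pt[OF f])
    also have "\<dots> \<le> ennreal C * (\<integral>\<^sup>+w. ennreal (wpowr p c f w) * 1 \<partial>lborel)"
      using c by (intro mult_left_mono nn_integral_mono) auto
    also have "\<dots> = ennreal C * fock_mass p \<alpha> f" by (simp add: fock_mass_def c_def)
    also have "\<dots> \<le> ennreal C * ennreal m"
      unfolding m_def by (intro mult_left_mono fock_mass_unit_ball[OF p \<alpha> nf]) simp
    also have "\<dots> = ennreal (C * m)" using C by (simp add: ennreal_mult')
    finally have le: "wpowr p c f z \<le> C * m"
      using C m by (subst (asm) ennreal_le_iff) auto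
    have "(norm z)\<^sup>2 \<le> R\<^sup>2" using z by (intro power_mono) auto
    then have "exp (c * (norm z)\<^sup>2) \<le> exp (c * R\<^sup>2)" using c by simp
    then have "wpowr p c f z * exp (c * (norm z)\<^sup>2) \<le> C * m * exp (c * R\<^sup>2)"
      using C m by (intro mult_mono[OF le]) auto
    then have "norm (f z) powr p \<le> C * m * exp (c * R\<^sup>2)"
      by (simp add: mult.assoc flip: exp_add)
    then have "(norm (f z) powr p) powr (1 / p) \<le> (C * m * exp (c * R\<^sup>2)) powr (1 / p)"
      using p by (intro powr_mono2) auto
    then show "norm (f z) \<le> (C * m * exp (c * R\<^sup>2)) powr (1 / p)"
      using p by (simp add: powr_powr)
  qed
qed

text \<open>Montel's theorem gives a locally uniform limit, and Fatou's lemma keeps it in the unit ball.\<close>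
lemma fock_unit_ball_subsequence:
  fixes p \<alpha> :: real
  assumes p: "0 < p" and \<alpha>: "0 < \<alpha>"
    and f: "\<And>n::nat. f n \<in> fock_space p \<alpha>" and nf: "\<And>n. fock_norm p \<alpha> (f n) \<le> 1"
  obtains h r where "h \<in> fock_space p \<alpha>" "fock_norm p \<alpha> h \<le> 1" "strict_mono (r :: nat \<Rightarrow> nat)"
    "\<And>z. (\<lambda>n. f (r n) z) \<longlonglongrightarrow> h z"
proof -
  define H where "H = {u. u holomorphic_on UNIV \<and> fock_norm p \<alpha> u \<le> 1}"
  obtain M where M: "\<And>f z R. f holomorphic_on UNIV \<Longrightarrow> fock_norm p \<alpha> f \<le> 1 \<Longrightarrow> norm z \<le> R \<Longrightarrow> norm (f z) \<le> M R"
    using fock_unit_ball_locally_bounded[OF p \<alpha>] by blast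
  have bd: "\<exists>B. \<forall>u\<in>H. \<forall>z\<in>K. norm (u z) \<le> B" if cK: "compact K" for K
  proof -
    obtain R where "\<And>z. z \<in> K \<Longrightarrow> norm z \<le> R"
      using compact_imp_bounded[OF cK] by (auto simp: bounded_iff)
    then show ?thesis using M by (intro exI[of _ "M R"]) (auto simp: H_def)
  qed
  have rng: "range f \<subseteq> H" using f nf by (auto simp: H_def fock_space_def)
  obtain h r where h: "h holomorphic_on UNIV" and r: "strict_mono (r :: nat \<Rightarrow> nat)"
    and lim: "\<And>z. (\<lambda>n. f (r n) z) \<longlonglongrightarrow> h z"
  proof (rule Montel[OF open_UNIV _ _ rng])
    show "u holomorphic_on UNIV" if "u \<in> H" for u using that by (simp add: H_def)
    show "\<exists>B. \<forall>u\<in>H. \<forall>z\<in>K. norm (u z) \<le> B" if "compact K" for K using bd[OF that] .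
  qed simp
  have [measurable]: "f n \<in> borel_measurable borel" "h \<in> borel_measurable borel" for n
    using f h by (auto intro: entire_measurable fock_space_holomorphic)
  define W where "W u z = ennreal (wpowr p (p * \<alpha> / 2) u z)" for u :: "complex \<Rightarrow> complex" and z
  have [measurable]: "W u \<in> borel_measurable borel" if "u \<in> borel_measurable borel" for u
    unfolding W_def using that by measurable
  have Wlim: "(\<lambda>n. W (f (r n)) z) \<longlonglongrightarrow> W h z" for z
    unfolding W_def using p lim[of z]
    by (intro tendsto_ennrealI tendsto_mult tendsto_powr' tendsto_norm tendsto_const) auto
  have "fock_mass p \<alpha> h = (\<integral>\<^sup>+z. liminf (\<lambda>n. W (f (r n)) z) \<partial>lborel)"
    unfolding fock_mass_def W_def[symmetric] by (intro nn_integral_cong) (simp add: lim_imp_Liminf[OF _ Wlim])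
  also have "\<dots> \<le> liminf (\<lambda>n. \<integral>\<^sup>+z. W (f (r n)) z \<partial>lborel)"
    by (rule nn_integral_liminf) measurable
  also have "\<dots> \<le> ennreal (2 * pi / (p * \<alpha>))"
  proof (rule Liminf_le)
    show "\<forall>\<^sub>F n in sequentially. (\<integral>\<^sup>+z. W (f (r n)) z \<partial>lborel) \<le> ennreal (2 * pi / (p * \<alpha>))"
      using fock_mass_unit_ball[OF p \<alpha> nf] by (simp add: fock_mass_def W_def)
  qed simp
  finally have "ennreal (p * \<alpha> / (2 * pi)) * fock_mass p \<alpha> h \<le> ennreal (p * \<alpha> / (2 * pi)) * ennreal (2 * pi / (p * \<alpha>))"
    by (rule mult_left_mono) simp
  also have "\<dots> = epowr 1 p"
    using p \<alpha> epowr_ennreal[of 1 p] by (simp flip: ennreal_mult')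
  finally have "fock_norm p \<alpha> h \<le> 1" by (simp add: fock_norm_le_iff[OF p])
  moreover from this have "fock_norm p \<alpha> h < \<infinity>" by (rule le_less_trans) simp
  ultimately show thesis using h r lim by (intro that[of h r]) (auto simp: fock_space_def)
qed

lemma fock_mass_diff_le:
  assumes f: "f holomorphic_on UNIV" and g: "g holomorphic_on UNIV" and p: "0 < p"
  shows "fock_mass p \<alpha> (\<lambda>z. f z - g z) \<le> ennreal (2 powr p) * (fock_mass p \<alpha> f + fock_mass p \<alpha> g)"
proof -
  have [measurable]: "f \<in> borel_measurable borel" "g \<in> borel_measurable borel" using f g by measurable
  have "fock_mass p \<alpha> (\<lambda>z. f z - g z) \<le> (\<integral>\<^sup>+z. ennreal (2 powr p) * (ennreal (wpowr p (p * \<alpha> / 2) f z)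
     + ennreal (wpowr p (p * \<alpha> / 2) g z)) \<partial>lborel)"
    unfolding fock_mass_def
  proof (rule nn_integral_mono)
    fix z :: complex
    define w where "w = exp (- (p * \<alpha> / 2) * (norm z)\<^sup>2)"
    have "norm (f z - g z) powr p \<le> (norm (f z) + norm (g z)) powr p"
      using p by (intro powr_mono2 norm_triangle_ineq4) auto
    also have "\<dots> \<le> 2 powr p * (norm (f z) powr p + norm (g z) powr p)"
      using powr_add_le_split[of "norm (f z)" "norm (g z)" 1 p] p by (simp add: distrib_left)
    finally have "norm (f z - g z) powr p * w \<le> 2 powr p * (norm (f z) powr p + norm (g z) powr p) * w"
      by (rule mult_right_mono) (simp add: w_def)
    also have "\<dots> = 2 powr p * (norm (f z) powr p * w + norm (g z) powr p * w)" by (simp add: algebra_simps)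
    finally show "ennreal (norm (f z - g z) powr p * exp (- (p * \<alpha> / 2) * (norm z)\<^sup>2)) \<le> ennreal (2 powr p) * (ennreal (wpowr p (p * \<alpha> / 2) f z)
     + ennreal (wpowr p (p * \<alpha> / 2) g z))"
      unfolding w_def by (subst ennreal_plus[symmetric], simp, simp) (subst ennreal_mult'[symmetric], simp, rule ennreal_leI)
  qed
  also have "\<dots> = ennreal (2 powr p) * (fock_mass p \<alpha> f + fock_mass p \<alpha> g)"
    unfolding fock_mass_def by (subst nn_integral_cmult) (simp_all add: nn_integral_add)
  finally show ?thesis .
qed

lemma fock_dist_tendsto_0:
  assumes q: "0 < q" and \<alpha>: "0 < \<alpha>" and mass: "(\<lambda>n. fock_mass q \<alpha> (\<lambda>z. F n z - G z)) \<longlonglongrightarrow> 0"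
  shows "(\<lambda>n. fock_dist q \<alpha> (F n) G) \<longlonglongrightarrow> 0"
proof -
  define k where "k = q * \<alpha> / (2 * pi)"
  have "(\<lambda>n. ennreal k * fock_mass q \<alpha> (\<lambda>z. F n z - G z)) \<longlonglongrightarrow> ennreal k * 0"
    by (intro ennreal_tendsto_cmult mass) simp
  then have lim: "(\<lambda>n. enn2real (ennreal k * fock_mass q \<alpha> (\<lambda>z. F n z - G z))) \<longlonglongrightarrow> 0"
    by (intro tendsto_enn2real) simp_all
  have "(\<lambda>n. (enn2real (ennreal k * fock_mass q \<alpha> (\<lambda>z. F n z - G z)) powr (1 / q)) powr min 1 q) \<longlonglongrightarrow> 0"
    using q by (intro tendsto_zero_powrI[OF _ tendsto_const] lim) auto
  moreover have "fock_dist q \<alpha> (F n) G = (enn2real (ennreal k * fock_mass q \<alpha> (\<lambda>z. F n z - G z)) powr (1 / q)) powr min 1 q" for n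
    unfolding fock_dist_def fock_norm_def fock_mass_def[symmetric] k_def[symmetric] by (simp add: epowr_def)
  ultimately show ?thesis by simp
qed

text \<open>The image of the closed unit ball is itself sequentially compact, hence closed: along a
  subsequence \<open>f (r n)\<close> tends pointwise to some \<open>h\<close> in the ball, and the image of \<open>f (r n) - h\<close> tends to
  \<open>0\<close> in norm.\<close>
lemma fock_compact_volterra_comp_of_berezin:
  fixes p q \<alpha> :: real
  assumes q: "0 < q" and qp: "q < p" and \<alpha>: "0 < \<alpha>"
    and g: "g holomorphic_on UNIV" and \<psi>: "\<psi> holomorphic_on UNIV"
    and B: "(berezin_integral p q \<alpha> \<psi> g) < \<infinity>"
  shows "fock_compact p q \<alpha> (volterra_comp g \<psi>)"
proof -
  have p: "p > 0" using q qp by simp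
  define T where "T = volterra_comp g \<psi>"
  define S where "S = T ` {f \<in> fock_space p \<alpha>. fock_norm p \<alpha> f \<le> 1}"
  interpret F: Metric_space "fock_space q \<alpha>" "fock_dist q \<alpha>" by (rule Metric_space_fock[OF q \<alpha>])
  have Tq: "T f \<in> fock_space q \<alpha>" if f: "f \<in> fock_space p \<alpha>" for f
  proof -
    obtain C :: real where C: "C > 0" and le:
      "\<And>f g \<psi>. \<lbrakk>g holomorphic_on UNIV; \<psi> holomorphic_on UNIV; f \<in> fock_space p \<alpha>; fock_norm p \<alpha> f \<le> 1\<rbrakk> \<Longrightarrow>
       fock_norm q \<alpha> (volterra_comp g \<psi> f) \<le> ennreal C *
         epowr (berezin_integral p q \<alpha> \<psi> g) ((p - q) / (p * q))"
      using volterra_comp_norm_le_berezin[OF q qp \<alpha>] by blast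
    have "fock_norm q \<alpha> (T f) \<le> (ennreal C *
         epowr (berezin_integral p q \<alpha> \<psi> g) ((p - q) / (p * q))) * fock_norm p \<alpha> f"
      unfolding T_def by (rule volterra_comp_bound_from_unit_ball[OF p q \<alpha> g \<psi> le[OF g \<psi>] f])
    also have "\<dots> < \<infinity>"
      using f B epowr_less_top_iff[of _ "(p - q) / (p * q)"] by (auto simp: ennreal_mult_less_top fock_space_def)
    finally show ?thesis
      using volterra_comp_holomorphic[OF fock_space_holomorphic[OF f] g \<psi>] by (simp add: fock_space_def T_def)
  qed
  obtain C2 :: real where C2: "C2 > 0" and equiv:
    "\<And>f g \<psi>. \<lbrakk>f holomorphic_on UNIV; g holomorphic_on UNIV; \<psi> holomorphic_on UNIV\<rbrakk> \<Longrightarrow>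
       fock_mass q \<alpha> (volterra_comp g \<psi> f) \<le> ennreal C2 * embedding_mass q \<alpha> \<psi> g f"
    using volterra_mass_equiv_embedding_mass[OF q \<alpha>] by metis
  have "compactin F.mtopology S"
    unfolding F.compactin_sequentially
  proof (intro conjI allI impI)
    show "S \<subseteq> fock_space q \<alpha>" using Tq by (auto simp: S_def)
    fix \<sigma> :: "nat \<Rightarrow> complex \<Rightarrow> complex"
    assume "range \<sigma> \<subseteq> S"
    then have "\<sigma> n \<in> S" for n by auto
    then have "\<exists>f. f \<in> fock_space p \<alpha> \<and> fock_norm p \<alpha> f \<le> 1 \<and> \<sigma> n = T f" for n
      unfolding S_def by blast
    then have "\<exists>f. \<forall>n. f n \<in> fock_space p \<alpha> \<and> fock_norm p \<alpha> (f n) \<le> 1 \<and> \<sigma> n = T (f n)"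
      by (intro choice allI)
    then obtain f where f: "\<And>n. f n \<in> fock_space p \<alpha>" "\<And>n. fock_norm p \<alpha> (f n) \<le> 1" "\<And>n. \<sigma> n = T (f n)" by blast
    obtain h r where h: "h \<in> fock_space p \<alpha>" "fock_norm p \<alpha> h \<le> 1" and r: "strict_mono (r :: nat \<Rightarrow> nat)"
      and lim: "\<And>z. (\<lambda>n. f (r n) z) \<longlonglongrightarrow> h z"
      by (rule fock_unit_ball_subsequence[where f = f, OF p \<alpha> f(1,2)]) (rule that)
    define u where "u n z = f (r n) z - h z" for n z
    have hf: "f n holomorphic_on UNIV" and hh: "h holomorphic_on UNIV" for n
      using f h by (auto intro: fock_space_holomorphic)
    have hu: "u n holomorphic_on UNIV" for n unfolding u_def using hf hh by (intro holomorphic_intros)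
    define m where "m = 2 * pi / (p * \<alpha>)"
    have m: "m > 0" using p \<alpha> by (simp add: m_def)
    have mu: "fock_mass p \<alpha> (u n) \<le> ennreal (2 powr p * (m + m))" for n
    proof -
      have "fock_mass p \<alpha> (u n) \<le> ennreal (2 powr p) * (fock_mass p \<alpha> (f (r n)) + fock_mass p \<alpha> h)"
        unfolding u_def by (rule fock_mass_diff_le[OF hf hh p])
      also have "\<dots> \<le> ennreal (2 powr p) * (ennreal m + ennreal m)"
        unfolding m_def by (intro mult_left_mono add_mono fock_mass_unit_ball p \<alpha> f h) simp
      also have "\<dots> = ennreal (2 powr p * (m + m))"
        by (simp only: ennreal_mult'[OF powr_ge_zero] ennreal_plus[OF less_imp_le[OF m] less_imp_le[OF m]])
      finally show ?thesis .
    qed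
    have "(\<lambda>n. u n z) \<longlonglongrightarrow> 0" for z
      using tendsto_diff[OF lim[of z] tendsto_const[of "h z"]] by (simp add: u_def)
    from embedding_mass_tendsto_0[OF q qp \<alpha> g \<psi> B hu _ mu this]
    have "(\<lambda>n. embedding_mass q \<alpha> \<psi> g (u n)) \<longlonglongrightarrow> 0" using m by simp
    then have "(\<lambda>n. ennreal C2 * embedding_mass q \<alpha> \<psi> g (u n)) \<longlonglongrightarrow> ennreal C2 * 0"
      by (intro ennreal_tendsto_cmult) auto
    then have "(\<lambda>n. ennreal C2 * embedding_mass q \<alpha> \<psi> g (u n)) \<longlonglongrightarrow> 0" by simp
    then have "(\<lambda>n. fock_mass q \<alpha> (T (u n))) \<longlonglongrightarrow> 0"
      unfolding T_def
      by (rule tendsto_sandwich[OF always_eventually always_eventually tendsto_const, rotated 2])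
        (use equiv[OF hu g \<psi>] in auto)
    moreover have "T (u n) = (\<lambda>z. T (f (r n)) z - T h z)" for n
      unfolding T_def u_def by (rule volterra_comp_diff[OF hf hh g \<psi>])
    ultimately have "(\<lambda>n. fock_dist q \<alpha> (T (f (r n))) (T h)) \<longlonglongrightarrow> 0"
      by (intro fock_dist_tendsto_0[OF q \<alpha>]) simp
    then have "limitin F.mtopology (\<sigma> \<circ> r) (T h) sequentially"
      using Tq[OF h(1)] Tq[OF f(1)] by (simp add: F.limitin_metric_dist_null f(3))
    moreover have "T h \<in> S" using h by (auto simp: S_def)
    ultimately show "\<exists>l r. l \<in> S \<and> strict_mono r \<and> limitin F.mtopology (\<sigma> \<circ> r) l sequentially" using r by blast
  qed
  moreover from this have "closedin F.mtopology S"
    by (rule compactin_imp_closedin[OF F.Hausdorff_space_mtopology])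
  ultimately have "compactin F.mtopology (F.mtopology closure_of S)"
    by (simp add: closure_of_closedin)
  then show ?thesis
    using Tq unfolding fock_compact_def fock_topology_def S_def T_def by auto
qed

text \<open>The compact closure of the image of the unit ball is bounded in the metric and contains \<open>0\<close>.
  Measuring distances from \<open>0\<close> bounds the norms on that image.\<close>
lemma fock_compact_imp_fock_bounded:
  fixes p q \<alpha> :: real
  assumes p: "0 < p" and q: "0 < q" and \<alpha>: "0 < \<alpha>"
    and g: "g holomorphic_on UNIV" and \<psi>: "\<psi> holomorphic_on UNIV"
    and cpt: "fock_compact p q \<alpha> (volterra_comp g \<psi>)"
  shows "fock_bounded p q \<alpha> (volterra_comp g \<psi>)"
proof -
  define T where "T = volterra_comp g \<psi>"
  define S where "S = T ` {f \<in> fock_space p \<alpha>. fock_norm p \<alpha> f \<le> 1}"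
  interpret F: Metric_space "fock_space q \<alpha>" "fock_dist q \<alpha>" by (rule Metric_space_fock[OF q \<alpha>])
  have Tq: "T ` fock_space p \<alpha> \<subseteq> fock_space q \<alpha>" and K: "compactin F.mtopology (F.mtopology closure_of S)"
    using cpt by (auto simp: fock_compact_def fock_topology_def S_def T_def)
  have Ssub: "S \<subseteq> fock_space q \<alpha>" using Tq by (auto simp: S_def)
  have "F.mbounded (F.mtopology closure_of S)" using K by (rule F.compactin_imp_mbounded)
  moreover have "S \<subseteq> F.mtopology closure_of S" using Ssub by (intro closure_of_subset) simp
  ultimately have "F.mbounded S" by (rule F.mbounded_subset)
  then obtain b where b: "\<And>x y. x \<in> S \<Longrightarrow> y \<in> S \<Longrightarrow> fock_dist q \<alpha> x y \<le> b"
    by (auto simp: F.mbounded_alt)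
  have z0: "fock_norm s \<alpha> (\<lambda>z. 0) = 0" if "s > 0" for s using that by (simp add: fock_norm_def epowr_def)
  have "(\<lambda>z. 0) \<in> fock_space p \<alpha>" using z0[OF p] by (simp add: fock_space_def)
  moreover have "T (\<lambda>z. 0) = (\<lambda>z. 0)" by (auto simp: T_def volterra_comp_def)
  ultimately have S0: "(\<lambda>z. 0) \<in> S" unfolding S_def using z0[OF p] by (intro image_eqI[of _ _ "\<lambda>z. 0"]) auto
  define M where "M = \<bar>b\<bar> powr (1 / min 1 q)"
  have "fock_norm q \<alpha> (T f) \<le> ennreal M" if "f \<in> fock_space p \<alpha>" "fock_norm p \<alpha> f \<le> 1" for f
  proof -
    have TS: "T f \<in> S" using that by (auto simp: S_def)
    then have d: "fock_dist q \<alpha> (T f) (\<lambda>z. 0) \<le> \<bar>b\<bar>" using b[OF _ S0, of "T f"] by linarith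
    have "(\<lambda>z. T f z - 0) \<in> fock_space q \<alpha>" using TS Ssub by auto
    then have "epowr (fock_norm q \<alpha> (\<lambda>z. T f z - 0)) (min 1 q) \<le> ennreal \<bar>b\<bar>"
      using d q by (subst fock_dist_eq[symmetric]) (auto intro: ennreal_leI)
    then have "fock_norm q \<alpha> (\<lambda>z. T f z - 0) \<le> epowr (ennreal \<bar>b\<bar>) (1 / min 1 q)"
      using q by (subst (asm) epowr_le_iff) auto
    then show ?thesis by (simp add: epowr_ennreal M_def)
  qed
  then have "fock_norm q \<alpha> (T f) \<le> ennreal M * fock_norm p \<alpha> f" if "f \<in> fock_space p \<alpha>" for f
    using volterra_comp_bound_from_unit_ball[OF p q \<alpha> g \<psi> _ that] by (auto simp: T_def)
  then show ?thesis using Tq unfolding fock_bounded_def T_def by blast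
qed

section \<open>Gaussian sums over the integer lattice\<close>

text \<open>On the annulus \<open>n \<le> (norm w)\<^sup>2 < n + 1\<close> the integrand is at most \<open>exp (- \<beta>) ^ n\<close>, and the area is at most
  \<open>pi * (n + 1)\<close>.\<close>
lemma gaussian_integral_bound:
  fixes \<beta> :: real
  assumes \<beta>: "\<beta> > 0"
  obtains G :: real where "G > 0"
    "\<And>\<zeta>. (\<integral>\<^sup>+w. ennreal (exp (- \<beta> * (dist (\<zeta>::complex) w)\<^sup>2)) \<partial>lborel) \<le> ennreal G"
proof -
  define x where "x = exp (- \<beta>)"
  have x: "0 < x" "x < 1" using \<beta> by (simp_all add: x_def)
  have "(\<integral>\<^sup>+w. ennreal (exp (- \<beta> * (norm (w::complex))\<^sup>2)) \<partial>lborel) \<le> (\<integral>\<^sup>+w. (\<Sum>n. ennreal (x ^ n) * indicator (annulus n) w) \<partial>lborel)"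
  proof (rule nn_integral_mono)
    fix w :: complex
    define n where "n = nat \<lfloor>(norm w)\<^sup>2\<rfloor>"
    have wn: "w \<in> annulus n" unfolding n_def by (rule mem_annulus_floor)
    then have "real n \<le> (norm w)\<^sup>2" by (simp add: annulus_def)
    then have "\<beta> * real n \<le> \<beta> * (norm w)\<^sup>2" using \<beta> by (intro mult_left_mono) auto
    then have "exp (- \<beta> * (norm w)\<^sup>2) \<le> exp (real n * - \<beta>)" by (simp add: mult.commute)
    then have "exp (- \<beta> * (norm w)\<^sup>2) \<le> x ^ n" unfolding x_def exp_of_nat_mult .
    then have "ennreal (exp (- \<beta> * (norm w)\<^sup>2)) \<le> (\<Sum>k\<in>{n}. ennreal (x ^ k) * indicator (annulus k) w)" using wn by (simp add: ennreal_leI)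
    also have "\<dots> \<le> (\<Sum>n. ennreal (x ^ n) * indicator (annulus n) w)" by (intro sum_le_suminf) auto
    finally show "ennreal (exp (- \<beta> * (norm w)\<^sup>2)) \<le> (\<Sum>n. ennreal (x ^ n) * indicator (annulus n) w)" .
  qed
  also have "\<dots> = (\<Sum>n. \<integral>\<^sup>+w. ennreal (x ^ n) * indicator (annulus n) w \<partial>lborel)" by (rule nn_integral_suminf) measurable
  also have "\<dots> \<le> (\<Sum>n. ennreal (pi * (real (Suc n) * x ^ n)))"
  proof (intro suminf_le allI summableI)
    fix n
    have "(\<integral>\<^sup>+w. ennreal (x ^ n) * indicator (annulus n) w \<partial>lborel)
       \<le> (\<integral>\<^sup>+w. ennreal (x ^ n) * indicator (ball (0::complex) (sqrt (real n + 1))) w \<partial>lborel)"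
      by (intro nn_integral_mono mult_left_mono) (use annulus_subset_ball[of n] in \<open>auto split: split_indicator\<close>)
    also have "\<dots> = ennreal (x ^ n) * ennreal (pi * (real n + 1))"
      by (subst nn_integral_cmult_indicator) (simp_all add: emeasure_disc)
    also have "\<dots> = ennreal (pi * (real (Suc n) * x ^ n))"
      using x by (simp add: mult_ac add.commute flip: ennreal_mult')
    finally show "(\<integral>\<^sup>+w. ennreal (x ^ n) * indicator (annulus n) w \<partial>lborel) \<le> ennreal (pi * (real (Suc n) * x ^ n))" .
  qed
  also have "\<dots> < \<infinity>"
  proof -
    have "summable (\<lambda>n. real (Suc n) * x ^ n)" using geometric_deriv_sums[of x] x by (auto simp: sums_iff)
    then have "(\<Sum>n. ennreal (pi * (real (Suc n) * x ^ n))) \<noteq> top"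
      using x by (intro ennreal_suminf_neq_top summable_mult) auto
    then show ?thesis by (simp add: less_top)
  qed
  finally have fin: "(\<integral>\<^sup>+w. ennreal (exp (- \<beta> * (norm (w::complex))\<^sup>2)) \<partial>lborel) < \<infinity>" (is "?I < _") .
  show thesis
  proof (rule that[of "enn2real ?I + 1"])
    show "enn2real ?I + 1 > 0" by (simp add: add_nonneg_pos)
    fix \<zeta> :: complex
    have "(\<integral>\<^sup>+w. ennreal (exp (- \<beta> * (dist \<zeta> w)\<^sup>2)) \<partial>lborel) = (\<integral>\<^sup>+w. ennreal (exp (- \<beta> * (norm (- \<zeta> + w))\<^sup>2)) \<partial>lborel)"
      by (simp add: dist_norm norm_minus_commute)
    also have "\<dots> = ?I" by (rule nn_integral_lborel_translate) measurable
    also have "?I \<le> ennreal (enn2real ?I + 1)" using fin by (cases ?I rule: epowr_cases) auto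
    finally show "(\<integral>\<^sup>+w. ennreal (exp (- \<beta> * (dist \<zeta> w)\<^sup>2)) \<partial>lborel) \<le> ennreal (enn2real ?I + 1)" .
  qed
qed

text \<open>The unit squares with lower left corners in \<open>\<int> + \<i> \<int>\<close>, given through the map that sends a point
  to the index of its square.\<close>
definition lattice_cell :: "complex \<Rightarrow> int \<times> int" where
  "lattice_cell z = (\<lfloor>Re z\<rfloor>, \<lfloor>Im z\<rfloor>)"

definition lattice_pt :: "int \<times> int \<Rightarrow> complex" where
  "lattice_pt j = Complex (of_int (fst j)) (of_int (snd j))"

abbreviation lattice_gauss :: "real \<Rightarrow> complex \<Rightarrow> int \<times> int \<Rightarrow> real" where
  "lattice_gauss \<beta> w j \<equiv> exp (- \<beta> * (dist w (lattice_pt j))\<^sup>2)"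

lemma lattice_cell_measurable [measurable]: "{z. lattice_cell z = j} \<in> sets borel"
proof -
  have "{z. lattice_cell z = j} = {z \<in> space borel. \<lfloor>Re z\<rfloor> = fst j \<and> \<lfloor>Im z\<rfloor> = snd j}"
    by (auto simp: lattice_cell_def)
  then show ?thesis by simp
qed

lemma dist_lattice_pt: "(dist z (lattice_pt (lattice_cell z)))\<^sup>2 \<le> 2"
proof -
  have "(Re z - of_int \<lfloor>Re z\<rfloor>)\<^sup>2 \<le> 1\<^sup>2" "(Im z - of_int \<lfloor>Im z\<rfloor>)\<^sup>2 \<le> 1\<^sup>2"
    by (intro power_mono; linarith)+
  then show ?thesis unfolding dist_norm cmod_power2 lattice_pt_def lattice_cell_def by simp
qed

lemma dist_sq_le_lattice_pt:
  "(dist w z)\<^sup>2 \<le> 2 * (dist w (lattice_pt (lattice_cell z)))\<^sup>2 + 4"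
  "(dist w (lattice_pt (lattice_cell z)))\<^sup>2 \<le> 2 * (dist w z)\<^sup>2 + 4"
proof -
  have sq: "(a + b)\<^sup>2 \<le> 2 * a\<^sup>2 + 2 * b\<^sup>2" for a b :: real
    using sum_squares_bound[of a b] by (simp add: power2_sum)
  let ?z = "lattice_pt (lattice_cell z)"
  have "(dist w z)\<^sup>2 \<le> (dist w ?z + dist z ?z)\<^sup>2" by (intro power_mono dist_triangle2) auto
  then show "(dist w z)\<^sup>2 \<le> 2 * (dist w ?z)\<^sup>2 + 4" using sq[of "dist w ?z" "dist z ?z"] dist_lattice_pt[of z] by linarith
  have "(dist w ?z)\<^sup>2 \<le> (dist w z + dist z ?z)\<^sup>2" by (intro power_mono dist_triangle) auto
  then show "(dist w ?z)\<^sup>2 \<le> 2 * (dist w z)\<^sup>2 + 4" using sq[of "dist w z" "dist z ?z"] dist_lattice_pt[of z] by linarith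
qed

lemma emeasure_lattice_cell: "emeasure lborel {z. lattice_cell z = j} \<ge> 1"
proof -
  have "box (lattice_pt j) (lattice_pt j + Complex 1 1) \<subseteq> {z. lattice_cell z = j}"
    by (auto simp: in_box_complex_iff lattice_pt_def lattice_cell_def floor_unique prod_eq_iff)
  then have "emeasure lborel (box (lattice_pt j) (lattice_pt j + Complex 1 1)) \<le> emeasure lborel {z. lattice_cell z = j}"
    by (intro emeasure_mono) auto
  moreover have "emeasure lborel (box (lattice_pt j) (lattice_pt j + Complex 1 1)) = 1"
    by (subst emeasure_lborel_box) (auto simp: Basis_complex_def lattice_pt_def)
  ultimately show ?thesis by simp
qed

text \<open>Each term is at most a constant times the integral of a wider Gaussian over the unit square
  of \<open>j\<close>, and these squares are disjoint.\<close>
lemma lattice_gaussian_sum_bound: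
  fixes \<beta> :: real
  assumes \<beta>: "\<beta> > 0"
  obtains C :: real where "C > 0"
    "\<And>J \<zeta>. finite J \<Longrightarrow> (\<Sum>j\<in>J. lattice_gauss \<beta> \<zeta> j) \<le> C"
proof -
  obtain G :: real where G: "G > 0" "\<And>\<zeta>. (\<integral>\<^sup>+w. ennreal (exp (- (\<beta> / 2) * (dist (\<zeta>::complex) w)\<^sup>2)) \<partial>lborel) \<le> ennreal G"
    using gaussian_integral_bound[of "\<beta> / 2"] \<beta> by auto
  show thesis
  proof (rule that[of "exp (2 * \<beta>) * G"])
    show "exp (2 * \<beta>) * G > 0" using G by simp
    fix J :: "(int \<times> int) set" and \<zeta> :: complex
    assume J: "finite J"
    define E where "E w = ennreal (exp (2 * \<beta>)) * ennreal (exp (- (\<beta> / 2) * (dist \<zeta> w)\<^sup>2))" for w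
    have [measurable]: "E \<in> borel_measurable borel" unfolding E_def by measurable
    have "ennreal (\<Sum>j\<in>J. lattice_gauss \<beta> \<zeta> j) = (\<Sum>j\<in>J. ennreal (lattice_gauss \<beta> \<zeta> j))"
      by (rule sum_ennreal[symmetric]) simp
    also have "\<dots> \<le> (\<Sum>j\<in>J. \<integral>\<^sup>+w. E w * indicator {z. lattice_cell z = j} w \<partial>lborel)"
    proof (rule sum_mono)
      fix j
      let ?e = "ennreal (lattice_gauss \<beta> \<zeta> j)"
      have "?e * 1 \<le> ?e * emeasure lborel {z. lattice_cell z = j}" by (intro mult_left_mono emeasure_lattice_cell) simp
      also have "\<dots> = (\<integral>\<^sup>+w. ?e * indicator {z. lattice_cell z = j} w \<partial>lborel)"
        by (rule nn_integral_cmult_indicator[symmetric]) simp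
      also have "\<dots> \<le> (\<integral>\<^sup>+w. E w * indicator {z. lattice_cell z = j} w \<partial>lborel)"
      proof (rule nn_integral_mono)
        fix w
        show "?e * indicator {z. lattice_cell z = j} w \<le> E w * indicator {z. lattice_cell z = j} w"
        proof (cases "lattice_cell w = j")
          case True
          have "\<beta> * (dist \<zeta> w)\<^sup>2 \<le> \<beta> * (2 * (dist \<zeta> (lattice_pt j))\<^sup>2 + 4)"
            using dist_sq_le_lattice_pt(1)[of \<zeta> w] \<beta> True by (intro mult_left_mono) auto
          then have "- \<beta> * (dist \<zeta> (lattice_pt j))\<^sup>2 \<le> 2 * \<beta> + - (\<beta> / 2) * (dist \<zeta> w)\<^sup>2" by (simp add: algebra_simps)
          then have "lattice_gauss \<beta> \<zeta> j \<le> exp (2 * \<beta>) * exp (- (\<beta> / 2) * (dist \<zeta> w)\<^sup>2)"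
            unfolding exp_add[symmetric] exp_le_cancel_iff .
          then have "?e \<le> E w" unfolding E_def ennreal_mult'[OF exp_ge_zero, symmetric] by (rule ennreal_leI)
          then show ?thesis by (rule mult_right_mono) simp
        qed simp
      qed
      finally show "?e \<le> (\<integral>\<^sup>+w. E w * indicator {z. lattice_cell z = j} w \<partial>lborel)" by simp
    qed
    also have "\<dots> = (\<integral>\<^sup>+w. (\<Sum>j\<in>J. E w * indicator {z. lattice_cell z = j} w) \<partial>lborel)"
      by (rule nn_integral_sum[symmetric]) measurable
    also have "\<dots> \<le> (\<integral>\<^sup>+w. E w \<partial>lborel)"
    proof (rule nn_integral_mono)
      fix w
      have "(\<Sum>j\<in>J. indicator {z. lattice_cell z = j} w) = (\<Sum>j\<in>J. if j = lattice_cell w then 1 else (0::ennreal))"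
        by (intro sum.cong) (auto split: split_indicator)
      also have "\<dots> \<le> 1" using J by (simp add: sum.delta)
      finally have "E w * (\<Sum>j\<in>J. indicator {z. lattice_cell z = j} w) \<le> E w * 1" by (rule mult_left_mono) simp
      then show "(\<Sum>j\<in>J. E w * indicator {z. lattice_cell z = j} w) \<le> E w" by (simp add: sum_distrib_left)
    qed
    also have "\<dots> = ennreal (exp (2 * \<beta>)) * (\<integral>\<^sup>+w. ennreal (exp (- (\<beta> / 2) * (dist \<zeta> w)\<^sup>2)) \<partial>lborel)"
      unfolding E_def by (rule nn_integral_cmult) measurable
    also have "\<dots> \<le> ennreal (exp (2 * \<beta>)) * ennreal G" by (intro mult_left_mono G) simp
    also have "\<dots> = ennreal (exp (2 * \<beta>) * G)" by (simp add: ennreal_mult')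
    finally show "(\<Sum>j\<in>J. lattice_gauss \<beta> \<zeta> j) \<le> exp (2 * \<beta>) * G"
      using G by (subst (asm) ennreal_le_iff) auto
  qed
qed

lemma powr_sum_le_sum_powr:
  fixes x :: "'a \<Rightarrow> real"
  assumes "finite J" "0 < s" "s \<le> 1" "\<And>j. 0 \<le> x j"
  shows "(\<Sum>j\<in>J. x j) powr s \<le> (\<Sum>j\<in>J. x j powr s)"
  using assms(1)
proof (induction J rule: finite_induct)
  case (insert j J)
  have "(x j + (\<Sum>j\<in>J. x j)) powr s \<le> x j powr s + (\<Sum>j\<in>J. x j) powr s"
    using assms by (intro powr_add_le_add_powr sum_nonneg) auto
  then show ?case using insert by simp
qed simp

text \<open>Jensen's inequality up to a constant, by \<open>le_add_powr_mult_powr\<close> with \<open>t = x / (2 * E)\<close>, where \<open>x\<close> is the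
  sum on the left.\<close>
lemma powr_weighted_sum_le:
  fixes a e :: "'a \<Rightarrow> real" and E s :: real
  assumes J: "finite J" and s: "1 \<le> s" and a: "\<And>j. 0 \<le> a j" and e: "\<And>j. 0 \<le> e j"
    and E: "(\<Sum>j\<in>J. e j) \<le> E" "E > 0"
  shows "(\<Sum>j\<in>J. a j * e j) powr s \<le> (2 * E) powr s / E * (\<Sum>j\<in>J. a j powr s * e j)"
proof -
  define x where "x = (\<Sum>j\<in>J. a j * e j)"
  define Y where "Y = (\<Sum>j\<in>J. a j powr s * e j)"
  have x0: "x \<ge> 0" and Y0: "Y \<ge> 0" using a e by (auto simp: x_def Y_def intro!: sum_nonneg)
  show ?thesis
  proof (cases "x = 0")
    case True
    then show ?thesis using Y0 E by (simp flip: x_def Y_def)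
  next
    case False
    define t where "t = x / (2 * E)"
    have t: "t > 0" using False x0 E by (simp add: t_def)
    have tE: "t * E = x / 2" using E by (simp add: t_def)
    have "x \<le> (\<Sum>j\<in>J. (t + a j powr s * t powr (1 - s)) * e j)"
      unfolding x_def using a e s t by (intro sum_mono mult_right_mono le_add_powr_mult_powr) auto
    also have "\<dots> = (\<Sum>j\<in>J. t * e j + t powr (1 - s) * (a j powr s * e j))"
      by (intro sum.cong refl) (simp add: algebra_simps)
    also have "\<dots> = t * (\<Sum>j\<in>J. e j) + t powr (1 - s) * Y"
      by (simp add: Y_def sum_distrib_left sum.distrib)
    also have "\<dots> \<le> t * E + t powr (1 - s) * Y" using E t by (intro add_right_mono mult_left_mono) auto
    finally have "t * E \<le> t powr (1 - s) * Y" using tE by linarith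
    then have "t * E * t powr (s - 1) \<le> t powr (1 - s) * Y * t powr (s - 1)" by (rule mult_right_mono) simp
    also have "t powr (1 - s) * Y * t powr (s - 1) = Y" using t by (simp add: mult_ac flip: powr_add)
    also have "t * E * t powr (s - 1) = t powr s * E" using t by (simp add: powr_diff)
    finally have "t powr s \<le> Y / E" using E by (simp add: field_simps)
    then have "(2 * E) powr s * t powr s \<le> (2 * E) powr s * (Y / E)" by (rule mult_left_mono) simp
    moreover have "x = 2 * E * t" using E by (simp add: t_def)
    ultimately have "x powr s \<le> (2 * E) powr s * (Y / E)" by (simp add: powr_mult)
    then show ?thesis by (simp add: x_def Y_def)
  qed
qed

text \<open>For \<open>s \<ge> 1\<close> the power goes inside by Jensen's inequality, since the Gaussians sum to a bounded
  function; for \<open>s < 1\<close> it does by subadditivity. In both cases the Gaussians are then integrated one by one.\<close>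
lemma lattice_superposition_bound:
  fixes \<beta> s :: real
  assumes \<beta>: "\<beta> > 0" and s: "s > 0"
  obtains C :: real where "C > 0"
    "\<And>J a. finite J \<Longrightarrow> (\<And>j. 0 \<le> a j) \<Longrightarrow>
       (\<integral>\<^sup>+\<zeta>. ennreal ((\<Sum>j\<in>J. a j * lattice_gauss \<beta> \<zeta> j) powr s) \<partial>lborel) \<le> ennreal (C * (\<Sum>j\<in>J. a j powr s))"
proof -
  note result = that
  have *: thesis if \<gamma>: "\<gamma> > 0" and D: "D > 0"
    and pt: "\<And>J a \<zeta>. finite J \<Longrightarrow> (\<And>j. 0 \<le> a j) \<Longrightarrow>
       (\<Sum>j\<in>J. a j * lattice_gauss \<beta> \<zeta> j) powr s \<le> D * (\<Sum>j\<in>J. a j powr s * lattice_gauss \<gamma> \<zeta> j)"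
    for \<gamma> D :: real
  proof -
    obtain G :: real where G: "G > 0" "\<And>\<zeta>. (\<integral>\<^sup>+w. ennreal (exp (- \<gamma> * (dist (\<zeta>::complex) w)\<^sup>2)) \<partial>lborel) \<le> ennreal G"
      using gaussian_integral_bound[OF \<gamma>] by blast
    show thesis
    proof (rule result[of "D * G"])
      show "D * G > 0" using D G by simp
      fix J :: "(int \<times> int) set" and a :: "int \<times> int \<Rightarrow> real"
      assume J: "finite J" and a: "\<And>j. 0 \<le> a j"
      have "(\<integral>\<^sup>+\<zeta>. ennreal ((\<Sum>j\<in>J. a j * lattice_gauss \<beta> \<zeta> j) powr s) \<partial>lborel)
        \<le> (\<integral>\<^sup>+\<zeta>. (\<Sum>j\<in>J. ennreal (D * a j powr s) * ennreal (exp (- \<gamma> * (dist (lattice_pt j) \<zeta>)\<^sup>2))) \<partial>lborel)"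
      proof (rule nn_integral_mono)
        fix \<zeta>
        have "ennreal ((\<Sum>j\<in>J. a j * lattice_gauss \<beta> \<zeta> j) powr s) \<le> ennreal (D * (\<Sum>j\<in>J. a j powr s * lattice_gauss \<gamma> \<zeta> j))"
          using pt[OF J a] by (rule ennreal_leI)
        also have "\<dots> = ennreal (\<Sum>j\<in>J. D * a j powr s * exp (- \<gamma> * (dist (lattice_pt j) \<zeta>)\<^sup>2))"
          by (simp add: sum_distrib_left mult.assoc dist_commute)
        also have "\<dots> = (\<Sum>j\<in>J. ennreal (D * a j powr s * exp (- \<gamma> * (dist (lattice_pt j) \<zeta>)\<^sup>2)))"
          using D by (intro sum_ennreal[symmetric]) simp
        also have "\<dots> = (\<Sum>j\<in>J. ennreal (D * a j powr s) * ennreal (exp (- \<gamma> * (dist (lattice_pt j) \<zeta>)\<^sup>2)))"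
          using D by (intro sum.cong refl ennreal_mult) auto
        finally show "ennreal ((\<Sum>j\<in>J. a j * lattice_gauss \<beta> \<zeta> j) powr s)
           \<le> (\<Sum>j\<in>J. ennreal (D * a j powr s) * ennreal (exp (- \<gamma> * (dist (lattice_pt j) \<zeta>)\<^sup>2)))" .
      qed
      also have "\<dots> = (\<Sum>j\<in>J. ennreal (D * a j powr s) * (\<integral>\<^sup>+\<zeta>. ennreal (exp (- \<gamma> * (dist (lattice_pt j) \<zeta>)\<^sup>2)) \<partial>lborel))"
        by (subst nn_integral_sum) (auto simp: nn_integral_cmult)
      also have "\<dots> \<le> (\<Sum>j\<in>J. ennreal (D * a j powr s) * ennreal G)"
        by (intro sum_mono mult_left_mono G) simp
      also have "\<dots> = (\<Sum>j\<in>J. ennreal (D * a j powr s * G))"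
        using G D by (intro sum.cong refl ennreal_mult[symmetric]) auto
      also have "\<dots> = ennreal (\<Sum>j\<in>J. D * a j powr s * G)" using G D by (intro sum_ennreal) simp
      also have "(\<Sum>j\<in>J. D * a j powr s * G) = D * G * (\<Sum>j\<in>J. a j powr s)" by (simp add: sum_distrib_left mult_ac)
      finally show "(\<integral>\<^sup>+\<zeta>. ennreal ((\<Sum>j\<in>J. a j * lattice_gauss \<beta> \<zeta> j) powr s) \<partial>lborel) \<le> ennreal (D * G * (\<Sum>j\<in>J. a j powr s))" .
    qed
  qed
  show thesis
  proof (cases "s \<ge> 1")
    case True
    obtain E :: real where E: "E > 0" "\<And>J \<zeta>. finite J \<Longrightarrow> (\<Sum>j\<in>J. lattice_gauss \<beta> \<zeta> j) \<le> E"
      using lattice_gaussian_sum_bound[OF \<beta>] by blast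
    show thesis
    proof (rule *[OF \<beta>])
      show "(\<Sum>j\<in>J. a j * lattice_gauss \<beta> \<zeta> j) powr s
          \<le> (2 * E) powr s / E * (\<Sum>j\<in>J. a j powr s * lattice_gauss \<beta> \<zeta> j)"
        if "finite J" "\<And>j. 0 \<le> a j" for J a \<zeta>
        using that by (intro powr_weighted_sum_le True E) auto
    qed (use E in simp)
  next
    case False
    show thesis
    proof (rule *[where \<gamma> = "\<beta> * s" and D = 1])
      fix J :: "(int \<times> int) set" and a :: "int \<times> int \<Rightarrow> real" and \<zeta>
      assume J: "finite J" and a: "\<And>j. 0 \<le> a j"
      have "(\<Sum>j\<in>J. a j * lattice_gauss \<beta> \<zeta> j) powr s \<le> (\<Sum>j\<in>J. (a j * lattice_gauss \<beta> \<zeta> j) powr s)"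
        using J s False a by (intro powr_sum_le_sum_powr) auto
      also have "\<dots> = (\<Sum>j\<in>J. a j powr s * exp (- (\<beta> * s) * (dist \<zeta> (lattice_pt j))\<^sup>2))"
        by (intro sum.cong refl) (simp add: powr_mult exp_powr_real mult_ac)
      finally show "(\<Sum>j\<in>J. a j * lattice_gauss \<beta> \<zeta> j) powr s \<le> 1 * (\<Sum>j\<in>J. a j powr s * exp (- (\<beta> * s) * (dist \<zeta> (lattice_pt j))\<^sup>2))"
        by simp
    qed (use \<beta> s in auto)
  qed
qed

section \<open>Testing the operator on sums of kernels\<close>

text \<open>The sums over \<open>S\<close> and over \<open>insert i S\<close> differ by \<open>a i\<close>, so one of them has modulus at least
  half of that of \<open>a i\<close>. This elementary averaging suffices here in place of Khinchine's inequality,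
  because at each point a single term of the sum is needed.\<close>
lemma sum_norm_powr_subset_sums:
  fixes a :: "'a \<Rightarrow> complex" and q :: real
  assumes J: "finite J" and i: "i \<in> J" and q: "0 < q"
  shows "2 ^ card J * ((norm (a i) / 2) powr q / 2) \<le> (\<Sum>S\<in>Pow J. norm (\<Sum>j\<in>S. a j) powr q)"
proof -
  define J' where "J' = J - {i}"
  have J': "finite J'" "i \<notin> J'" "J = insert i J'" using J i by (auto simp: J'_def)
  have pow: "Pow J = Pow J' \<union> insert i ` Pow J'" unfolding J'(3) by (rule Pow_insert)
  have inj: "inj_on (insert i) (Pow J')" using J'(2) by (auto simp: inj_on_def)
  have card: "2 ^ card J = 2 * (2::real) ^ card J'" using J' by simp
  have "2 ^ card J * ((norm (a i) / 2) powr q / 2) = (\<Sum>S\<in>Pow J'. (norm (a i) / 2) powr q)"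
    using J' by (simp add: card card_Pow)
  also have "\<dots> \<le> (\<Sum>S\<in>Pow J'. norm (\<Sum>j\<in>S. a j) powr q + norm (\<Sum>j\<in>insert i S. a j) powr q)"
  proof (rule sum_mono)
    fix S assume S: "S \<in> Pow J'"
    then have fS: "finite S" "i \<notin> S" using J' by (auto intro: finite_subset)
    let ?x = "\<Sum>j\<in>S. a j"
    have ins: "(\<Sum>j\<in>insert i S. a j) = a i + ?x" using fS by simp
    have "norm (a i) \<le> norm (a i + ?x) + norm ?x" using norm_triangle_ineq4[of "a i + ?x" ?x] by simp
    then consider "norm (a i) / 2 \<le> norm ?x" | "norm (a i) / 2 \<le> norm (a i + ?x)" by linarith
    then show "(norm (a i) / 2) powr q \<le> norm ?x powr q + norm (\<Sum>j\<in>insert i S. a j) powr q"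
    proof cases
      case 1
      then have "(norm (a i) / 2) powr q \<le> norm ?x powr q" using q by (intro powr_mono2) auto
      then show ?thesis by (simp add: add_increasing2)
    next
      case 2
      then have "(norm (a i) / 2) powr q \<le> norm (a i + ?x) powr q" using q by (intro powr_mono2) auto
      then show ?thesis unfolding ins by (simp add: add_increasing)
    qed
  qed
  also have "\<dots> = (\<Sum>S\<in>Pow J'. norm (\<Sum>j\<in>S. a j) powr q) + (\<Sum>S\<in>insert i ` Pow J'. norm (\<Sum>j\<in>S. a j) powr q)"
    using inj by (simp add: sum.distrib sum.reindex)
  also have "\<dots> = (\<Sum>S\<in>Pow J. norm (\<Sum>j\<in>S. a j) powr q)"
    unfolding pow using J' by (intro sum.union_disjoint[symmetric]) auto
  finally show ?thesis .
qed

text \<open>The reproducing kernel at \<open>a\<close> of the Fock space with \<open>p = 2\<close>, normalised. Multiplied by the weight, its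
  modulus is a Gaussian centred at \<open>a\<close>.\<close>
definition fock_kernel :: "real \<Rightarrow> complex \<Rightarrow> complex \<Rightarrow> complex" where
  "fock_kernel \<alpha> a z = exp (of_real \<alpha> * z * cnj a - of_real (\<alpha> / 2 * (norm a)\<^sup>2))"

abbreviation kernel_sum :: "real \<Rightarrow> (int \<times> int \<Rightarrow> real) \<Rightarrow> (int \<times> int) set \<Rightarrow> complex \<Rightarrow> complex" where
  "kernel_sum \<alpha> a S z \<equiv> (\<Sum>j\<in>S. of_real (a j) * fock_kernel \<alpha> (lattice_pt j) z)"

lemma fock_kernel_holomorphic: "fock_kernel \<alpha> a holomorphic_on UNIV"
  unfolding fock_kernel_def[abs_def] by (intro holomorphic_intros)

lemma norm_fock_kernel:
  "norm (fock_kernel \<alpha> a z) * exp (- (\<alpha> / 2) * (norm z)\<^sup>2) = exp (- (\<alpha> / 2) * (dist z a)\<^sup>2)"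
proof -
  have "norm (fock_kernel \<alpha> a z) = exp (\<alpha> * Re (z * cnj a) - \<alpha> / 2 * (norm a)\<^sup>2)"
    by (simp add: fock_kernel_def mult.assoc)
  then have "norm (fock_kernel \<alpha> a z) * exp (- (\<alpha> / 2) * (norm z)\<^sup>2) = exp (\<alpha> * Re (z * cnj a) - \<alpha> / 2 * (norm a)\<^sup>2 + - (\<alpha> / 2) * (norm z)\<^sup>2)"
    by (simp only: exp_add)
  also have "\<alpha> * Re (z * cnj a) - \<alpha> / 2 * (norm a)\<^sup>2 + - (\<alpha> / 2) * (norm z)\<^sup>2 = - (\<alpha> / 2) * (dist z a)\<^sup>2"
    unfolding dist_norm norm_diff_sq_complex by (simp add: algebra_simps)
  finally show ?thesis .
qed

lemma fock_mass_kernel_sum_bound: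
  fixes p \<alpha> :: real
  assumes p: "0 < p" and \<alpha>: "0 < \<alpha>"
  obtains C :: real where "C > 0"
    "\<And>J S a. finite J \<Longrightarrow> S \<subseteq> J \<Longrightarrow> (\<And>j. 0 \<le> a j) \<Longrightarrow>
       fock_mass p \<alpha> (kernel_sum \<alpha> a S) \<le> ennreal (C * (\<Sum>j\<in>J. a j powr p))"
proof -
  obtain C :: real where C: "C > 0" and sup: "\<And>J a. finite J \<Longrightarrow> (\<And>j. 0 \<le> a j) \<Longrightarrow>
       (\<integral>\<^sup>+\<zeta>. ennreal ((\<Sum>j\<in>J. a j * lattice_gauss (\<alpha> / 2) \<zeta> j) powr p) \<partial>lborel) \<le> ennreal (C * (\<Sum>j\<in>J. a j powr p))"
    using lattice_superposition_bound[of "\<alpha> / 2" p] \<alpha> p by auto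
  show thesis
  proof (rule that[OF C])
    fix J S :: "(int \<times> int) set" and a :: "int \<times> int \<Rightarrow> real"
    assume J: "finite J" and S: "S \<subseteq> J" and a: "\<And>j. 0 \<le> a j"
    have "fock_mass p \<alpha> (kernel_sum \<alpha> a S)
      \<le> (\<integral>\<^sup>+\<zeta>. ennreal ((\<Sum>j\<in>J. a j * lattice_gauss (\<alpha> / 2) \<zeta> j) powr p) \<partial>lborel)"
      unfolding fock_mass_def fock_weight_powr[OF norm_ge_zero]
    proof (intro nn_integral_mono ennreal_leI powr_mono2)
      fix \<zeta> :: complex
      have "norm (kernel_sum \<alpha> a S \<zeta>) \<le> (\<Sum>j\<in>S. a j * norm (fock_kernel \<alpha> (lattice_pt j) \<zeta>))"
        by (rule order_trans[OF norm_sum]) (simp add: norm_mult a)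
      also have "\<dots> \<le> (\<Sum>j\<in>J. a j * norm (fock_kernel \<alpha> (lattice_pt j) \<zeta>))"
        using J S a by (intro sum_mono2) auto
      finally have "norm (kernel_sum \<alpha> a S \<zeta>) * exp (- (\<alpha> / 2) * (norm \<zeta>)\<^sup>2)
         \<le> (\<Sum>j\<in>J. a j * norm (fock_kernel \<alpha> (lattice_pt j) \<zeta>)) * exp (- (\<alpha> / 2) * (norm \<zeta>)\<^sup>2)" by (rule mult_right_mono) simp
      also have "\<dots> = (\<Sum>j\<in>J. a j * lattice_gauss (\<alpha> / 2) \<zeta> j)"
        by (simp only: sum_distrib_right mult.assoc norm_fock_kernel)
      finally show "norm (kernel_sum \<alpha> a S \<zeta>) * exp (- (\<alpha> / 2) * (norm \<zeta>)\<^sup>2)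
         \<le> (\<Sum>j\<in>J. a j * lattice_gauss (\<alpha> / 2) \<zeta> j)" .
    qed (use p in auto)
    also have "\<dots> \<le> ennreal (C * (\<Sum>j\<in>J. a j powr p))" by (rule sup[OF J a])
    finally show "fock_mass p \<alpha> (kernel_sum \<alpha> a S) \<le> ennreal (C * (\<Sum>j\<in>J. a j powr p))" .
  qed
qed

text \<open>The norm bound and the Littlewood--Paley equivalence, rewritten in terms of integrals.\<close>
lemma embedding_mass_le_of_norm_bound:
  fixes p q \<alpha> :: real
  assumes p: "0 < p" and q: "0 < q" and \<alpha>: "0 < \<alpha>"
  obtains C :: real where "C > 0"
    "\<And>f g \<psi> K m. \<lbrakk>g holomorphic_on UNIV; \<psi> holomorphic_on UNIV; f holomorphic_on UNIV; 0 \<le> K; 0 \<le> m;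
       \<And>u. u \<in> fock_space p \<alpha> \<Longrightarrow> fock_norm q \<alpha> (volterra_comp g \<psi> u) \<le> ennreal K * fock_norm p \<alpha> u;
       fock_mass p \<alpha> f \<le> ennreal m\<rbrakk> \<Longrightarrow> embedding_mass q \<alpha> \<psi> g f \<le> ennreal (C * K powr q * m powr (q / p))"
proof -
  obtain C2 :: real where C2: "C2 > 0" and equiv:
    "\<And>f g \<psi>. \<lbrakk>f holomorphic_on UNIV; g holomorphic_on UNIV; \<psi> holomorphic_on UNIV\<rbrakk> \<Longrightarrow>
       embedding_mass q \<alpha> \<psi> g f \<le> ennreal C2 * fock_mass q \<alpha> (volterra_comp g \<psi> f)"
    using volterra_mass_equiv_embedding_mass[OF q \<alpha>] by metis
  define kp where "kp = p * \<alpha> / (2 * pi)"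
  define kq where "kq = q * \<alpha> / (2 * pi)"
  have k: "kp > 0" "kq > 0" using p q \<alpha> by (simp_all add: kp_def kq_def)
  show thesis
  proof (rule that[of "C2 * kp powr (q / p) / kq"])
    show "C2 * kp powr (q / p) / kq > 0" using C2 k by simp
    fix f g \<psi> :: "complex \<Rightarrow> complex" and K m :: real
    assume g: "g holomorphic_on UNIV" and \<psi>: "\<psi> holomorphic_on UNIV" and f: "f holomorphic_on UNIV"
      and K: "0 \<le> K" and m: "0 \<le> m"
      and bd: "\<And>u. u \<in> fock_space p \<alpha> \<Longrightarrow> fock_norm q \<alpha> (volterra_comp g \<psi> u) \<le> ennreal K * fock_norm p \<alpha> u"
      and mass: "fock_mass p \<alpha> f \<le> ennreal m"
    have "fock_mass p \<alpha> f < \<infinity>" using mass by (rule le_less_trans) simp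
    then have fp: "f \<in> fock_space p \<alpha>" using f by (simp add: fock_space_iff_mass[OF p \<alpha>])
    have "ennreal kp * fock_mass p \<alpha> f \<le> ennreal kp * ennreal m" by (intro mult_left_mono mass) simp
    also have "\<dots> = epowr (ennreal ((kp * m) powr (1 / p))) p"
      using k m p by (simp add: epowr_ennreal powr_powr ennreal_mult')
    finally have "fock_norm p \<alpha> f \<le> ennreal ((kp * m) powr (1 / p))"
      unfolding kp_def by (simp add: fock_norm_le_iff[OF p])
    then have "ennreal K * fock_norm p \<alpha> f \<le> ennreal K * ennreal ((kp * m) powr (1 / p))"
      by (rule mult_left_mono) simp
    with bd[OF fp] have "fock_norm q \<alpha> (volterra_comp g \<psi> f) \<le> ennreal (K * (kp * m) powr (1 / p))"
      using K by (simp add: ennreal_mult')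
    then have "ennreal kq * fock_mass q \<alpha> (volterra_comp g \<psi> f) \<le> epowr (ennreal (K * (kp * m) powr (1 / p))) q"
      unfolding kq_def by (simp add: fock_norm_le_iff[OF q])
    also have "\<dots> = ennreal (K powr q * (kp powr (q / p) * m powr (q / p)))"
      using K by (simp add: epowr_ennreal powr_mult powr_powr)
    finally have "ennreal (C2 / kq) * (ennreal kq * fock_mass q \<alpha> (volterra_comp g \<psi> f)) \<le> ennreal (C2 / kq) * ennreal (K powr q * (kp powr (q / p) * m powr (q / p)))"
      by (rule mult_left_mono) simp
    also have "\<dots> = ennreal (C2 / kq * (K powr q * (kp powr (q / p) * m powr (q / p))))"
      using C2 k by (intro ennreal_mult'[symmetric]) simp
    also have "C2 / kq * (K powr q * (kp powr (q / p) * m powr (q / p))) = C2 * kp powr (q / p) / kq * K powr q * m powr (q / p)"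
      by simp
    also have "ennreal (C2 / kq) * (ennreal kq * fock_mass q \<alpha> (volterra_comp g \<psi> f)) = ennreal C2 * fock_mass q \<alpha> (volterra_comp g \<psi> f)"
      using C2 k by (simp flip: mult.assoc ennreal_mult')
    finally show "embedding_mass q \<alpha> \<psi> g f \<le> ennreal (C2 * kp powr (q / p) / kq * K powr q * m powr (q / p))"
      using equiv[OF f g \<psi>] by (rule order_trans[rotated])
  qed
qed

text \<open>The mass that the image of \<open>carleson_density\<close> under \<open>\<psi>\<close> gives to the unit square of \<open>j\<close>.\<close>
definition cell_mass :: "real \<Rightarrow> real \<Rightarrow> (complex \<Rightarrow> complex) \<Rightarrow> (complex \<Rightarrow> complex) \<Rightarrow> int \<times> int \<Rightarrow> ennreal" where
  "cell_mass q \<alpha> \<psi> g j = (\<integral>\<^sup>+z. ennreal (carleson_density q \<alpha> \<psi> g z) * indicator {w. lattice_cell w = j} (\<psi> z) \<partial>lborel)"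

text \<open>Sum the hypothesis over all \<open>S \<subseteq> J\<close>. At a point \<open>z\<close> with \<open>\<psi> z\<close> in the unit square of \<open>i\<close>, the
  averaging argument retains the term of index \<open>i\<close>, whose kernel is bounded below on that square.\<close>
lemma sum_cell_mass_le_embedding_mass:
  fixes q \<alpha> :: real
  assumes q: "0 < q" and \<alpha>: "0 < \<alpha>" and g: "g holomorphic_on UNIV" and \<psi>: "\<psi> holomorphic_on UNIV"
    and J: "finite J" and a: "\<And>j. 0 \<le> a j"
    and bd: "\<And>S. S \<subseteq> J \<Longrightarrow> embedding_mass q \<alpha> \<psi> g (kernel_sum \<alpha> a S) \<le> ennreal M"
    and M: "0 \<le> M"
  shows "(\<Sum>j\<in>J. ennreal (a j powr q) * cell_mass q \<alpha> \<psi> g j) \<le> ennreal (2 * 2 powr q * exp (q * \<alpha>) * M)"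
proof -
  define c where "c = q * \<alpha> / 2"
  have c: "c > 0" using q \<alpha> by (simp add: c_def)
  define D where "D z = carleson_density q \<alpha> \<psi> g z" for z
  have D0: "D z \<ge> 0" for z by (simp add: D_def)
  define F where "F S z = (\<Sum>j\<in>S. of_real (a j) * fock_kernel \<alpha> (lattice_pt j) z)" for S z
  have [measurable]: "D \<in> borel_measurable borel" "\<psi> \<in> borel_measurable borel"
    using carleson_density_measurable[OF g \<psi>] \<psi> by (auto simp: D_def[abs_def] intro: entire_measurable)
  have [measurable]: "F S \<in> borel_measurable borel" for S
    unfolding F_def using fock_kernel_holomorphic
    by (intro entire_measurable holomorphic_intros)
  define L where "L = 2 ^ card J * (exp (- (2 * c)) * (2 powr (- q) / 2))"
  have L: "L > 0" by (simp add: L_def)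
  have pt: "ennreal L * (\<Sum>j\<in>J. ennreal (a j powr q) * (ennreal (D z) * indicator {w. lattice_cell w = j} (\<psi> z)))
     \<le> (\<Sum>S\<in>Pow J. ennreal (D z) * ennreal (norm (F S (\<psi> z)) powr q * exp (- c * (norm (\<psi> z))\<^sup>2)))" for z
  proof -
    define i where "i = lattice_cell (\<psi> z)"
    define e where "e = exp (- c * (norm (\<psi> z))\<^sup>2)"
    have R: "(\<Sum>S\<in>Pow J. ennreal (D z) * ennreal (norm (F S (\<psi> z)) powr q * e)) = ennreal (D z * ((\<Sum>S\<in>Pow J. norm (F S (\<psi> z)) powr q) * e))"
      using D0[of z] by (simp add: e_def sum_distrib_left sum_distrib_right sum_ennreal flip: ennreal_mult')
    show ?thesis
    proof (cases "i \<in> J")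
      case False
      then have "(\<Sum>j\<in>J. ennreal (a j powr q) * (ennreal (D z) * indicator {w. lattice_cell w = j} (\<psi> z))) = 0"
        by (intro sum.neutral) (auto simp: i_def indicator_def)
      then show ?thesis by simp
    next
      case True
      have "(\<Sum>j\<in>J. ennreal (a j powr q) * (ennreal (D z) * indicator {w. lattice_cell w = j} (\<psi> z)))
         = (\<Sum>j\<in>J. if j = i then ennreal (a i powr q) * ennreal (D z) else 0)"
        by (intro sum.cong refl) (auto simp: i_def)
      also have "\<dots> = ennreal (a i powr q * D z)" using True J by (simp add: ennreal_mult')
      finally have "ennreal L * (\<Sum>j\<in>J. ennreal (a j powr q) * (ennreal (D z) * indicator {w. lattice_cell w = j} (\<psi> z)))
         = ennreal (L * (a i powr q * D z))" using L by (simp add: ennreal_mult')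
      also have "\<dots> \<le> ennreal (D z * ((\<Sum>S\<in>Pow J. norm (F S (\<psi> z)) powr q) * e))"
      proof (rule ennreal_leI)
        let ?x = "norm (fock_kernel \<alpha> (lattice_pt i) (\<psi> z))"
        have "c * (dist (\<psi> z) (lattice_pt i))\<^sup>2 \<le> c * 2" using dist_lattice_pt[of "\<psi> z"] c by (intro mult_left_mono) (auto simp: i_def)
        then have "exp (- (2 * c)) \<le> exp (- c * (dist (\<psi> z) (lattice_pt i))\<^sup>2)" by simp
        also have "\<dots> = (?x * exp (- (\<alpha> / 2) * (norm (\<psi> z))\<^sup>2)) powr q"
          unfolding norm_fock_kernel by (simp add: exp_powr_real c_def mult_ac)
        also have "\<dots> = ?x powr q * e"
          unfolding e_def c_def by (rule fock_weight_powr[symmetric]) simp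
        finally have "exp (- (2 * c)) \<le> ?x powr q * e" .
        then have "2 ^ card J * (2 powr (- q) / 2) * a i powr q * exp (- (2 * c)) \<le> 2 ^ card J * (2 powr (- q) / 2) * a i powr q * (?x powr q * e)"
          by (rule mult_left_mono) simp
        also have "\<dots> = 2 ^ card J * ((norm (of_real (a i) * fock_kernel \<alpha> (lattice_pt i) (\<psi> z)) / 2) powr q / 2) * e"
          using a[of i] by (simp add: norm_mult powr_mult powr_divide powr_minus field_simps)
        also have "\<dots> \<le> (\<Sum>S\<in>Pow J. norm (F S (\<psi> z)) powr q) * e"
          unfolding F_def using sum_norm_powr_subset_sums[OF J True q, of "\<lambda>j. of_real (a j) * fock_kernel \<alpha> (lattice_pt j) (\<psi> z)"]
          by (intro mult_right_mono) (auto simp: e_def)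
        finally have "D z * (2 ^ card J * (2 powr (- q) / 2) * a i powr q * exp (- (2 * c))) \<le> D z * ((\<Sum>S\<in>Pow J. norm (F S (\<psi> z)) powr q) * e)"
          using D0 by (rule mult_left_mono)
        then show "L * (a i powr q * D z) \<le> D z * ((\<Sum>S\<in>Pow J. norm (F S (\<psi> z)) powr q) * e)"
          by (simp add: L_def mult_ac)
      qed
      finally show ?thesis unfolding e_def[symmetric] R .
    qed
  qed
  have "ennreal L * (\<Sum>j\<in>J. ennreal (a j powr q) * cell_mass q \<alpha> \<psi> g j)
     = (\<integral>\<^sup>+z. ennreal L * (\<Sum>j\<in>J. ennreal (a j powr q) * (ennreal (D z) * indicator {w. lattice_cell w = j} (\<psi> z))) \<partial>lborel)"
    unfolding cell_mass_def D_def[symmetric] by (simp add: nn_integral_cmult nn_integral_sum)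
  also have "\<dots> \<le> (\<integral>\<^sup>+z. (\<Sum>S\<in>Pow J. ennreal (D z) * ennreal (norm (F S (\<psi> z)) powr q * exp (- c * (norm (\<psi> z))\<^sup>2))) \<partial>lborel)"
    by (intro nn_integral_mono pt)
  also have "\<dots> = (\<Sum>S\<in>Pow J. embedding_mass q \<alpha> \<psi> g (F S))"
    unfolding embedding_mass_def D_def[symmetric] c_def[symmetric] by (rule nn_integral_sum) measurable
  also have "\<dots> \<le> (\<Sum>S\<in>Pow J. ennreal M)" unfolding F_def by (intro sum_mono bd) auto
  also have "\<dots> = ennreal (\<Sum>S\<in>Pow J. M)" using M by (intro sum_ennreal)
  also have "(\<Sum>S\<in>Pow J. M) = 2 ^ card J * M" using J by (simp add: card_Pow)
  finally have "ennreal (1 / L) * (ennreal L * (\<Sum>j\<in>J. ennreal (a j powr q) * cell_mass q \<alpha> \<psi> g j)) \<le> ennreal (1 / L) * ennreal (2 ^ card J * M)"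
    by (rule mult_left_mono) simp
  also have "ennreal (1 / L) * (ennreal L * (\<Sum>j\<in>J. ennreal (a j powr q) * cell_mass q \<alpha> \<psi> g j)) = (\<Sum>j\<in>J. ennreal (a j powr q) * cell_mass q \<alpha> \<psi> g j)"
    using L by (simp flip: mult.assoc ennreal_mult')
  also have "ennreal (1 / L) * ennreal (2 ^ card J * M) = ennreal (1 / L * (2 ^ card J * M))"
    using L by (intro ennreal_mult'[symmetric]) simp
  also have "1 / L * (2 ^ card J * M) = 2 * 2 powr q * exp (q * \<alpha>) * M"
    by (simp add: L_def c_def exp_minus powr_minus field_simps)
  finally show ?thesis .
qed

lemma le_powr_of_le_mult_powr:
  fixes X Y p q :: real
  assumes "0 \<le> X" "0 < q" "q < p" "X \<le> Y * X powr (q / p)"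
  shows "X \<le> Y powr (p / (p - q))"
proof (cases "X = 0")
  case False
  then have X: "X > 0" using assms by simp
  have "X powr ((p - q) / p) * X powr (q / p) = X"
    using X assms by (simp add: diff_divide_distrib flip: powr_add)
  then have "X powr ((p - q) / p) * X powr (q / p) \<le> Y * X powr (q / p)" using assms by simp
  then have "X powr ((p - q) / p) \<le> Y" using X by (simp add: mult_le_cancel_right)
  then have "(X powr ((p - q) / p)) powr (p / (p - q)) \<le> Y powr (p / (p - q))"
    using assms by (intro powr_mono2) auto
  then show ?thesis using X assms by (simp add: powr_powr)
qed simp

text \<open>Testing with \<open>a j = m j powr (1 / (p - q))\<close>, where \<open>m j\<close> is the mass of the square of \<open>j\<close>, makes both
  \<open>a j powr q * m j\<close> and \<open>a j powr p\<close> equal to \<open>m j powr (p / (p - q))\<close>. Their sum \<open>X\<close> then satisfies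
  \<open>X \<le> Y * X powr (q / p)\<close>, which can be solved for \<open>X\<close>. A single kernel already shows that each
  mass is finite.\<close>
lemma sum_cell_mass_powr_bound:
  fixes p q \<alpha> :: real
  assumes q: "0 < q" and qp: "q < p" and \<alpha>: "0 < \<alpha>"
  obtains C :: real where "C > 0"
    "\<And>g \<psi> K j. \<lbrakk>g holomorphic_on UNIV; \<psi> holomorphic_on UNIV; 0 \<le> K;
       \<And>u. u \<in> fock_space p \<alpha> \<Longrightarrow> fock_norm q \<alpha> (volterra_comp g \<psi> u) \<le> ennreal K * fock_norm p \<alpha> u\<rbrakk> \<Longrightarrow>
       cell_mass q \<alpha> \<psi> g j < \<infinity>"
    "\<And>g \<psi> K J. \<lbrakk>g holomorphic_on UNIV; \<psi> holomorphic_on UNIV; 0 \<le> K;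
       \<And>u. u \<in> fock_space p \<alpha> \<Longrightarrow> fock_norm q \<alpha> (volterra_comp g \<psi> u) \<le> ennreal K * fock_norm p \<alpha> u; finite J\<rbrakk> \<Longrightarrow>
       (\<Sum>j\<in>J. enn2real (cell_mass q \<alpha> \<psi> g j) powr (p / (p - q))) \<le> (C * K powr q) powr (p / (p - q))"
proof -
  have p: "p > 0" using q qp by simp
  obtain C1 :: real where C1: "C1 > 0" and emb:
    "\<And>f g \<psi> K m. \<lbrakk>g holomorphic_on UNIV; \<psi> holomorphic_on UNIV; f holomorphic_on UNIV; 0 \<le> K; 0 \<le> m;
       \<And>u. u \<in> fock_space p \<alpha> \<Longrightarrow> fock_norm q \<alpha> (volterra_comp g \<psi> u) \<le> ennreal K * fock_norm p \<alpha> u;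
       fock_mass p \<alpha> f \<le> ennreal m\<rbrakk> \<Longrightarrow> embedding_mass q \<alpha> \<psi> g f \<le> ennreal (C1 * K powr q * m powr (q / p))"
    using embedding_mass_le_of_norm_bound[OF p q \<alpha>] by blast
  obtain C2 :: real where C2: "C2 > 0" and ker:
    "\<And>J S a. finite J \<Longrightarrow> S \<subseteq> J \<Longrightarrow> (\<And>j. 0 \<le> a j) \<Longrightarrow>
       fock_mass p \<alpha> (kernel_sum \<alpha> a S) \<le> ennreal (C2 * (\<Sum>j\<in>J. a j powr p))"
    using fock_mass_kernel_sum_bound[OF p \<alpha>] by blast
  define C where "C = 2 * 2 powr q * exp (q * \<alpha>) * C1 * C2 powr (q / p)"
  have C: "C > 0" using C1 C2 by (simp add: C_def)
  have main: "(\<Sum>j\<in>J. ennreal (a j powr q) * cell_mass q \<alpha> \<psi> g j) \<le> ennreal (C * K powr q * (\<Sum>j\<in>J. a j powr p) powr (q / p))"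
    if g: "g holomorphic_on UNIV" and \<psi>: "\<psi> holomorphic_on UNIV" and K: "0 \<le> K"
      and bd: "\<And>u. u \<in> fock_space p \<alpha> \<Longrightarrow> fock_norm q \<alpha> (volterra_comp g \<psi> u) \<le> ennreal K * fock_norm p \<alpha> u"
      and J: "finite J" and a: "\<And>j. 0 \<le> a j" for g \<psi> K J a
  proof -
    define M where "M = C1 * K powr q * (C2 * (\<Sum>j\<in>J. a j powr p)) powr (q / p)"
    have "(\<Sum>j\<in>J. ennreal (a j powr q) * cell_mass q \<alpha> \<psi> g j) \<le> ennreal (2 * 2 powr q * exp (q * \<alpha>) * M)"
    proof (rule sum_cell_mass_le_embedding_mass[OF q \<alpha> g \<psi> J a])
      show "0 \<le> M" using C1 by (simp add: M_def)
      fix S assume S: "S \<subseteq> J"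
      have hol: "(kernel_sum \<alpha> a S) holomorphic_on UNIV"
        by (intro holomorphic_intros fock_kernel_holomorphic)
      show "embedding_mass q \<alpha> \<psi> g (kernel_sum \<alpha> a S) \<le> ennreal M"
        unfolding M_def
        by (rule emb[OF g \<psi> hol K _ bd ker[OF J S a]]) (use C2 in \<open>auto intro!: mult_nonneg_nonneg sum_nonneg\<close>)
    qed
    also have "2 * 2 powr q * exp (q * \<alpha>) * M = C * K powr q * (\<Sum>j\<in>J. a j powr p) powr (q / p)"
      by (simp add: M_def C_def powr_mult)
    finally show ?thesis .
  qed
  have fin: "cell_mass q \<alpha> \<psi> g j < \<infinity>"
    if "g holomorphic_on UNIV" "\<psi> holomorphic_on UNIV" "0 \<le> K"
      "\<And>u. u \<in> fock_space p \<alpha> \<Longrightarrow> fock_norm q \<alpha> (volterra_comp g \<psi> u) \<le> ennreal K * fock_norm p \<alpha> u" for g \<psi> K j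
  proof -
    have "(\<Sum>j\<in>{j}. ennreal (1 powr q) * cell_mass q \<alpha> \<psi> g j) < \<infinity>"
      by (rule le_less_trans[OF main[OF that]]) auto
    then show ?thesis by simp
  qed
  show thesis
  proof (rule that[OF C])
    show "cell_mass q \<alpha> \<psi> g j < \<infinity>"
      if "g holomorphic_on UNIV" "\<psi> holomorphic_on UNIV" "0 \<le> K"
        "\<And>u. u \<in> fock_space p \<alpha> \<Longrightarrow> fock_norm q \<alpha> (volterra_comp g \<psi> u) \<le> ennreal K * fock_norm p \<alpha> u" for g \<psi> K j
      using that by (rule fin)
  next
    fix g \<psi> :: "complex \<Rightarrow> complex" and K :: real and J :: "(int \<times> int) set"
    assume h: "g holomorphic_on UNIV" "\<psi> holomorphic_on UNIV" "0 \<le> K"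
      "\<And>u. u \<in> fock_space p \<alpha> \<Longrightarrow> fock_norm q \<alpha> (volterra_comp g \<psi> u) \<le> ennreal K * fock_norm p \<alpha> u"
      and J: "finite J"
    define m where "m j = enn2real (cell_mass q \<alpha> \<psi> g j)" for j
    have m: "cell_mass q \<alpha> \<psi> g j = ennreal (m j)" "m j \<ge> 0" for j
      using fin[OF h, of j] by (simp_all add: m_def)
    define X where "X = (\<Sum>j\<in>J. m j powr (p / (p - q)))"
    define a where "a j = m j powr (1 / (p - q))" for j
    have ap: "a j powr p = m j powr (p / (p - q))" for j by (simp add: a_def powr_powr)
    have aq: "a j powr q * m j = m j powr (p / (p - q))" for j
    proof (cases "m j = 0")
      case False
      then have "a j powr q * m j = m j powr (q / (p - q) + 1)"
        using m(2)[of j] by (simp add: a_def powr_powr powr_add)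
      also have "q / (p - q) + 1 = p / (p - q)" using qp by (simp add: field_simps)
      finally show ?thesis .
    qed simp
    have "ennreal X = (\<Sum>j\<in>J. ennreal (a j powr q) * cell_mass q \<alpha> \<psi> g j)"
      unfolding X_def m(1) by (simp add: aq flip: ennreal_mult')
    also have "\<dots> \<le> ennreal (C * K powr q * X powr (q / p))"
      using main[OF h J, of a] unfolding ap X_def by (simp add: a_def)
    finally have "X \<le> C * K powr q * X powr (q / p)"
      using C by (subst (asm) ennreal_le_iff) auto
    then have "X \<le> (C * K powr q) powr (p / (p - q))"
      by (intro le_powr_of_le_mult_powr q qp) (auto simp: X_def intro: sum_nonneg)
    then show "(\<Sum>j\<in>J. enn2real (cell_mass q \<alpha> \<psi> g j) powr (p / (p - q))) \<le> (C * K powr q) powr (p / (p - q))"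
      by (simp add: X_def m_def)
  qed
qed

section \<open>From cell masses to the Berezin transform\<close>

definition lattice_box :: "nat \<Rightarrow> (int \<times> int) set" where
  "lattice_box n = {- int n..int n} \<times> {- int n..int n}"

lemma lattice_box_mono: "m \<le> n \<Longrightarrow> lattice_box m \<subseteq> lattice_box n"
  by (auto simp: lattice_box_def)

lemma finite_lattice_box: "finite (lattice_box n)"
  by (simp add: lattice_box_def)

lemma in_lattice_box: "j \<in> lattice_box (nat (\<bar>fst j\<bar> + \<bar>snd j\<bar>))"
  by (cases j) (auto simp: lattice_box_def)

text \<open>Replacing \<open>\<psi> z\<close> by the corner of its unit square costs a factor and half of the exponent. Finite
  boxes of indices exhaust the lattice, which keeps all sums finite.\<close>
lemma berezin_le_SUP_cell_sums:
  fixes q \<alpha> :: real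
  assumes q: "0 < q" and \<alpha>: "0 < \<alpha>" and g: "g holomorphic_on UNIV" and \<psi>: "\<psi> holomorphic_on UNIV"
  shows "berezin q \<alpha> \<psi> g w \<le> (SUP n. \<Sum>j\<in>lattice_box n.
     ennreal (exp (q * \<alpha>) * lattice_gauss (q * \<alpha> / 4) w j) * cell_mass q \<alpha> \<psi> g j)"
proof -
  define c where "c = q * \<alpha> / 2"
  have c: "c > 0" using q \<alpha> by (simp add: c_def)
  define D where "D z = ennreal (carleson_density q \<alpha> \<psi> g z)" for z
  have [measurable]: "D \<in> borel_measurable borel" "\<psi> \<in> borel_measurable borel"
    using carleson_density_measurable[OF g \<psi>] \<psi> by (auto simp: D_def[abs_def] intro: entire_measurable)
  define E where "E j = ennreal (exp (q * \<alpha>) * lattice_gauss (q * \<alpha> / 4) w j)" for j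
  define u where "u n z = (\<Sum>j\<in>lattice_box n. E j * (D z * indicator {w. lattice_cell w = j} (\<psi> z)))" for n z
  have [measurable]: "u n \<in> borel_measurable borel" for n unfolding u_def by measurable
  have inc: "incseq u"
    unfolding u_def by (intro incseq_SucI le_funI sum_mono2 lattice_box_mono finite_lattice_box) auto
  have "berezin q \<alpha> \<psi> g w \<le> (\<integral>\<^sup>+z. (SUP n. u n z) \<partial>lborel)"
    unfolding berezin_eq_gaussian D_def[symmetric] c_def[symmetric]
  proof (rule nn_integral_mono)
    fix z
    define j where "j = lattice_cell (\<psi> z)"
    define n where "n = nat (\<bar>fst j\<bar> + \<bar>snd j\<bar>)"
    have "c * (dist w (lattice_pt j))\<^sup>2 \<le> c * (2 * (dist w (\<psi> z))\<^sup>2 + 4)"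
      unfolding j_def using c by (intro mult_left_mono dist_sq_le_lattice_pt) auto
    then have "- c * (dist (\<psi> z) w)\<^sup>2 \<le> 2 * c + - (c / 2) * (dist w (lattice_pt j))\<^sup>2" by (simp add: algebra_simps dist_commute)
    then have "exp (- c * (dist (\<psi> z) w)\<^sup>2) \<le> exp (2 * c) * exp (- (c / 2) * (dist w (lattice_pt j))\<^sup>2)"
      unfolding exp_add[symmetric] exp_le_cancel_iff .
    then have "ennreal (exp (- c * (dist (\<psi> z) w)\<^sup>2)) \<le> E j" by (simp add: E_def c_def ennreal_leI)
    then have "D z * ennreal (exp (- c * (dist (\<psi> z) w)\<^sup>2)) \<le> D z * E j" by (rule mult_left_mono) simp
    also have "\<dots> = (\<Sum>i\<in>{j}. E i * (D z * indicator {w. lattice_cell w = i} (\<psi> z)))" by (simp add: j_def mult.commute)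
    also have "\<dots> \<le> u n z"
      unfolding u_def n_def by (intro sum_mono2 finite_lattice_box) (auto simp: in_lattice_box)
    also have "\<dots> \<le> (SUP n. u n z)" by (rule SUP_upper) simp
    finally show "D z * ennreal (exp (- c * (dist (\<psi> z) w)\<^sup>2)) \<le> (SUP n. u n z)" .
  qed
  also have "\<dots> = (SUP n. \<integral>\<^sup>+z. u n z \<partial>lborel)"
    by (rule nn_integral_monotone_convergence_SUP[OF inc]) measurable
  also have "\<dots> = (SUP n. \<Sum>j\<in>lattice_box n. E j * cell_mass q \<alpha> \<psi> g j)"
    unfolding u_def cell_mass_def D_def[symmetric]
    by (subst nn_integral_sum) (simp_all add: nn_integral_cmult)
  finally show ?thesis unfolding E_def .
qed

text \<open>The power of the Berezin transform is bounded by a supremum of powers of finite Gaussian sums,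
  to which monotone convergence and \<open>lattice_superposition_bound\<close> apply.\<close>
lemma berezin_norm_le_of_norm_bound:
  fixes p q \<alpha> :: real
  assumes q: "0 < q" and qp: "q < p" and \<alpha>: "0 < \<alpha>"
  obtains C :: real where "C > 0"
    "\<And>g \<psi> K. \<lbrakk>g holomorphic_on UNIV; \<psi> holomorphic_on UNIV; 0 \<le> K;
       \<And>u. u \<in> fock_space p \<alpha> \<Longrightarrow> fock_norm q \<alpha> (volterra_comp g \<psi> u) \<le> ennreal K * fock_norm p \<alpha> u\<rbrakk> \<Longrightarrow>
       epowr (berezin_integral p q \<alpha> \<psi> g) ((p - q) / (p * q)) \<le> ennreal (C * K)"
proof -
  have p: "p > 0" using q qp by simp
  define r where "r = p / (p - q)"
  have r: "r > 0" using p qp by (simp add: r_def)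
  obtain C1 :: real where C1: "C1 > 0" and fin:
    "\<And>g \<psi> K j. \<lbrakk>g holomorphic_on UNIV; \<psi> holomorphic_on UNIV; 0 \<le> K;
       \<And>u. u \<in> fock_space p \<alpha> \<Longrightarrow> fock_norm q \<alpha> (volterra_comp g \<psi> u) \<le> ennreal K * fock_norm p \<alpha> u\<rbrakk> \<Longrightarrow>
       cell_mass q \<alpha> \<psi> g j < \<infinity>"
    and cells: "\<And>g \<psi> K J. \<lbrakk>g holomorphic_on UNIV; \<psi> holomorphic_on UNIV; 0 \<le> K;
       \<And>u. u \<in> fock_space p \<alpha> \<Longrightarrow> fock_norm q \<alpha> (volterra_comp g \<psi> u) \<le> ennreal K * fock_norm p \<alpha> u; finite J\<rbrakk> \<Longrightarrow>
       (\<Sum>j\<in>J. enn2real (cell_mass q \<alpha> \<psi> g j) powr r) \<le> (C1 * K powr q) powr r"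
    using sum_cell_mass_powr_bound[OF q qp \<alpha>] unfolding r_def by blast
  obtain C2 :: real where C2: "C2 > 0" and sup: "\<And>J a. finite J \<Longrightarrow> (\<And>j. 0 \<le> a j) \<Longrightarrow>
       (\<integral>\<^sup>+\<zeta>. ennreal ((\<Sum>j\<in>J. a j * lattice_gauss (q * \<alpha> / 4) \<zeta> j) powr r) \<partial>lborel) \<le> ennreal (C2 * (\<Sum>j\<in>J. a j powr r))"
    using lattice_superposition_bound[of "q * \<alpha> / 4" r] q \<alpha> r by auto
  define E where "E = exp (q * \<alpha>) powr r * C2"
  have E: "E > 0" using C2 by (simp add: E_def)
  define t where "t = (p - q) / (p * q)"
  have t: "t > 0" "r * t = 1 / q" using p q qp by (simp_all add: t_def r_def)
  show thesis
  proof (rule that[of "E powr t * C1 powr (1 / q)"])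
    show "E powr t * C1 powr (1 / q) > 0" using E C1 by simp
    fix g \<psi> :: "complex \<Rightarrow> complex" and K :: real
    assume h: "g holomorphic_on UNIV" "\<psi> holomorphic_on UNIV" "0 \<le> K"
      "\<And>u. u \<in> fock_space p \<alpha> \<Longrightarrow> fock_norm q \<alpha> (volterra_comp g \<psi> u) \<le> ennreal K * fock_norm p \<alpha> u"
    define m where "m j = enn2real (cell_mass q \<alpha> \<psi> g j)" for j
    have m: "cell_mass q \<alpha> \<psi> g j = ennreal (m j)" "m j \<ge> 0" for j
      using fin[OF h, of j] by (simp_all add: m_def)
    define s where "s n w = (\<Sum>j\<in>lattice_box n. m j * lattice_gauss (q * \<alpha> / 4) w j)" for n w
    have s0: "s n w \<ge> 0" for n w unfolding s_def using m by (intro sum_nonneg) auto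
    have [measurable]: "s n \<in> borel_measurable borel" for n unfolding s_def by measurable
    have sinc: "s n w \<le> s (Suc n) w" for n w
      unfolding s_def using m by (intro sum_mono2 lattice_box_mono finite_lattice_box) auto
    define x where "x n w = ennreal ((exp (q * \<alpha>) * s n w) powr r)" for n w
    have [measurable]: "x n \<in> borel_measurable borel" for n unfolding x_def by measurable
    have inc: "incseq x"
      unfolding x_def using r sinc s0
      by (intro incseq_SucI le_funI ennreal_leI powr_mono2 mult_left_mono) auto
    have B: "berezin q \<alpha> \<psi> g w \<le> (SUP n. ennreal (exp (q * \<alpha>) * s n w))" for w
    proof -
      have "(\<Sum>j\<in>lattice_box n. ennreal (exp (q * \<alpha>) * lattice_gauss (q * \<alpha> / 4) w j) * cell_mass q \<alpha> \<psi> g j)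
         = ennreal (exp (q * \<alpha>) * s n w)" for n
      proof -
        have "(\<Sum>j\<in>lattice_box n. ennreal (exp (q * \<alpha>) * lattice_gauss (q * \<alpha> / 4) w j) * cell_mass q \<alpha> \<psi> g j)
          = (\<Sum>j\<in>lattice_box n. ennreal (exp (q * \<alpha>) * (m j * lattice_gauss (q * \<alpha> / 4) w j)))"
          unfolding m(1) by (intro sum.cong refl) (simp add: mult_ac m(2) flip: ennreal_mult')
        also have "\<dots> = ennreal (\<Sum>j\<in>lattice_box n. exp (q * \<alpha>) * (m j * lattice_gauss (q * \<alpha> / 4) w j))"
          using m by (intro sum_ennreal) simp
        finally show ?thesis by (simp add: s_def sum_distrib_left)
      qed
      then show ?thesis using berezin_le_SUP_cell_sums[OF q \<alpha> h(1,2), of w] by simp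
    qed
    have "epowr (berezin q \<alpha> \<psi> g w) r \<le> (SUP n. x n w)" for w
    proof -
      have "ennreal (exp (q * \<alpha>) * s n w) \<le> epowr (SUP n. x n w) (1 / r)" for n
      proof -
        have "epowr (ennreal (exp (q * \<alpha>) * s n w)) r = x n w" using s0 by (simp add: x_def epowr_ennreal)
        also have "\<dots> \<le> (SUP n. x n w)" by (rule SUP_upper) simp
        finally show ?thesis using r by (simp add: epowr_le_iff)
      qed
      then have "berezin q \<alpha> \<psi> g w \<le> epowr (SUP n. x n w) (1 / r)" by (intro order_trans[OF B] SUP_least)
      then show ?thesis using r by (simp add: epowr_le_iff)
    qed
    then have "(\<integral>\<^sup>+w. epowr (berezin q \<alpha> \<psi> g w) r \<partial>lborel) \<le> (\<integral>\<^sup>+w. (SUP n. x n w) \<partial>lborel)"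
      by (intro nn_integral_mono)
    also have "\<dots> = (SUP n. \<integral>\<^sup>+w. x n w \<partial>lborel)"
      by (rule nn_integral_monotone_convergence_SUP[OF inc]) measurable
    also have "\<dots> \<le> ennreal (E * (C1 * K powr q) powr r)"
    proof (rule SUP_least)
      fix n
      have "(\<integral>\<^sup>+w. x n w \<partial>lborel) = ennreal (exp (q * \<alpha>) powr r) * (\<integral>\<^sup>+w. ennreal (s n w powr r) \<partial>lborel)"
        unfolding x_def powr_mult ennreal_mult'[OF powr_ge_zero] by (rule nn_integral_cmult) measurable
      also have "\<dots> \<le> ennreal (exp (q * \<alpha>) powr r) * ennreal (C2 * (\<Sum>j\<in>lattice_box n. m j powr r))"
        unfolding s_def using m by (intro mult_left_mono sup finite_lattice_box) auto
      also have "\<dots> \<le> ennreal (exp (q * \<alpha>) powr r) * ennreal (C2 * (C1 * K powr q) powr r)"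
        using cells[OF h finite_lattice_box, of n] C2
        by (intro mult_left_mono ennreal_leI) (auto simp: m_def)
      also have "\<dots> = ennreal (E * (C1 * K powr q) powr r)" by (simp add: E_def mult.assoc ennreal_mult')
      finally show "(\<integral>\<^sup>+w. x n w \<partial>lborel) \<le> ennreal (E * (C1 * K powr q) powr r)" .
    qed
    finally have "epowr (\<integral>\<^sup>+w. epowr (berezin q \<alpha> \<psi> g w) r \<partial>lborel) t \<le> epowr (ennreal (E * (C1 * K powr q) powr r)) t"
      using t(1) by (intro epowr_mono)
    also have "\<dots> = ennreal ((E * (C1 * K powr q) powr r) powr t)" using E by (intro epowr_ennreal) simp
    also have "(E * (C1 * K powr q) powr r) powr t = E powr t * C1 powr (1 / q) * K"
    proof -
      have "q * r * t = 1" using t(2) q by (simp add: mult.assoc)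
      then show ?thesis using t(2) h(3) by (simp add: powr_mult powr_powr)
    qed
    finally show "epowr (berezin_integral p q \<alpha> \<psi> g) ((p - q) / (p * q)) \<le> ennreal (E powr t * C1 powr (1 / q) * K)"
      unfolding r_def t_def .
  qed
qed

theorem theorem2:
  fixes p q \<alpha> :: real
  assumes "0 < q" and "q < p" and "0 < \<alpha>"
  shows "(\<forall>g \<psi>. g holomorphic_on UNIV \<and> \<psi> holomorphic_on UNIV \<longrightarrow>
            (fock_bounded p q \<alpha> (volterra_comp g \<psi>) \<longleftrightarrow> fock_compact p q \<alpha> (volterra_comp g \<psi>)) \<and>
            (fock_compact p q \<alpha> (volterra_comp g \<psi>) \<longleftrightarrow> berezin q \<alpha> \<psi> g \<in> Lr (p / (p - q)))) \<and>
         (\<exists>C::real. C > 0 \<and>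
            (\<forall>g \<psi>. g holomorphic_on UNIV \<and> \<psi> holomorphic_on UNIV \<and>
               fock_bounded p q \<alpha> (volterra_comp g \<psi>) \<longrightarrow>
               fock_opnorm p q \<alpha> (volterra_comp g \<psi>) \<le>
                 ennreal C * epowr (\<integral>\<^sup>+w. epowr (berezin q \<alpha> \<psi> g w) (p / (p - q)) \<partial>lborel)
                               ((p - q) / (p * q)) \<and>
               epowr (\<integral>\<^sup>+w. epowr (berezin q \<alpha> \<psi> g w) (p / (p - q)) \<partial>lborel)
                   ((p - q) / (p * q)) \<le>
                 ennreal C * fock_opnorm p q \<alpha> (volterra_comp g \<psi>)))"
proof -
  note q = assms(1) and qp = assms(2) and \<alpha> = assms(3)
  have p: "p > 0" using q qp by simp
  define I where "I g \<psi> = (\<integral>\<^sup>+w. epowr (berezin q \<alpha> \<psi> g w) (p / (p - q)) \<partial>lborel)" for g \<psi>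
  obtain C1 :: real where C1: "C1 > 0" and upper:
    "\<And>f g \<psi>. \<lbrakk>g holomorphic_on UNIV; \<psi> holomorphic_on UNIV; f \<in> fock_space p \<alpha>; fock_norm p \<alpha> f \<le> 1\<rbrakk> \<Longrightarrow>
       fock_norm q \<alpha> (volterra_comp g \<psi> f) \<le> ennreal C1 * epowr (I g \<psi>) ((p - q) / (p * q))"
    using volterra_comp_norm_le_berezin[OF q qp \<alpha>] unfolding I_def by blast
  obtain C2 :: real where C2: "C2 > 0" and lower:
    "\<And>g \<psi> K. \<lbrakk>g holomorphic_on UNIV; \<psi> holomorphic_on UNIV; 0 \<le> K;
       \<And>u. u \<in> fock_space p \<alpha> \<Longrightarrow> fock_norm q \<alpha> (volterra_comp g \<psi> u) \<le> ennreal K * fock_norm p \<alpha> u\<rbrakk> \<Longrightarrow>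
       epowr (I g \<psi>) ((p - q) / (p * q)) \<le> ennreal (C2 * K)"
    using berezin_norm_le_of_norm_bound[OF q qp \<alpha>] unfolding I_def by blast
  have Lr: "berezin q \<alpha> \<psi> g \<in> Lr (p / (p - q)) \<longleftrightarrow> I g \<psi> < \<infinity>"
    if "g holomorphic_on UNIV" "\<psi> holomorphic_on UNIV" for g \<psi>
    using berezin_measurable[OF that] by (simp add: Lr_def I_def)
  have bounded_imp: "I g \<psi> < \<infinity>" if g: "g holomorphic_on UNIV" "\<psi> holomorphic_on UNIV" and bd: "fock_bounded p q \<alpha> (volterra_comp g \<psi>)" for g \<psi>
  proof -
    obtain K where "\<And>f. f \<in> fock_space p \<alpha> \<Longrightarrow> fock_norm q \<alpha> (volterra_comp g \<psi> f) \<le> ennreal K * fock_norm p \<alpha> f"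
      using bd by (auto simp: fock_bounded_def)
    then have "fock_norm q \<alpha> (volterra_comp g \<psi> f) \<le> ennreal (max 0 K) * fock_norm p \<alpha> f" if "f \<in> fock_space p \<alpha>" for f
      using that by (metis ennreal_eq_0_iff le_cases max.absorb1 max.absorb2 order_refl ennreal_0)
    then have "epowr (I g \<psi>) ((p - q) / (p * q)) \<le> ennreal (C2 * max 0 K)" by (intro lower g) auto
    also have "\<dots> < \<infinity>" by simp
    finally show ?thesis by (simp only: epowr_less_top_iff)
  qed
  have imp_compact: "fock_compact p q \<alpha> (volterra_comp g \<psi>)" if "g holomorphic_on UNIV" "\<psi> holomorphic_on UNIV" "I g \<psi> < \<infinity>" for g \<psi>
    using fock_compact_volterra_comp_of_berezin[OF q qp \<alpha> that(1,2)] that(3) by (simp add: I_def)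
  have compact_imp: "fock_bounded p q \<alpha> (volterra_comp g \<psi>)" if "g holomorphic_on UNIV" "\<psi> holomorphic_on UNIV" "fock_compact p q \<alpha> (volterra_comp g \<psi>)" for g \<psi>
    using fock_compact_imp_fock_bounded[OF p q \<alpha> that] .
  have norms: "fock_opnorm p q \<alpha> (volterra_comp g \<psi>) \<le> ennreal (max C1 C2) * epowr (I g \<psi>) ((p - q) / (p * q)) \<and>
     epowr (I g \<psi>) ((p - q) / (p * q)) \<le> ennreal (max C1 C2) * fock_opnorm p q \<alpha> (volterra_comp g \<psi>)"
    if g: "g holomorphic_on UNIV" and \<psi>: "\<psi> holomorphic_on UNIV" and bd: "fock_bounded p q \<alpha> (volterra_comp g \<psi>)" for g \<psi>
  proof
    define N where "N = fock_opnorm p q \<alpha> (volterra_comp g \<psi>)"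
    have "N \<le> ennreal C1 * epowr (I g \<psi>) ((p - q) / (p * q))"
      unfolding N_def fock_opnorm_def by (rule SUP_least) (use upper[OF g \<psi>] in auto)
    also have "\<dots> \<le> ennreal (max C1 C2) * epowr (I g \<psi>) ((p - q) / (p * q))" by (intro mult_right_mono ennreal_leI) auto
    finally show "fock_opnorm p q \<alpha> (volterra_comp g \<psi>) \<le> ennreal (max C1 C2) * epowr (I g \<psi>) ((p - q) / (p * q))"
      by (simp add: N_def)
    have "epowr (I g \<psi>) ((p - q) / (p * q)) < \<infinity>" using bounded_imp[OF that] by (simp only: epowr_less_top_iff)
    then have "N < \<infinity>"
      using \<open>N \<le> ennreal C1 * epowr (I g \<psi>) ((p - q) / (p * q))\<close> by (auto simp: ennreal_mult_less_top intro: le_less_trans)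
    then obtain K where K: "N = ennreal K" "K \<ge> 0" by (cases N rule: epowr_cases) auto
    have "fock_norm q \<alpha> (volterra_comp g \<psi> f) \<le> ennreal K" if "f \<in> fock_space p \<alpha>" "fock_norm p \<alpha> f \<le> 1" for f
      unfolding K(1)[symmetric] N_def fock_opnorm_def using that by (intro SUP_upper) auto
    then have "fock_norm q \<alpha> (volterra_comp g \<psi> f) \<le> ennreal K * fock_norm p \<alpha> f" if "f \<in> fock_space p \<alpha>" for f
      using volterra_comp_bound_from_unit_ball[OF p q \<alpha> g \<psi> _ that] by blast
    then have "epowr (I g \<psi>) ((p - q) / (p * q)) \<le> ennreal (C2 * K)" by (intro lower g \<psi> K)
    also have "\<dots> = ennreal C2 * N" using C2 K by (simp add: ennreal_mult')
    also have "\<dots> \<le> ennreal (max C1 C2) * N" by (intro mult_right_mono ennreal_leI) auto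
    finally show "epowr (I g \<psi>) ((p - q) / (p * q)) \<le> ennreal (max C1 C2) * fock_opnorm p q \<alpha> (volterra_comp g \<psi>)"
      by (simp add: N_def)
  qed
  have equiv: "(fock_bounded p q \<alpha> (volterra_comp g \<psi>) \<longleftrightarrow> fock_compact p q \<alpha> (volterra_comp g \<psi>)) \<and>
      (fock_compact p q \<alpha> (volterra_comp g \<psi>) \<longleftrightarrow> berezin q \<alpha> \<psi> g \<in> Lr (p / (p - q)))"
    if "g holomorphic_on UNIV \<and> \<psi> holomorphic_on UNIV" for g \<psi>
    using that Lr bounded_imp imp_compact compact_imp by blast
  have "max C1 C2 > 0" using C1 by simp
  then show ?thesis using equiv norms unfolding I_def by blast
qed

end
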